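(* Let $n$ be a positive integer, let $T_0>0$ and $s>3/2$, and let $u\in C^0([0,T_0];H^s(\mathbb{R}))$ be a solution of $$u_t-u_{txx}+\frac{(n+1)(n+2)}{2}u^nu_x=\frac{n(n-1)}{2}u^{n-2}u_x^3+2n u^{n-1}u_xu_{xx}+u^n u_{xxx}$$ with initial condition $u(0,x)=u_0(x)$. Assume that: (1) $n$ is odd; (2) for some $\alpha\in(1/(n+1),1)$, $$|u_0(x)|\sim o(e^{-x})\quad\text{and}\quad |u_0'(x)|\sim O(e^{-\alpha x})\quad\text{as } x\to+\infty;$$ (3) there exists $t_1\in[0,T_0]$, $t_1>0$, such that $$|u(t_1,x)|\sim o(e^{-x})\quad\text{as } x\to+\infty.$$ Then $u\equiv0$.
   Context: Notation: $|f(x)|\sim O(e^{ax})$ as $x\to+\infty$ means that there exists some (finite) $L$ (possibly $L=0$) such that $\lim_{x\to\infty}|f(x)|/e^{ax}=L$; $|f(x)|\sim o(e^{ax})$ as $x\to+\infty$ means $\lim_{x\to\infty}|f(x)|/e^{ax}=0$. Solutions: the equation is understood in the equivalent nonlocal form $$u_t+u^nu_x+\partial_x(1-\partial_x^2)^{-1}\left(\frac n2u^{n-1}u_x^2+\frac{n(n+3)}{2(n+1)}u^{n+1}\right)=0,$$ where $(1-\partial_x^2)^{-1}f=g*f$ with $g(x)=e^{-|x|}/2$. For $u_0\in H^s(\mathbb{R})$, $s>3/2$, the Cauchy problem has a unique solution $u\in C^0([0,T);H^s(\mathbb{R}))\cap C^1([0,T);H^{s-1}(\mathbb{R}))$ for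 some $T>0$; here $T_0\in(0,T)$ is arbitrary and $u$ is this (real-valued) solution restricted to $[0,T_0]$. *)

theory Defs
  imports "HOL-Analysis.Analysis"
begin

definition square_integrable :: "(real \<Rightarrow> complex) \<Rightarrow> bool" where
  "square_integrable f \<longleftrightarrow>
     f \<in> borel_measurable lborel \<and> integrable lborel (\<lambda>x. (cmod (f x))\<^sup>2)"

(* F is the Plancherel transform of f: the limit in L^2, as R tends to infinity, of the
   integrals of exp (- i x \<xi>) f x over [-R, R].  F is determined up to a null set. *)
definition is_fourier_L2 :: "(real \<Rightarrow> complex) \<Rightarrow> (real \<Rightarrow> complex) \<Rightarrow> bool" where
  "is_fourier_L2 f F \<longleftrightarrow> square_integrable f \<and> square_integrable F \<and>
     ((\<lambda>R. \<integral>\<^sup>+\<xi>. ennreal ((cmod (F \<xi> - (LINT x:{-R..R}|lborel. cis (- (x * \<xi>)) * f x)))\<^sup>2) \<partial>lborel)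
        \<longlongrightarrow> 0) at_top"

(* The real-valued part of H^s(R).  As elements are required to lie in L^2, this is the usual
   space for s \<ge> 0 only.  Elements are functions, not classes modulo null sets. *)
definition sobolev_space :: "real \<Rightarrow> (real \<Rightarrow> real) set" where
  "sobolev_space s = {f. \<exists>F. is_fourier_L2 (\<lambda>x. complex_of_real (f x)) F \<and>
     integrable lborel (\<lambda>\<xi>. (1 + \<xi>\<^sup>2) powr s * (cmod (F \<xi>))\<^sup>2)}"

(* Meaningful on sobolev_space s only; there the value does not depend on the choice of F. *)
definition sobolev_norm :: "real \<Rightarrow> (real \<Rightarrow> real) \<Rightarrow> real" where
  "sobolev_norm s f =
     (let F = (SOME F. is_fourier_L2 (\<lambda>x. complex_of_real (f x)) F)
      in sqrt (LINT \<xi>|lborel. (1 + \<xi>\<^sup>2) powr s * (cmod (F \<xi>))\<^sup>2))"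

definition C0_sobolev :: "real set \<Rightarrow> real \<Rightarrow> (real \<Rightarrow> real \<Rightarrow> real) \<Rightarrow> bool" where
  "C0_sobolev I s u \<longleftrightarrow> (\<forall>t\<in>I. u t \<in> sobolev_space s \<and>
     ((\<lambda>\<tau>. sobolev_norm s (\<lambda>x. u \<tau> x - u t x)) \<longlongrightarrow> 0) (at t within I))"

(* v is the strong derivative of the curve t \<mapsto> u t in H^s, one-sided at end points of I. *)
definition has_sobolev_time_derivative ::
  "real set \<Rightarrow> real \<Rightarrow> (real \<Rightarrow> real \<Rightarrow> real) \<Rightarrow> (real \<Rightarrow> real \<Rightarrow> real) \<Rightarrow> bool" where
  "has_sobolev_time_derivative I s u v \<longleftrightarrow>
     (\<forall>t\<in>I. u t \<in> sobolev_space s \<and> v t \<in> sobolev_space s \<and>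
       ((\<lambda>\<tau>. sobolev_norm s (\<lambda>x. (u \<tau> x - u t x) / (\<tau> - t) - v t x)) \<longlongrightarrow> 0) (at t within I))"

(* (1 - d^2/dx^2)^(-1) f, that is, g * f with g x = exp (-|x|) / 2. *)
definition inv_helmholtz :: "(real \<Rightarrow> real) \<Rightarrow> real \<Rightarrow> real" where
  "inv_helmholtz f x = (LINT y|lborel. exp (- \<bar>x - y\<bar>) / 2 * f y)"

(* Solution of the nonlocal form of the equation, in C^0(I; H^s) and C^1(I; H^(s-1)).
   Continuity of u t selects the continuous representative of the H^s class; for s > 3/2 it is
   continuously differentiable, so that deriv (u t) is the spatial derivative at every point.
   The equation is an identity in H^(s-1), hence holds almost everywhere in x. *)
definition gCH_solution :: "nat \<Rightarrow> real \<Rightarrow> real set \<Rightarrow> (real \<Rightarrow> real \<Rightarrow> real) \<Rightarrow> bool" where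
  "gCH_solution n s I u \<longleftrightarrow>
     (\<forall>t\<in>I. continuous_on UNIV (u t)) \<and> C0_sobolev I s u \<and>
     (\<exists>u\<^sub>t. has_sobolev_time_derivative I (s - 1) u u\<^sub>t \<and> C0_sobolev I (s - 1) u\<^sub>t \<and>
       (\<forall>t\<in>I. AE x in lborel.
          u\<^sub>t t x + u t x ^ n * deriv (u t) x
          + deriv (inv_helmholtz (\<lambda>y. real n / 2 * u t y ^ (n - 1) * (deriv (u t) y)\<^sup>2
              + real n * (real n + 3) / (2 * (real n + 1)) * u t y ^ (n + 1))) x = 0))"

(* |f x| ~ O(exp (a x)) in the sense that the quotient has a finite limit, which is stronger
   than boundedness of the quotient. *)
definition sim_bigo_exp :: "(real \<Rightarrow> real) \<Rightarrow> real \<Rightarrow> bool" where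
  "sim_bigo_exp f a \<longleftrightarrow> (\<exists>L::real. ((\<lambda>x. \<bar>f x\<bar> / exp (a * x)) \<longlongrightarrow> L) at_top)"

definition sim_smallo_exp :: "(real \<Rightarrow> real) \<Rightarrow> real \<Rightarrow> bool" where
  "sim_smallo_exp f a \<longleftrightarrow> ((\<lambda>x. \<bar>f x\<bar> / exp (a * x)) \<longlongrightarrow> 0) at_top"

end

theory Submission
  imports Defs "HOL-Probability.Characteristic_Functions"
begin

text \<open>
  Since \<open>n\<close> is odd, the source \<open>F = n/2 u\<^sup>n\<^sup>-\<^sup>1 u\<^sub>x\<^sup>2 + n(n+3)/(2(n+1)) u\<^sup>n\<^sup>+\<^sup>1\<close> is nonnegative. The decay of
  the initial data at the rate \<open>exp (-\<alpha>x)\<close> persists for \<open>u\<close> and \<open>u\<^sub>x\<close>, hence \<open>u\<^sup>nu\<^sub>x\<close> and \<open>F\<close> are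
  \<open>O(exp (-(n+1)\<alpha>x))\<close>, which is \<open>o(exp (-x))\<close>. The kernel \<open>exp (-\<bar>x\<bar>)/2\<close>, in contrast, decays only
  like \<open>exp (-x)\<close>, so that \<open>exp x \<cdot> u\<^sub>t\<close> tends to half the integral of \<open>exp y \<cdot> F\<close> over the line. If
  \<open>u(0)\<close> did not vanish, \<open>exp x \<cdot> (u(t\<^sub>1,x) - u(0,x))\<close> would therefore stay above a positive constant
  as \<open>x \<rightarrow> \<infinity>\<close>. So \<open>u(0) = 0\<close>, and persistence with zero initial data gives \<open>u = 0\<close>.

  Persistence is a maximum principle for \<open>\<phi> u\<close> and for \<open>\<phi>(x) (u(x+h) - u(x))/h\<close>, where \<open>\<phi>\<close> is a bounded
  regularisation of \<open>exp (\<alpha>x)\<close>. The difference quotient replaces \<open>u\<^sub>x\<close>, which is merely continuous.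
  The classical regularity needed for this follows from Fourier inversion for continuous \<open>L\<^sup>2\<close>
  functions with integrable transform, obtained by pairing with Gaussians.
\<close>

section \<open>Real integrals\<close>

text \<open>The bound \<alpha> > 1/(n+1) makes products of n+1 decaying factors beat exp (-x); the
  bound \<alpha> < 1 lets the weight exp (\<alpha> x) survive convolution with the kernel, at the
  cost of a factor 1/(1-\<alpha>). Oddness of n makes both n-1 and n+1 even. Regularity is the
  obstacle: s > 3/2 makes u_x continuous but provides no u_xx, and u_t lives in H^(s-1) only. Three
  facts compensate. As s-1 > 1/2, the almost everywhere equation becomes a pointwise one. The
  nonlocal term is P' with P = g * F, and P'' = P - F needs no derivative of F. At a maximum of the
  weighted difference quotient, the vanishing space derivative expresses the difference of u_x
  values, which stands for u_xx, through the derivative of the weight. The weight has to be bounded: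
  otherwise the supremum under study might be infinite from the start, and a maximum need not be
  attained. Decay of u at infinity, from u in L^2 and bounded u_x, provides the maximum
  point.\<close>

lemma cauchy_schwarz_integral:
  fixes f g :: "'a \<Rightarrow> real"
  assumes [measurable]: "f \<in> borel_measurable M" "g \<in> borel_measurable M"
    and f: "integrable M (\<lambda>x. (f x)\<^sup>2)" and g: "integrable M (\<lambda>x. (g x)\<^sup>2)"
  shows "integrable M (\<lambda>x. f x * g x)"
    and "(LINT x|M. \<bar>f x * g x\<bar>) \<le> sqrt (LINT x|M. (f x)\<^sup>2) * sqrt (LINT x|M. (g x)\<^sup>2)"
proof -
  show int: "integrable M (\<lambda>x. f x * g x)"
  proof (rule Bochner_Integration.integrable_bound)
    show "integrable M (\<lambda>x. (f x)\<^sup>2 + (g x)\<^sup>2)" using f g by simp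
    have "\<bar>a * b\<bar> \<le> a\<^sup>2 + b\<^sup>2" for a b :: real
    proof -
      have "2 * (\<bar>a\<bar> * \<bar>b\<bar>) \<le> a\<^sup>2 + b\<^sup>2"
        using sum_squares_bound[of "\<bar>a\<bar>" "\<bar>b\<bar>"] by (simp add: mult.assoc)
      then show ?thesis by (simp add: abs_mult) (smt (verit) mult_nonneg_nonneg)
    qed
    then show "AE x in M. norm (f x * g x) \<le> norm ((f x)\<^sup>2 + (g x)\<^sup>2)"
      by simp
  qed simp
  have "(\<integral>\<^sup>+x. ennreal \<bar>f x\<bar> * ennreal \<bar>g x\<bar> \<partial>M)\<^sup>2
      \<le> (\<integral>\<^sup>+x. (ennreal \<bar>f x\<bar>)\<^sup>2 \<partial>M) * (\<integral>\<^sup>+x. (ennreal \<bar>g x\<bar>)\<^sup>2 \<partial>M)"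
    by (rule Cauchy_Schwarz_nn_integral) simp_all
  also have "(\<integral>\<^sup>+x. ennreal \<bar>f x\<bar> * ennreal \<bar>g x\<bar> \<partial>M) = ennreal (LINT x|M. \<bar>f x * g x\<bar>)"
    using integrable_abs[OF int] by (subst nn_integral_eq_integral[symmetric])
      (auto simp: abs_mult ennreal_mult intro!: nn_integral_cong)
  also have "(\<integral>\<^sup>+x. (ennreal \<bar>f x\<bar>)\<^sup>2 \<partial>M) = ennreal (LINT x|M. (f x)\<^sup>2)"
    using f by (subst nn_integral_eq_integral[symmetric])
      (auto simp: ennreal_power intro!: nn_integral_cong)
  also have "(\<integral>\<^sup>+x. (ennreal \<bar>g x\<bar>)\<^sup>2 \<partial>M) = ennreal (LINT x|M. (g x)\<^sup>2)"
    using g by (subst nn_integral_eq_integral[symmetric])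
      (auto simp: ennreal_power intro!: nn_integral_cong)
  finally have "(LINT x|M. \<bar>f x * g x\<bar>)\<^sup>2 \<le> (LINT x|M. (f x)\<^sup>2) * (LINT x|M. (g x)\<^sup>2)"
    by (simp add: ennreal_power flip: ennreal_mult)
  then show "(LINT x|M. \<bar>f x * g x\<bar>) \<le> sqrt (LINT x|M. (f x)\<^sup>2) * sqrt (LINT x|M. (g x)\<^sup>2)"
    by (simp add: real_le_rsqrt flip: real_sqrt_mult)
qed

text \<open>The mean value theorem turns the bound on \<open>f'\<close> into a Lipschitz bound in x
  with constant \<open>w \<xi>\<close>, so \<open>w\<close> dominates all difference quotients;
  along sequences the limit is then dominated convergence.\<close>

lemma has_real_derivative_lebesgue_integral:
  fixes f f' :: "real \<Rightarrow> 'a \<Rightarrow> real"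
  assumes deriv: "\<And>x \<xi>. ((\<lambda>x. f x \<xi>) has_real_derivative f' x \<xi>) (at x)"
    and bound: "\<And>x \<xi>. \<bar>f' x \<xi>\<bar> \<le> w \<xi>" and w: "integrable M w"
    and f: "\<And>x. integrable M (f x)" and f': "\<And>x. f' x \<in> borel_measurable M"
  shows "((\<lambda>x. LINT \<xi>|M. f x \<xi>) has_real_derivative (LINT \<xi>|M. f' x \<xi>)) (at x)"
proof -
  have fm[measurable]: "f x \<in> borel_measurable M" for x using f by auto
  have lip: "\<bar>f y \<xi> - f x \<xi>\<bar> \<le> w \<xi> * \<bar>y - x\<bar>" for x y \<xi>
    using field_differentiable_bound[of UNIV "\<lambda>x. f x \<xi>" "\<lambda>x. f' x \<xi>" "w \<xi>" y x] deriv bound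
    by (auto simp: mult.commute dest: has_field_derivative_at_within)
  have "((\<lambda>h. ((LINT \<xi>|M. f (x + h) \<xi>) - (LINT \<xi>|M. f x \<xi>)) / h) \<longlongrightarrow> (LINT \<xi>|M. f' x \<xi>)) (at 0)"
    unfolding tendsto_at_iff_sequentially comp_def
  proof (intro allI impI)
    fix X :: "nat \<Rightarrow> real"
    assume X: "\<forall>i. X i \<in> UNIV - {0}" and X0: "X \<longlonglongrightarrow> 0"
    have "(\<lambda>i. LINT \<xi>|M. (f (x + X i) \<xi> - f x \<xi>) / X i) \<longlonglongrightarrow> (LINT \<xi>|M. f' x \<xi>)"
    proof (rule integral_dominated_convergence[where w = w])
      show "AE \<xi> in M. (\<lambda>i. (f (x + X i) \<xi> - f x \<xi>) / X i) \<longlonglongrightarrow> f' x \<xi>"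
        using deriv[of _ x] X X0 unfolding DERIV_def tendsto_at_iff_sequentially comp_def by auto
      fix i
      have "X i \<noteq> 0" using X by auto
      then show "AE \<xi> in M. norm ((f (x + X i) \<xi> - f x \<xi>) / X i) \<le> w \<xi>"
        using lip[of "x + X i" _ x] by (auto simp: divide_le_eq)
    qed (use w f' in auto)
    then show "(\<lambda>i. ((LINT \<xi>|M. f (x + X i) \<xi>) - (LINT \<xi>|M. f x \<xi>)) / X i) \<longlonglongrightarrow> (LINT \<xi>|M. f' x \<xi>)"
      using f by simp
  qed
  then show ?thesis by (simp add: DERIV_def)
qed

lemma isCont_lebesgue_integral:
  fixes f :: "real \<Rightarrow> 'a \<Rightarrow> real"
  assumes cont: "\<And>\<xi>. isCont (\<lambda>x. f x \<xi>) x"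
    and bound: "\<And>x \<xi>. \<bar>f x \<xi>\<bar> \<le> w \<xi>" and w: "integrable M w"
    and f: "\<And>x. f x \<in> borel_measurable M"
  shows "isCont (\<lambda>x. LINT \<xi>|M. f x \<xi>) x"
  unfolding continuous_at_sequentially comp_def
proof (intro allI impI)
  fix X :: "nat \<Rightarrow> real" assume X: "X \<longlonglongrightarrow> x"
  show "(\<lambda>i. LINT \<xi>|M. f (X i) \<xi>) \<longlonglongrightarrow> (LINT \<xi>|M. f x \<xi>)"
  proof (rule integral_dominated_convergence[where w = w])
    show "AE \<xi> in M. (\<lambda>i. f (X i) \<xi>) \<longlonglongrightarrow> f x \<xi>"
      using cont X by (auto simp: continuous_at_sequentially comp_def)
  qed (use f w bound in auto)
qed

text \<open>Comparison with \<open>x powr (- 2 * \<sigma>)\<close>, integrable on [1, \<infinity>)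
  because 2\<sigma> > 1; the left half-line follows by reflection, the middle by continuity.\<close>

lemma integrable_powr_sq:
  fixes \<sigma> :: real
  assumes "\<sigma> > 1 / 2"
  shows "integrable lborel (\<lambda>\<xi>::real. (1 + \<xi>\<^sup>2) powr (- \<sigma>))"
proof -
  have m: "(1::real) + \<xi>\<^sup>2 > 0" for \<xi> by (smt (verit) zero_le_power2)
  have 1: "set_integrable lborel {1..} (\<lambda>x::real. x powr (- 2 * \<sigma>))"
  proof -
    have "((\<lambda>x::real. x powr (- 2 * \<sigma>)) has_integral - (1 powr (- 2 * \<sigma> + 1)) / (- 2 * \<sigma> + 1)) {1..}"
      by (rule has_integral_powr_to_inf) (use assms in auto)
    then have "(\<lambda>x::real. x powr (- 2 * \<sigma>)) absolutely_integrable_on {1..}"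
      by (intro nonnegative_absolutely_integrable_1) (auto simp: integrable_on_def)
    then show ?thesis
      by (simp add: set_integrable_def integrable_completion)
  qed
  have 2: "set_integrable lborel {1..} (\<lambda>\<xi>::real. (1 + \<xi>\<^sup>2) powr (- \<sigma>))"
  proof (rule set_integrable_bound[OF 1])
    show "AE x in lborel. x \<in> {1..} \<longrightarrow> norm ((1 + x\<^sup>2) powr - \<sigma>) \<le> norm (x powr (- 2 * \<sigma>))"
    proof (intro AE_I2 impI)
      fix x :: real assume x: "x \<in> {1..}"
      have "x powr (- 2 * \<sigma>) = (x\<^sup>2) powr (- \<sigma>)"
        using x by (simp add: powr_powr flip: powr_numeral)
      moreover have "(1 + x\<^sup>2) powr - \<sigma> \<le> (x\<^sup>2) powr (- \<sigma>)"
        using x assms by (intro powr_mono2') auto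
      ultimately show "norm ((1 + x\<^sup>2) powr - \<sigma>) \<le> norm (x powr (- 2 * \<sigma>))" by simp
    qed
  qed (auto simp: set_borel_measurable_def)
  have 3: "set_integrable lborel {..- 1} (\<lambda>\<xi>::real. (1 + \<xi>\<^sup>2) powr (- \<sigma>))"
  proof -
    have "integrable lborel (\<lambda>x. indicator {1..} (0 + (-1) * x) *\<^sub>R (1 + (0 + (-1) * x :: real)\<^sup>2) powr (- \<sigma>))"
      using 2 unfolding set_integrable_def by (intro lborel_integrable_real_affine) auto
    then show ?thesis unfolding set_integrable_def
      by (rule Bochner_Integration.integrable_cong[THEN iffD1, rotated 2]) (auto simp: indicator_def)
  qed
  have 4: "set_integrable lborel {- 1..1} (\<lambda>\<xi>::real. (1 + \<xi>\<^sup>2) powr (- \<sigma>))"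
    using m by (intro borel_integrable_atLeastAtMost') (auto intro!: continuous_intros simp: less_imp_neq[symmetric])
  have "set_integrable lborel ({..- 1} \<union> {- 1..1} \<union> {1..}) (\<lambda>\<xi>::real. (1 + \<xi>\<^sup>2) powr (- \<sigma>))"
    by (intro set_integrable_Un 2 3 4) auto
  also have "{..- 1} \<union> {- 1..1} \<union> {1..} = (UNIV :: real set)" by auto
  finally show ?thesis by (simp add: set_integrable_def)
qed

section \<open>Fourier inversion and Sobolev embedding\<close>

text \<open>The truncation makes the integral converge for every f in L^2; it is named so that its
  linearity can be stated.\<close>

definition truncated_fourier :: "real \<Rightarrow> (real \<Rightarrow> complex) \<Rightarrow> real \<Rightarrow> complex" where
  "truncated_fourier R f \<xi> = (LINT x:{-R..R}|lborel. cis (- (x * \<xi>)) * f x)"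

section \<open>Linearity, uniqueness and almost everywhere invariance of the Plancherel
  transform\<close>

lemma square_integrable_measurable[measurable_dest]:
  "square_integrable f \<Longrightarrow> f \<in> borel_measurable lborel"
  by (simp add: square_integrable_def)

lemma borel_measurable_cis[measurable]: "cis \<in> borel_measurable borel"
  by (intro borel_measurable_continuous_onI continuous_intros)

lemma truncated_fourier_measurable[measurable]:
  assumes [measurable]: "f \<in> borel_measurable borel"
  shows "truncated_fourier R f \<in> borel_measurable borel"
  unfolding truncated_fourier_def[abs_def] set_lebesgue_integral_def by measurable

lemma square_integrable_imp_set_integrable:
  assumes f: "square_integrable f"
  shows "set_integrable lborel {-R..R} f"
proof (rule set_integrable_bound)
  have "set_integrable lborel {-R..R} (\<lambda>x. (cmod (f x))\<^sup>2)"
    using f unfolding square_integrable_def set_integrable_def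
    by (intro integrable_mult_indicator) auto
  moreover have "set_integrable lborel {-R..R} (\<lambda>x. 1::real)"
    by (intro borel_integrable_atLeastAtMost') auto
  ultimately show "set_integrable lborel {-R..R} (\<lambda>x. 1 + (cmod (f x))\<^sup>2)"
    by (intro set_integral_add)
  show "set_borel_measurable lborel {-R..R} f"
    using f unfolding set_borel_measurable_def by measurable
  have "a \<le> 1 + a\<^sup>2" for a :: real
    using sum_squares_bound[of a 1] by (smt (verit) zero_le_power2 one_power2)
  then show "AE x in lborel. x \<in> {- R..R} \<longrightarrow> norm (f x) \<le> norm (1 + (cmod (f x))\<^sup>2)"
    by simp
qed

lemma square_integrable_imp_set_integrable_cis:
  assumes f: "square_integrable f"
  shows "set_integrable lborel {-R..R} (\<lambda>x. cis (- (x * \<xi>)) * f x)"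
proof (rule set_integrable_bound[OF square_integrable_imp_set_integrable[OF f]])
  show "set_borel_measurable lborel {-R..R} (\<lambda>x. cis (- (x * \<xi>)) * f x)"
    using f unfolding set_borel_measurable_def by measurable
qed (auto simp: norm_mult)

lemma truncated_fourier_diff:
  "square_integrable f \<Longrightarrow> square_integrable g \<Longrightarrow>
    truncated_fourier R (\<lambda>x. f x - g x) \<xi> = truncated_fourier R f \<xi> - truncated_fourier R g \<xi>"
  unfolding truncated_fourier_def
  by (subst set_integral_diff(2)[symmetric])
    (auto simp: square_integrable_imp_set_integrable_cis right_diff_distrib)

lemma truncated_fourier_cmult:
  "truncated_fourier R (\<lambda>x. c * f x) \<xi> = c * truncated_fourier R f \<xi>"
  unfolding truncated_fourier_def
  by (subst set_integral_mult_right[symmetric]) (simp add: mult.left_commute)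

text \<open>Stands in for the triangle inequality in L^2; the factor 2 is harmless because it enters
  only limits equal to 0 and claims of integrability.\<close>

lemma cmod_diff_sq_le: "(cmod (a - b))\<^sup>2 \<le> 2 * (cmod a)\<^sup>2 + 2 * (cmod b)\<^sup>2"
proof -
  have "(cmod (a - b))\<^sup>2 \<le> (cmod a + cmod b)\<^sup>2"
    by (intro power_mono norm_triangle_ineq4) auto
  also have "\<dots> \<le> 2 * (cmod a)\<^sup>2 + 2 * (cmod b)\<^sup>2"
    using sum_squares_bound[of "cmod a" "cmod b"] by (simp add: power2_sum)
  finally show ?thesis .
qed

lemma square_integrable_diff:
  assumes f: "square_integrable f" and g: "square_integrable g"
  shows "square_integrable (\<lambda>x. f x - g x)"
    and "(LINT x|lborel. (cmod (f x - g x))\<^sup>2)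
       \<le> 2 * (LINT x|lborel. (cmod (f x))\<^sup>2) + 2 * (LINT x|lborel. (cmod (g x))\<^sup>2)"
proof -
  have [measurable]: "f \<in> borel_measurable borel" "g \<in> borel_measurable borel"
    using f g by (auto simp: square_integrable_def)
  have i: "integrable lborel (\<lambda>x. (cmod (f x))\<^sup>2)" "integrable lborel (\<lambda>x. (cmod (g x))\<^sup>2)"
    using f g by (auto simp: square_integrable_def)
  have "integrable lborel (\<lambda>x. (cmod (f x - g x))\<^sup>2)"
    by (rule Bochner_Integration.integrable_bound
        [where f = "\<lambda>x. 2 * (cmod (f x))\<^sup>2 + 2 * (cmod (g x))\<^sup>2"])
      (use i cmod_diff_sq_le in auto)
  then show "square_integrable (\<lambda>x. f x - g x)" by (simp add: square_integrable_def)
  have "(LINT x|lborel. (cmod (f x - g x))\<^sup>2) \<le> (LINT x|lborel. 2 * (cmod (f x))\<^sup>2 + 2 * (cmod (g x))\<^sup>2)"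
    by (intro integral_mono) (use i \<open>integrable lborel (\<lambda>x. (cmod (f x - g x))\<^sup>2)\<close> cmod_diff_sq_le in auto)
  then show "(LINT x|lborel. (cmod (f x - g x))\<^sup>2)
       \<le> 2 * (LINT x|lborel. (cmod (f x))\<^sup>2) + 2 * (LINT x|lborel. (cmod (g x))\<^sup>2)"
    using i by simp
qed

lemma square_integrable_cmult: "square_integrable f \<Longrightarrow> square_integrable (\<lambda>x. c * f x)"
  by (auto simp: square_integrable_def norm_mult power_mult_distrib)

text \<open>Replaces the extended nonnegative integral by the Lebesgue integral, which is easier to
  combine. Eventual square integrability has to be recorded separately: the Lebesgue integral of a
  non-integrable function is 0 by default and would fake convergence.\<close>

lemma is_fourier_L2_iff:
  "is_fourier_L2 f F \<longleftrightarrow> square_integrable f \<and> square_integrable F \<and>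
     (\<forall>\<^sub>F R in at_top. square_integrable (\<lambda>\<xi>. F \<xi> - truncated_fourier R f \<xi>)) \<and>
     ((\<lambda>R. LINT \<xi>|lborel. (cmod (F \<xi> - truncated_fourier R f \<xi>))\<^sup>2) \<longlongrightarrow> 0) at_top"
proof (cases "square_integrable f \<and> square_integrable F")
  case True
  then have [measurable]: "f \<in> borel_measurable borel" "F \<in> borel_measurable borel"
    by (auto simp: square_integrable_def)
  define N where "N = (\<lambda>R. \<integral>\<^sup>+\<xi>. ennreal ((cmod (F \<xi> - truncated_fourier R f \<xi>))\<^sup>2) \<partial>lborel)"
  define L where "L = (\<lambda>R. LINT \<xi>|lborel. (cmod (F \<xi> - truncated_fourier R f \<xi>))\<^sup>2)"
  have eq: "N R = ennreal (L R)" if "square_integrable (\<lambda>\<xi>. F \<xi> - truncated_fourier R f \<xi>)" for R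
    using that unfolding N_def L_def square_integrable_def by (intro nn_integral_eq_integral) auto
  have si: "square_integrable (\<lambda>\<xi>. F \<xi> - truncated_fourier R f \<xi>)" if "N R < \<infinity>" for R
    using that unfolding N_def square_integrable_def by (auto intro!: integrableI_bounded)
  have L0: "L R \<ge> 0" for R unfolding L_def by simp
  have "(N \<longlongrightarrow> 0) at_top \<longleftrightarrow>
     (\<forall>\<^sub>F R in at_top. square_integrable (\<lambda>\<xi>. F \<xi> - truncated_fourier R f \<xi>)) \<and> (L \<longlongrightarrow> 0) at_top"
  proof safe
    assume N: "(N \<longlongrightarrow> 0) at_top"
    then have "\<forall>\<^sub>F R in at_top. N R < \<infinity>" by (rule order_tendstoD) simp
    then show ev: "\<forall>\<^sub>F R in at_top. square_integrable (\<lambda>\<xi>. F \<xi> - truncated_fourier R f \<xi>)"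
      by eventually_elim (rule si)
    have "\<forall>\<^sub>F R in at_top. N R = ennreal (L R)"
      using ev by (auto elim!: eventually_mono simp: eq)
    then have "((\<lambda>R. ennreal (L R)) \<longlongrightarrow> ennreal 0) at_top"
      using N by (simp add: tendsto_cong)
    then show "(L \<longlongrightarrow> 0) at_top" by (subst (asm) tendsto_ennreal_iff) (auto simp: L0)
  next
    assume ev: "\<forall>\<^sub>F R in at_top. square_integrable (\<lambda>\<xi>. F \<xi> - truncated_fourier R f \<xi>)"
      and "(L \<longlongrightarrow> 0) at_top"
    then have "((\<lambda>R. ennreal (L R)) \<longlongrightarrow> ennreal 0) at_top" by (intro tendsto_intros)
    moreover have "\<forall>\<^sub>F R in at_top. N R = ennreal (L R)"
      using ev by (auto elim!: eventually_mono simp: eq)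
    ultimately show "(N \<longlongrightarrow> 0) at_top"
      by (simp add: tendsto_cong)
  qed
  then show ?thesis
    using True unfolding is_fourier_L2_def N_def L_def truncated_fourier_def by blast
qed (auto simp: is_fourier_L2_def)

lemma is_fourier_L2_diff:
  assumes "is_fourier_L2 f F" "is_fourier_L2 g G"
  shows "is_fourier_L2 (\<lambda>x. f x - g x) (\<lambda>\<xi>. F \<xi> - G \<xi>)"
proof -
  define L where "L = (\<lambda>R f F. LINT \<xi>|lborel. (cmod (F \<xi> - truncated_fourier R f \<xi>))\<^sup>2)"
  have f: "square_integrable f" "square_integrable F"
      "\<forall>\<^sub>F R in at_top. square_integrable (\<lambda>\<xi>. F \<xi> - truncated_fourier R f \<xi>)"
      "((\<lambda>R. L R f F) \<longlongrightarrow> 0) at_top"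
    using assms(1) by (auto simp: is_fourier_L2_iff L_def)
  have g: "square_integrable g" "square_integrable G"
      "\<forall>\<^sub>F R in at_top. square_integrable (\<lambda>\<xi>. G \<xi> - truncated_fourier R g \<xi>)"
      "((\<lambda>R. L R g G) \<longlongrightarrow> 0) at_top"
    using assms(2) by (auto simp: is_fourier_L2_iff L_def)
  have eq: "F \<xi> - G \<xi> - truncated_fourier R (\<lambda>x. f x - g x) \<xi> =
    (F \<xi> - truncated_fourier R f \<xi>) - (G \<xi> - truncated_fourier R g \<xi>)" for R \<xi>
    using f g by (auto simp: truncated_fourier_diff)
  have "\<forall>\<^sub>F R in at_top. square_integrable (\<lambda>\<xi>. F \<xi> - G \<xi> - truncated_fourier R (\<lambda>x. f x - g x) \<xi>)"
    using f(3) g(3) unfolding eq by eventually_elim (rule square_integrable_diff)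
  moreover have "((\<lambda>R. L R (\<lambda>x. f x - g x) (\<lambda>\<xi>. F \<xi> - G \<xi>)) \<longlongrightarrow> 0) at_top"
  proof (rule tendsto_sandwich[where f = "\<lambda>_. 0" and h = "\<lambda>R. 2 * L R f F + 2 * L R g G"])
    show "((\<lambda>R. 2 * L R f F + 2 * L R g G) \<longlongrightarrow> 0) at_top"
      by (rule tendsto_eq_intros f g | simp)+
    show "\<forall>\<^sub>F R in at_top. L R (\<lambda>x. f x - g x) (\<lambda>\<xi>. F \<xi> - G \<xi>) \<le> 2 * L R f F + 2 * L R g G"
      using f(3) g(3) unfolding L_def eq by eventually_elim (rule square_integrable_diff)
  qed (auto simp: L_def)
  ultimately show ?thesis
    unfolding is_fourier_L2_iff L_def using f g square_integrable_diff by blast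
qed

lemma is_fourier_L2_cmult:
  assumes "is_fourier_L2 f F"
  shows "is_fourier_L2 (\<lambda>x. c * f x) (\<lambda>\<xi>. c * F \<xi>)"
proof -
  have f: "square_integrable f" "square_integrable F"
      "\<forall>\<^sub>F R in at_top. square_integrable (\<lambda>\<xi>. F \<xi> - truncated_fourier R f \<xi>)"
      "((\<lambda>R. LINT \<xi>|lborel. (cmod (F \<xi> - truncated_fourier R f \<xi>))\<^sup>2) \<longlongrightarrow> 0) at_top"
    using assms by (auto simp: is_fourier_L2_iff)
  have eq: "c * F \<xi> - truncated_fourier R (\<lambda>x. c * f x) \<xi> = c * (F \<xi> - truncated_fourier R f \<xi>)" for R \<xi>
    by (auto simp: truncated_fourier_cmult right_diff_distrib)
  have "\<forall>\<^sub>F R in at_top. square_integrable (\<lambda>\<xi>. c * F \<xi> - truncated_fourier R (\<lambda>x. c * f x) \<xi>)"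
    using f(3) unfolding eq by eventually_elim (rule square_integrable_cmult)
  moreover have "((\<lambda>R. LINT \<xi>|lborel. (cmod (c * F \<xi> - truncated_fourier R (\<lambda>x. c * f x) \<xi>))\<^sup>2) \<longlongrightarrow> 0) at_top"
    using tendsto_mult_left[OF f(4), of "(cmod c)\<^sup>2"] unfolding eq by (simp add: norm_mult power_mult_distrib)
  ultimately show ?thesis
    unfolding is_fourier_L2_iff using f square_integrable_cmult by blast
qed

text \<open>Both F and G are L^2 limits of the same truncated transforms. As a consequence, the
  choice operator in \<open>sobolev_norm\<close> is immaterial on the Sobolev space.\<close>

lemma is_fourier_L2_unique:
  assumes "is_fourier_L2 f F" "is_fourier_L2 f G"
  shows "AE \<xi> in lborel. F \<xi> = G \<xi>"
proof -
  define L where "L = (\<lambda>R F. LINT \<xi>|lborel. (cmod (F \<xi> - truncated_fourier R f \<xi>))\<^sup>2)"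
  have F: "square_integrable f" "square_integrable F"
      "\<forall>\<^sub>F R in at_top. square_integrable (\<lambda>\<xi>. F \<xi> - truncated_fourier R f \<xi>)"
      "((\<lambda>R. L R F) \<longlongrightarrow> 0) at_top"
    using assms(1) by (auto simp: is_fourier_L2_iff L_def)
  have G: "square_integrable G"
      "\<forall>\<^sub>F R in at_top. square_integrable (\<lambda>\<xi>. G \<xi> - truncated_fourier R f \<xi>)"
      "((\<lambda>R. L R G) \<longlongrightarrow> 0) at_top"
    using assms(2) by (auto simp: is_fourier_L2_iff L_def)
  have "((\<lambda>R. 2 * L R F + 2 * L R G) \<longlongrightarrow> 0) at_top"
    by (rule tendsto_eq_intros F G | simp)+
  moreover have "\<forall>\<^sub>F R in at_top. (LINT \<xi>|lborel. (cmod (F \<xi> - G \<xi>))\<^sup>2) \<le> 2 * L R F + 2 * L R G"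
    using F(3) G(2) unfolding L_def
  proof eventually_elim
    case (elim R)
    from square_integrable_diff(2)[OF this] show ?case by simp
  qed
  ultimately have "(LINT \<xi>|lborel. (cmod (F \<xi> - G \<xi>))\<^sup>2) \<le> 0"
    by (intro tendsto_lowerbound[where F = at_top]) auto
  moreover have "(LINT \<xi>|lborel. (cmod (F \<xi> - G \<xi>))\<^sup>2) \<ge> 0" by simp
  moreover have "integrable lborel (\<lambda>\<xi>. (cmod (F \<xi> - G \<xi>))\<^sup>2)"
    using square_integrable_diff(1)[OF F(2) G(1)] by (simp add: square_integrable_def)
  ultimately have "AE \<xi> in lborel. (cmod (F \<xi> - G \<xi>))\<^sup>2 = 0"
    by (subst integral_nonneg_eq_0_iff_AE[symmetric]) auto
  then show ?thesis by eventually_elim auto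
qed

text \<open>The equation identifies the time derivative with a continuous function only almost
  everywhere, whereas inversion and embedding require the continuous representative.\<close>

lemma is_fourier_L2_cong_AE:
  assumes "AE x in lborel. f x = g x" "f \<in> borel_measurable borel" "g \<in> borel_measurable borel"
  shows "is_fourier_L2 f F \<longleftrightarrow> is_fourier_L2 g F"
proof -
  have [measurable]: "f \<in> borel_measurable borel" "g \<in> borel_measurable borel" using assms by auto
  have "truncated_fourier R f \<xi> = truncated_fourier R g \<xi>" for R \<xi>
    unfolding truncated_fourier_def using assms(1)
    by (intro set_lebesgue_integral_cong_AE) (auto elim!: eventually_mono)
  moreover have "integrable lborel (\<lambda>x. (cmod (f x))\<^sup>2) \<longleftrightarrow> integrable lborel (\<lambda>x. (cmod (g x))\<^sup>2)"
    by (rule integrable_cong_AE) (use assms(1) in \<open>auto elim!: eventually_mono\<close>)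
  then have "square_integrable f \<longleftrightarrow> square_integrable g"
    by (simp add: square_integrable_def)
  with calculation show ?thesis unfolding is_fourier_L2_iff by simp
qed

section \<open>Pairing with Gaussians and pointwise inversion\<close>

lemma integrable_gaussian: "a > 0 \<Longrightarrow> integrable lborel (\<lambda>\<xi>::real. exp (- (a * \<xi>)\<^sup>2 / 2))"
proof -
  assume a: "a > 0"
  have "integrable lborel (\<lambda>\<xi>. sqrt (2 * pi) * std_normal_density \<xi>)" by simp
  then have "integrable lborel (\<lambda>\<xi>::real. exp (- \<xi>\<^sup>2 / 2))"
    by (simp add: std_normal_density_def)
  then have "integrable lborel (\<lambda>\<xi>::real. exp (- (0 + a * \<xi>)\<^sup>2 / 2))"
    by (intro lborel_integrable_real_affine) (use a in auto)
  then show ?thesis by simp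
qed

text \<open>The substitution z = a \<xi> reduces this to the characteristic function of the standard
  normal law. Writing the value as a normal density of width \<open>a\<close> prepares the
  approximate identity.\<close>

lemma fourier_transform_gaussian:
  fixes a s :: real
  assumes a: "a > 0"
  shows "(LINT \<xi>|lborel. cis (s * \<xi>) * exp (- (a * \<xi>)\<^sup>2 / 2)) = complex_of_real (2 * pi * normal_density 0 a s)"
proof -
  have "complex_of_real (exp (- (s / a)\<^sup>2 / 2)) = (CLINT z|std_normal_distribution. iexp (s / a * z))"
    using fun_cong[OF char_std_normal_distribution, of "s / a"] by (simp add: char_def)
  also have "\<dots> = (CLINT z|lborel. std_normal_density z *\<^sub>R cis (s / a * z))"
    by (subst integral_density) (auto simp: cis_conv_exp)
  also have "\<dots> = (CLINT z|lborel. (1 / sqrt (2 * pi)) *\<^sub>R (cis (s / a * z) * exp (- z\<^sup>2 / 2)))"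
    by (simp add: std_normal_density_def scaleR_conv_of_real mult_ac)
  also have "\<dots> = (1 / sqrt (2 * pi)) *\<^sub>R (CLINT z|lborel. cis (s / a * z) * exp (- z\<^sup>2 / 2))"
    by simp
  also have "(CLINT z|lborel. cis (s / a * z) * exp (- z\<^sup>2 / 2))
      = a *\<^sub>R (LINT \<xi>|lborel. cis (s * \<xi>) * exp (- (a * \<xi>)\<^sup>2 / 2))"
    using a by (subst lborel_integral_real_affine[where c = a and t = 0]) auto
  finally have "complex_of_real (exp (- (s / a)\<^sup>2 / 2)) =
     (1 / sqrt (2 * pi)) *\<^sub>R a *\<^sub>R (LINT \<xi>|lborel. cis (s * \<xi>) * exp (- (a * \<xi>)\<^sup>2 / 2))" .
  then have "(LINT \<xi>|lborel. cis (s * \<xi>) * exp (- (a * \<xi>)\<^sup>2 / 2)) =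
     (sqrt (2 * pi) / a) *\<^sub>R complex_of_real (exp (- (s / a)\<^sup>2 / 2))"
    using a by simp
  also have "\<dots> = complex_of_real (2 * pi * normal_density 0 a s)"
  proof -
    have "sqrt (2 * pi * a\<^sup>2) = sqrt (2 * pi) * a" using a by (simp add: real_sqrt_mult)
    moreover have "2 * pi = sqrt (2 * pi) * sqrt (2 * pi)" by simp
    ultimately have "sqrt (2 * pi) / a = 2 * pi / sqrt (2 * pi * a\<^sup>2)"
      using a by (simp add: field_simps)
    then show ?thesis
      using a by (simp add: normal_density_def scaleR_conv_of_real power_divide flip: of_real_mult)
  qed
  finally show ?thesis .
qed

text \<open>The truncated f and the Gaussian are both integrable, so Fubini applies although f
  itself may fail to be integrable on the line.\<close>

lemma truncated_fourier_gaussian_pairing: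
  fixes f :: "real \<Rightarrow> complex" and a x R :: real
  assumes f: "square_integrable f" and a: "a > 0"
  shows "(LINT \<xi>|lborel. truncated_fourier R f \<xi> * (cis (x * \<xi>) * exp (- (a * \<xi>)\<^sup>2 / 2)))
    = 2 * pi * (LINT y:{-R..R}|lborel. f y * normal_density x a y)"
proof -
  have [measurable]: "f \<in> borel_measurable borel" using f by (simp add: square_integrable_def)
  define g where "g = (\<lambda>y. indicator {-R..R} y *\<^sub>R f y)"
  have gi: "integrable lborel g"
    using square_integrable_imp_set_integrable[OF f, of R] by (simp add: g_def set_integrable_def)
  have [measurable]: "g \<in> borel_measurable borel" using gi by auto
  let ?K = "\<lambda>y \<xi>. cis ((x - y) * \<xi>) * exp (- (a * \<xi>)\<^sup>2 / 2) * g y"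
  have ci: "integrable lborel (\<lambda>\<xi>. cis (s * \<xi>) * exp (- (a * \<xi>)\<^sup>2 / 2))" for s
    by (rule Bochner_Integration.integrable_bound[OF integrable_gaussian[OF a]])
      (auto simp: norm_mult)
  have "(LINT \<xi>|lborel. truncated_fourier R f \<xi> * (cis (x * \<xi>) * exp (- (a * \<xi>)\<^sup>2 / 2)))
    = (LINT \<xi>|lborel. LINT y|lborel. ?K y \<xi>)"
  proof (intro Bochner_Integration.integral_cong refl)
    fix \<xi>
    have "truncated_fourier R f \<xi> = (LINT y|lborel. cis (- (y * \<xi>)) * g y)"
      unfolding truncated_fourier_def set_lebesgue_integral_def g_def
      by (intro Bochner_Integration.integral_cong) auto
    then have "truncated_fourier R f \<xi> * (cis (x * \<xi>) * exp (- (a * \<xi>)\<^sup>2 / 2)) =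
       (LINT y|lborel. (cis (- (y * \<xi>)) * g y) * (cis (x * \<xi>) * exp (- (a * \<xi>)\<^sup>2 / 2)))"
      by simp
    also have "\<dots> = (LINT y|lborel. ?K y \<xi>)"
    proof (intro Bochner_Integration.integral_cong refl)
      fix y
      have "cis (- (y * \<xi>)) * cis (x * \<xi>) = cis ((x - y) * \<xi>)"
        by (simp add: cis_mult algebra_simps)
      moreover have "(cis (- (y * \<xi>)) * g y) * (cis (x * \<xi>) * exp (- (a * \<xi>)\<^sup>2 / 2))
          = (cis (- (y * \<xi>)) * cis (x * \<xi>)) * exp (- (a * \<xi>)\<^sup>2 / 2) * g y"
        by (simp only: mult_ac)
      ultimately show "(cis (- (y * \<xi>)) * g y) * (cis (x * \<xi>) * exp (- (a * \<xi>)\<^sup>2 / 2)) = ?K y \<xi>"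
        by simp
    qed
    finally show "truncated_fourier R f \<xi> * (cis (x * \<xi>) * exp (- (a * \<xi>)\<^sup>2 / 2)) = (LINT y|lborel. ?K y \<xi>)" .
  qed
  also have "\<dots> = (LINT y|lborel. LINT \<xi>|lborel. ?K y \<xi>)"
  proof (rule lborel_pair.Fubini_integral, rule lborel_pair.Fubini_integrable)
    have "(LINT \<xi>|lborel. norm (?K y \<xi>)) = (LINT \<xi>|lborel. exp (- (a * \<xi>)\<^sup>2 / 2)) * norm (g y)" for y
      by (simp add: norm_mult)
    then show "integrable lborel (\<lambda>y. LINT \<xi>|lborel. norm (case (y, \<xi>) of (y, \<xi>) \<Rightarrow> ?K y \<xi>))"
      using gi by simp
    show "AE y in lborel. integrable lborel (\<lambda>\<xi>. case (y, \<xi>) of (y, \<xi>) \<Rightarrow> ?K y \<xi>)"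
      using ci by simp
  qed measurable
  also have "\<dots> = (LINT y|lborel. complex_of_real (2 * pi * normal_density 0 a (x - y)) * g y)"
    using fourier_transform_gaussian[OF a] by simp
  also have "\<dots> = (LINT y|lborel. 2 * pi * (indicator {-R..R} y *\<^sub>R (f y * normal_density x a y)))"
    by (intro Bochner_Integration.integral_cong)
      (auto simp: g_def normal_density_def power2_commute[of x] scaleR_conv_of_real)
  also have "\<dots> = 2 * pi * (LINT y:{-R..R}|lborel. f y * normal_density x a y)"
    unfolding set_lebesgue_integral_def by (subst integral_mult_right_zero[symmetric]) (simp add: mult_ac)
  finally show ?thesis .
qed


lemma square_integrable_mult:
  assumes "square_integrable f" "square_integrable g"
  shows "integrable lborel (\<lambda>x. f x * g x)"
    and "cmod (LINT x|lborel. f x * g x)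
      \<le> sqrt (LINT x|lborel. (cmod (f x))\<^sup>2) * sqrt (LINT x|lborel. (cmod (g x))\<^sup>2)"
proof -
  have [measurable]: "f \<in> borel_measurable borel" "g \<in> borel_measurable borel"
    using assms by (auto simp: square_integrable_def)
  have i: "integrable lborel (\<lambda>x. cmod (f x) * cmod (g x))"
    using assms by (intro cauchy_schwarz_integral) (auto simp: square_integrable_def)
  show int: "integrable lborel (\<lambda>x. f x * g x)"
    by (rule Bochner_Integration.integrable_bound[OF i]) (auto simp: norm_mult)
  have "cmod (LINT x|lborel. f x * g x) \<le> (LINT x|lborel. cmod (f x * g x))"
    by (rule integral_norm_bound)
  also have "\<dots> = (LINT x|lborel. \<bar>cmod (f x) * cmod (g x)\<bar>)"
    by (simp add: norm_mult)
  also have "\<dots> \<le> sqrt (LINT x|lborel. (cmod (f x))\<^sup>2) * sqrt (LINT x|lborel. (cmod (g x))\<^sup>2)"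
    using assms by (intro cauchy_schwarz_integral) (auto simp: square_integrable_def)
  finally show "cmod (LINT x|lborel. f x * g x)
      \<le> sqrt (LINT x|lborel. (cmod (f x))\<^sup>2) * sqrt (LINT x|lborel. (cmod (g x))\<^sup>2)" .
qed

text \<open>By Cauchy-Schwarz, L^2 convergence of the truncated transforms implies convergence when
  tested against \<open>\<Phi>\<close>.\<close>

lemma is_fourier_L2_pairing:
  assumes "is_fourier_L2 f F" and \<Phi>: "square_integrable \<Phi>"
  shows "((\<lambda>R. LINT \<xi>|lborel. truncated_fourier R f \<xi> * \<Phi> \<xi>) \<longlongrightarrow> (LINT \<xi>|lborel. F \<xi> * \<Phi> \<xi>)) at_top"
proof (rule LIM_zero_cancel, rule Lim_null_comparison)
  let ?L = "\<lambda>R. LINT \<xi>|lborel. (cmod (F \<xi> - truncated_fourier R f \<xi>))\<^sup>2"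
  have F: "square_integrable F"
      "\<forall>\<^sub>F R in at_top. square_integrable (\<lambda>\<xi>. F \<xi> - truncated_fourier R f \<xi>)"
      "(?L \<longlongrightarrow> 0) at_top"
    using assms(1) by (auto simp: is_fourier_L2_iff)
  let ?b = "\<lambda>R. sqrt (?L R) * sqrt (LINT x|lborel. (cmod (\<Phi> x))\<^sup>2)"
  show "(?b \<longlongrightarrow> 0) at_top"
    by (rule tendsto_eq_intros F(3) | simp)+
  show "\<forall>\<^sub>F R in at_top. norm ((LINT \<xi>|lborel. truncated_fourier R f \<xi> * \<Phi> \<xi>) - (LINT \<xi>|lborel. F \<xi> * \<Phi> \<xi>)) \<le> ?b R"
    using F(2)
  proof eventually_elim
    case (elim R)
    have "(LINT \<xi>|lborel. truncated_fourier R f \<xi> * \<Phi> \<xi>)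
      = (LINT \<xi>|lborel. F \<xi> * \<Phi> \<xi> - (F \<xi> - truncated_fourier R f \<xi>) * \<Phi> \<xi>)"
      by (simp add: algebra_simps)
    also have "\<dots> = (LINT \<xi>|lborel. F \<xi> * \<Phi> \<xi>) - (LINT \<xi>|lborel. (F \<xi> - truncated_fourier R f \<xi>) * \<Phi> \<xi>)"
      by (intro Bochner_Integration.integral_diff square_integrable_mult F \<Phi> elim)
    finally show ?case
      using square_integrable_mult(2)[OF elim \<Phi>] by (simp add: norm_minus_commute)
  qed
qed

text \<open>From exp (- r) \<le> 1 / r with r = (y - x)^2 / (2 a^2). The bound is linear in
  \<open>a\<close> and integrable in y away from x, so it controls even an unbounded f in
  L^2.\<close>

lemma normal_density_tail_le:
  assumes "a > 0" "y \<noteq> x"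
  shows "normal_density x a y \<le> 2 * a / (y - x)\<^sup>2"
proof -
  let ?r = "(y - x)\<^sup>2 / (2 * a\<^sup>2)"
  have r: "?r > 0" using assms by simp
  have "exp (- ?r) \<le> 1 / ?r"
  proof -
    have "?r \<le> exp ?r" using exp_ge_add_one_self[of ?r] by linarith
    then have "1 / exp ?r \<le> 1 / ?r" using r by (intro frac_le) auto
    then show ?thesis by (simp add: exp_minus inverse_eq_divide)
  qed
  moreover have "sqrt (2 * pi * a\<^sup>2) \<ge> a"
    using assms pi_gt3 by (intro real_le_rsqrt) (auto simp: mult_le_cancel_right1)
  ultimately have "1 / sqrt (2 * pi * a\<^sup>2) * exp (- ?r) \<le> 1 / a * (1 / ?r)"
    using assms by (intro mult_mono) (auto simp: frac_le)
  also have "\<dots> = 2 * a / (y - x)\<^sup>2"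
    using assms by (simp add: field_simps power2_eq_square)
  finally show ?thesis by (simp add: normal_density_def)
qed

text \<open>Near x continuity is used. Farther away f may be unbounded, and the tail of the Gaussian
  is paired with |f| \<le> 1 + |f|^2; its contribution is at most the width of the Gaussian times a
  fixed integral.\<close>

lemma gaussian_approximate_identity:
  fixes f :: "real \<Rightarrow> complex"
  assumes f: "square_integrable f" and cont: "isCont f x"
  shows "integrable lborel (\<lambda>y. f y * normal_density x (1 / real (Suc k)) y)"
    and "(\<lambda>k. LINT y|lborel. f y * normal_density x (1 / real (Suc k)) y) \<longlonglongrightarrow> f x"
proof -
  have [measurable]: "f \<in> borel_measurable borel" using f by (simp add: square_integrable_def)
  let ?a = "\<lambda>k. 1 / real (Suc k)"
  have fi: "integrable lborel (\<lambda>y. (cmod (f y))\<^sup>2)" using f by (simp add: square_integrable_def)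
  have bound: "\<exists>W. integrable lborel W \<and> (\<forall>y a. a > 0 \<longrightarrow>
      cmod ((f y - f x) * normal_density x a y) \<le> e * normal_density x a y + a * W y)" if e: "e > 0" for e
  proof -
    obtain \<delta> where \<delta>: "\<delta> > 0" "\<And>y. \<bar>y - x\<bar> < \<delta> \<Longrightarrow> cmod (f y - f x) < e"
      using cont e unfolding continuous_at_eps_delta dist_norm by auto
    \<comment> \<open>For z = y - x with |z| \<ge> \<delta>, both 1/z^2 \<le> 1 + 1/\<delta>^2 and
      1/z^2 \<le> (1 + 1/\<delta>^2) / (1 + z^2) hold; the first serves the term |f|^2, the second
      the constants. The shape \<open>- x + 1 * y\<close> fits the affine substitution rule.\<close>
    define W where "W = (\<lambda>y. 2 * (1 + 1 / \<delta>\<^sup>2) * ((cmod (f y))\<^sup>2 + (1 + cmod (f x)) * (1 + (- x + 1 * y)\<^sup>2) powr (- 1)))"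
    have "integrable lborel (\<lambda>y::real. (1 + (- x + 1 * y)\<^sup>2) powr (- 1))"
      using lborel_integrable_real_affine[OF integrable_powr_sq[of 1], of 1 "- x"] by simp
    then have "integrable lborel W"
      unfolding W_def using fi by (intro integrable_mult_right Bochner_Integration.integrable_add)
    moreover have "cmod ((f y - f x) * normal_density x a y) \<le> e * normal_density x a y + a * W y"
      if a: "a > 0" for y a
    proof (cases "\<bar>y - x\<bar> < \<delta>")
      case True
      have "W y \<ge> 0" by (simp add: W_def)
      have "cmod ((f y - f x) * normal_density x a y) = cmod (f y - f x) * normal_density x a y"
        by (simp add: norm_mult)
      also have "\<dots> \<le> e * normal_density x a y"
        using \<delta>(2)[OF True] by (intro mult_right_mono) auto
      finally show ?thesis using \<open>W y \<ge> 0\<close> a by (simp add: add_increasing2)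
    next
      case False
      define z where "z = y - x"
      have z: "z\<^sup>2 \<ge> \<delta>\<^sup>2" "z \<noteq> 0" using False \<delta>(1) by (auto simp: z_def abs_le_square_iff[symmetric])
      have d0: "\<delta>\<^sup>2 > 0" "z\<^sup>2 > 0" using \<delta>(1) z by auto
      have b1: "1 / z\<^sup>2 \<le> 1 + 1 / \<delta>\<^sup>2"
        using z d0 frac_le[of 1 1 "\<delta>\<^sup>2" "z\<^sup>2"] by simp
      have b2: "1 / z\<^sup>2 \<le> (1 + 1 / \<delta>\<^sup>2) * (1 / (1 + z\<^sup>2))"
      proof -
        have "1 + z\<^sup>2 > 0" using d0 by linarith
        moreover have "(1 + z\<^sup>2) / z\<^sup>2 \<le> 1 + 1 / \<delta>\<^sup>2"
          using b1 d0 z frac_le[of 1 1 "\<delta>\<^sup>2" "z\<^sup>2"] by (simp add: add_divide_distrib)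
        ultimately have "(1 + z\<^sup>2) / z\<^sup>2 / (1 + z\<^sup>2) \<le> (1 + 1 / \<delta>\<^sup>2) / (1 + z\<^sup>2)"
          by (intro divide_right_mono) auto
        moreover have "(1 + z\<^sup>2) / z\<^sup>2 / (1 + z\<^sup>2) = 1 / z\<^sup>2"
          using \<open>1 + z\<^sup>2 > 0\<close> by simp
        ultimately show ?thesis by simp
      qed
      have c: "cmod (f y) \<le> 1 + (cmod (f y))\<^sup>2"
        using sum_squares_bound[of "cmod (f y)" 1] by (smt (verit) zero_le_power2 one_power2)
      have "cmod ((f y - f x) * normal_density x a y) = cmod (f y - f x) * normal_density x a y"
        by (simp add: norm_mult)
      also have "\<dots> \<le> (cmod (f y) + cmod (f x)) * (2 * a / z\<^sup>2)"
        unfolding z_def using a z z_def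
        by (intro mult_mono norm_triangle_ineq4 normal_density_tail_le) auto
      also have "\<dots> \<le> ((cmod (f y))\<^sup>2 + (1 + cmod (f x))) * (2 * a / z\<^sup>2)"
        using a c by (intro mult_right_mono) auto
      also have "\<dots> = 2 * a * ((cmod (f y))\<^sup>2 * (1 / z\<^sup>2) + (1 + cmod (f x)) * (1 / z\<^sup>2))"
        using z by (simp add: field_simps)
      also have "\<dots> \<le> 2 * a * ((cmod (f y))\<^sup>2 * (1 + 1 / \<delta>\<^sup>2)
           + (1 + cmod (f x)) * ((1 + 1 / \<delta>\<^sup>2) * (1 / (1 + z\<^sup>2))))"
        using a b1 b2 by (intro mult_left_mono add_mono) auto
      also have "\<dots> = a * W y"
      proof -
        have "1 + z\<^sup>2 > 0" using d0 by linarith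
        then have "1 / (1 + z\<^sup>2) = (1 + (- x + 1 * y)\<^sup>2) powr (- 1)"
          by (simp add: z_def powr_minus_divide)
        then show ?thesis unfolding W_def by (simp only:) (simp add: algebra_simps)
      qed
      finally show ?thesis using e by (simp add: add_increasing)
    qed
    ultimately show ?thesis by blast
  qed
  have int1: "integrable lborel (\<lambda>y. (f y - f x) * normal_density x (?a k) y)" for k
  proof -
    obtain W where W: "integrable lborel W" "\<And>y a. a > 0 \<Longrightarrow>
      cmod ((f y - f x) * normal_density x a y) \<le> 1 * normal_density x a y + a * W y"
      using bound[of 1] by auto
    show ?thesis
    proof (rule Bochner_Integration.integrable_bound)
      show "integrable lborel (\<lambda>y. 1 * normal_density x (?a k) y + ?a k * W y)"
        using W(1) by auto
      show "AE y in lborel. norm ((f y - f x) * normal_density x (?a k) y) \<le> norm (1 * normal_density x (?a k) y + ?a k * W y)"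
        using W(2)[of "?a k"] by (intro AE_I2) (smt (verit) of_nat_0_less_iff real_norm_def zero_less_Suc zero_less_divide_1_iff)
    qed simp
  qed
  have int2: "integrable lborel (\<lambda>y. f x * complex_of_real (normal_density x (?a k) y))" for k
    by (intro integrable_mult_right integrable_of_real) simp
  have eq: "(\<lambda>y. f y * normal_density x (?a k) y) =
     (\<lambda>y. (f y - f x) * normal_density x (?a k) y + f x * complex_of_real (normal_density x (?a k) y))" for k
    by (auto simp: algebra_simps)
  show "integrable lborel (\<lambda>y. f y * normal_density x (?a k) y)" for k
    unfolding eq by (intro Bochner_Integration.integrable_add int1 int2)
  have split: "(LINT y|lborel. f y * normal_density x (?a k) y) - f x
      = (LINT y|lborel. (f y - f x) * normal_density x (?a k) y)" for k
  proof -
    have "(LINT y|lborel. f x * complex_of_real (normal_density x (?a k) y)) = f x"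
      by simp
    then show ?thesis
      unfolding eq by (subst Bochner_Integration.integral_add[OF int1 int2]) simp
  qed
  show "(\<lambda>k. LINT y|lborel. f y * normal_density x (?a k) y) \<longlonglongrightarrow> f x"
  proof (rule LIM_zero_cancel, unfold split, rule LIMSEQ_I)
    fix e :: real assume e: "e > 0"
    then obtain W where W: "integrable lborel W" "\<And>y a. a > 0 \<Longrightarrow>
      cmod ((f y - f x) * normal_density x a y) \<le> e / 2 * normal_density x a y + a * W y"
      using bound[of "e / 2"] by auto
    have "(\<lambda>k. e / 2 + ?a k * (LINT y|lborel. W y)) \<longlonglongrightarrow> e / 2 + 0 * (LINT y|lborel. W y)"
      by (intro tendsto_add tendsto_mult tendsto_const LIMSEQ_Suc[OF lim_1_over_n])
    then have "\<forall>\<^sub>F k in sequentially. e / 2 + ?a k * (LINT y|lborel. W y) < e"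
      by (rule order_tendstoD) (use e in simp)
    then obtain K where K: "\<And>k. k \<ge> K \<Longrightarrow> e / 2 + ?a k * (LINT y|lborel. W y) < e"
      by (auto simp: eventually_sequentially)
    have "cmod (LINT y|lborel. (f y - f x) * normal_density x (?a k) y) \<le> e / 2 + ?a k * (LINT y|lborel. W y)" for k
    proof -
      have "cmod (LINT y|lborel. (f y - f x) * normal_density x (?a k) y)
        \<le> (LINT y|lborel. cmod ((f y - f x) * normal_density x (?a k) y))"
        by (rule integral_norm_bound)
      also have "\<dots> \<le> (LINT y|lborel. e / 2 * normal_density x (?a k) y + ?a k * W y)"
      proof (rule integral_mono)
        show "integrable lborel (\<lambda>y. e / 2 * normal_density x (?a k) y + ?a k * W y)"
          using W(1) by auto
        show "cmod ((f y - f x) * normal_density x (?a k) y) \<le> e / 2 * normal_density x (?a k) y + ?a k * W y" for y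
          by (rule W(2)) simp
      qed (intro integrable_norm int1)
      also have "\<dots> = e / 2 + ?a k * (LINT y|lborel. W y)"
        using W(1) by (subst Bochner_Integration.integral_add) auto
      finally show ?thesis .
    qed
    then show "\<exists>no. \<forall>n\<ge>no. norm ((LINT y|lborel. (f y - f x) * normal_density x (?a n) y) - 0) < e"
      using K by (intro exI[of _ K]) (auto intro: le_less_trans)
  qed
qed

text \<open>The Gaussian-regularised integral has two limits: dominated convergence with majorant
  |F| yields the inversion integral, the approximate identity yields 2\<pi> f(x). The factor 2\<pi>
  belongs to the unnormalised transform.\<close>

theorem fourier_L2_inversion:
  fixes f :: "real \<Rightarrow> complex"
  assumes f: "is_fourier_L2 f F" and F: "integrable lborel F" and cont: "isCont f x"
  shows "(LINT \<xi>|lborel. F \<xi> * cis (x * \<xi>)) = 2 * pi * f x"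
proof (rule LIMSEQ_unique)
  let ?a = "\<lambda>k. 1 / real (Suc k)"
  let ?\<Phi> = "\<lambda>k \<xi>. cis (x * \<xi>) * complex_of_real (exp (- (?a k * \<xi>)\<^sup>2 / 2))"
  have sf: "square_integrable f" using f by (simp add: is_fourier_L2_def)
  have [measurable]: "f \<in> borel_measurable borel" "F \<in> borel_measurable borel"
    using sf F by (auto simp: square_integrable_def)
  have s\<Phi>: "square_integrable (?\<Phi> k)" for k
  proof -
    have "integrable lborel (\<lambda>\<xi>::real. exp (- (?a k * \<xi>)\<^sup>2 / 2))"
      by (intro integrable_gaussian) simp
    then have "integrable lborel (\<lambda>\<xi>. (cmod (?\<Phi> k \<xi>))\<^sup>2)"
    proof (rule Bochner_Integration.integrable_bound)
      have "(exp (- t\<^sup>2 / 2))\<^sup>2 \<le> exp (- t\<^sup>2 / 2)" for t :: real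
        unfolding power2_eq_square[of "exp _"] by (intro mult_left_le) auto
      then show "AE \<xi> in lborel. norm ((cmod (?\<Phi> k \<xi>))\<^sup>2) \<le> norm (exp (- (?a k * \<xi>)\<^sup>2 / 2))"
        by (simp add: norm_mult)
    qed simp
    then show ?thesis by (simp add: square_integrable_def)
  qed
  \<comment> \<open>The \<open>L\<^sup>2\<close> limit defining \<open>F\<close>, tested against a Gaussian, needs no Plancherel theorem.\<close>
  have eq: "(LINT \<xi>|lborel. F \<xi> * ?\<Phi> k \<xi>) = 2 * pi * (LINT y|lborel. f y * normal_density x (?a k) y)" for k
  proof (rule tendsto_unique[OF trivial_limit_at_top_linorder is_fourier_L2_pairing[OF f s\<Phi>]])
    have "((\<lambda>R. LINT y|lborel. indicator {-R..R} y *\<^sub>R (f y * normal_density x (?a k) y))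
       \<longlongrightarrow> (LINT y|lborel. f y * normal_density x (?a k) y)) at_top"
    proof (rule integral_dominated_convergence_at_top)
      show "integrable lborel (\<lambda>y. norm (f y * normal_density x (?a k) y))"
        by (intro integrable_norm gaussian_approximate_identity sf cont)
      show "AE y in lborel. ((\<lambda>R. indicator {-R..R} y *\<^sub>R (f y * normal_density x (?a k) y))
         \<longlongrightarrow> f y * normal_density x (?a k) y) at_top"
      proof (intro AE_I2 tendsto_eventually)
        fix y
        show "\<forall>\<^sub>F R in at_top. indicator {-R..R} y *\<^sub>R (f y * normal_density x (?a k) y) = f y * normal_density x (?a k) y"
          using eventually_ge_at_top[of "\<bar>y\<bar>"] by eventually_elim (auto simp: indicator_def)
      qed
    qed (auto simp: indicator_def)
    then have "((\<lambda>R. 2 * pi * (LINT y:{-R..R}|lborel. f y * normal_density x (?a k) y))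
       \<longlongrightarrow> 2 * pi * (LINT y|lborel. f y * normal_density x (?a k) y)) at_top"
      unfolding set_lebesgue_integral_def by (rule tendsto_mult_left)
    then show "((\<lambda>R. LINT \<xi>|lborel. truncated_fourier R f \<xi> * ?\<Phi> k \<xi>)
      \<longlongrightarrow> 2 * pi * (LINT y|lborel. f y * normal_density x (?a k) y)) at_top"
      by (subst truncated_fourier_gaussian_pairing[OF sf]) auto
  qed
  show "(\<lambda>k. LINT \<xi>|lborel. F \<xi> * ?\<Phi> k \<xi>) \<longlonglongrightarrow> 2 * pi * f x"
    unfolding eq by (rule tendsto_mult_left[OF gaussian_approximate_identity(2)[OF sf cont]])
  show "(\<lambda>k. LINT \<xi>|lborel. F \<xi> * ?\<Phi> k \<xi>) \<longlonglongrightarrow> (LINT \<xi>|lborel. F \<xi> * cis (x * \<xi>))"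
  proof (rule integral_dominated_convergence[where w = "\<lambda>\<xi>. norm (F \<xi>)"])
    show "AE \<xi> in lborel. (\<lambda>k. F \<xi> * ?\<Phi> k \<xi>) \<longlonglongrightarrow> F \<xi> * cis (x * \<xi>)"
    proof (rule AE_I2)
      fix \<xi> :: real
      have "isCont (\<lambda>a. F \<xi> * (cis (x * \<xi>) * complex_of_real (exp (- (a * \<xi>)\<^sup>2 / 2)))) 0"
        by (intro continuous_intros) auto
      from isCont_tendsto_compose[OF this LIMSEQ_Suc[OF lim_1_over_n]] show "(\<lambda>k. F \<xi> * ?\<Phi> k \<xi>) \<longlonglongrightarrow> F \<xi> * cis (x * \<xi>)"
        by simp
    qed
    show "AE \<xi> in lborel. norm (F \<xi> * ?\<Phi> k \<xi>) \<le> norm (F \<xi>)" for k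
      by (intro AE_I2) (simp add: norm_mult mult_left_le)
  qed (use F in simp_all)
qed

section \<open>Sobolev spaces: linear structure, embedding, decay at infinity\<close>

lemma sobolev_space_fourier:
  assumes f: "f \<in> sobolev_space \<sigma>"
  obtains F where "is_fourier_L2 (\<lambda>x. complex_of_real (f x)) F"
    "integrable lborel (\<lambda>\<xi>. (1 + \<xi>\<^sup>2) powr \<sigma> * (cmod (F \<xi>))\<^sup>2)"
    "sobolev_norm \<sigma> f = sqrt (LINT \<xi>|lborel. (1 + \<xi>\<^sup>2) powr \<sigma> * (cmod (F \<xi>))\<^sup>2)"
proof -
  define F where "F = (SOME F. is_fourier_L2 (\<lambda>x. complex_of_real (f x)) F)"
  obtain G where G: "is_fourier_L2 (\<lambda>x. complex_of_real (f x)) G"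
    "integrable lborel (\<lambda>\<xi>. (1 + \<xi>\<^sup>2) powr \<sigma> * (cmod (G \<xi>))\<^sup>2)"
    using f by (auto simp: sobolev_space_def)
  have F: "is_fourier_L2 (\<lambda>x. complex_of_real (f x)) F"
    unfolding F_def using someI[of "is_fourier_L2 (\<lambda>x. complex_of_real (f x))"] G(1) by blast
  have [measurable]: "F \<in> borel_measurable borel" "G \<in> borel_measurable borel"
    using F G by (auto simp: is_fourier_L2_def square_integrable_def)
  have "AE \<xi> in lborel. F \<xi> = G \<xi>" by (rule is_fourier_L2_unique[OF F G(1)])
  then have "integrable lborel (\<lambda>\<xi>. (1 + \<xi>\<^sup>2) powr \<sigma> * (cmod (F \<xi>))\<^sup>2) \<longleftrightarrow>
     integrable lborel (\<lambda>\<xi>. (1 + \<xi>\<^sup>2) powr \<sigma> * (cmod (G \<xi>))\<^sup>2)"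
    by (intro integrable_cong_AE) (auto elim!: eventually_mono)
  with F G show thesis by (intro that[of F]) (auto simp: sobolev_norm_def F_def Let_def)
qed

lemma sobolev_norm_nonneg: "sobolev_norm \<sigma> f \<ge> 0"
  unfolding sobolev_norm_def Let_def by simp

lemma sobolev_space_diff:
  assumes "f \<in> sobolev_space \<sigma>" "g \<in> sobolev_space \<sigma>"
  shows "(\<lambda>x. f x - g x) \<in> sobolev_space \<sigma>"
proof -
  obtain F where F: "is_fourier_L2 (\<lambda>x. complex_of_real (f x)) F"
    "integrable lborel (\<lambda>\<xi>. (1 + \<xi>\<^sup>2) powr \<sigma> * (cmod (F \<xi>))\<^sup>2)"
    using assms(1) by (auto simp: sobolev_space_def)
  obtain G where G: "is_fourier_L2 (\<lambda>x. complex_of_real (g x)) G"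
    "integrable lborel (\<lambda>\<xi>. (1 + \<xi>\<^sup>2) powr \<sigma> * (cmod (G \<xi>))\<^sup>2)"
    using assms(2) by (auto simp: sobolev_space_def)
  have [measurable]: "F \<in> borel_measurable borel" "G \<in> borel_measurable borel"
    using F G by (auto simp: is_fourier_L2_def square_integrable_def)
  have "integrable lborel (\<lambda>\<xi>. (1 + \<xi>\<^sup>2) powr \<sigma> * (cmod (F \<xi> - G \<xi>))\<^sup>2)"
  proof (rule Bochner_Integration.integrable_bound)
    show "integrable lborel (\<lambda>\<xi>. 2 * ((1 + \<xi>\<^sup>2) powr \<sigma> * (cmod (F \<xi>))\<^sup>2) + 2 * ((1 + \<xi>\<^sup>2) powr \<sigma> * (cmod (G \<xi>))\<^sup>2))"
      using F G by auto
    have "(1 + \<xi>\<^sup>2) powr \<sigma> * (cmod (F \<xi> - G \<xi>))\<^sup>2 \<le> 2 * ((1 + \<xi>\<^sup>2) powr \<sigma> * (cmod (F \<xi>))\<^sup>2) + 2 * ((1 + \<xi>\<^sup>2) powr \<sigma> * (cmod (G \<xi>))\<^sup>2)" for \<xi>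
      using mult_left_mono[OF cmod_diff_sq_le[of "F \<xi>" "G \<xi>"], of "(1 + \<xi>\<^sup>2) powr \<sigma>"]
      by (simp add: distrib_left mult.left_commute)
    then show "AE \<xi> in lborel. norm ((1 + \<xi>\<^sup>2) powr \<sigma> * (cmod (F \<xi> - G \<xi>))\<^sup>2) \<le>
       norm (2 * ((1 + \<xi>\<^sup>2) powr \<sigma> * (cmod (F \<xi>))\<^sup>2) + 2 * ((1 + \<xi>\<^sup>2) powr \<sigma> * (cmod (G \<xi>))\<^sup>2))"
      by (auto simp: abs_of_nonneg)
  qed simp
  with is_fourier_L2_diff[OF F(1) G(1)] show ?thesis
    by (auto simp: sobolev_space_def)
qed

lemma sobolev_space_cmult:
  assumes "f \<in> sobolev_space \<sigma>"
  shows "(\<lambda>x. c * f x) \<in> sobolev_space \<sigma>"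
proof -
  obtain F where F: "is_fourier_L2 (\<lambda>x. complex_of_real (f x)) F"
    "integrable lborel (\<lambda>\<xi>. (1 + \<xi>\<^sup>2) powr \<sigma> * (cmod (F \<xi>))\<^sup>2)"
    using assms(1) by (auto simp: sobolev_space_def)
  have "integrable lborel (\<lambda>\<xi>. c\<^sup>2 * ((1 + \<xi>\<^sup>2) powr \<sigma> * (cmod (F \<xi>))\<^sup>2))"
    using F(2) by simp
  then have "integrable lborel (\<lambda>\<xi>. (1 + \<xi>\<^sup>2) powr \<sigma> * (cmod (complex_of_real c * F \<xi>))\<^sup>2)"
    by (simp add: norm_mult power_mult_distrib mult_ac)
  with is_fourier_L2_cmult[OF F(1), of "complex_of_real c"] show ?thesis
    by (auto simp: sobolev_space_def)
qed

lemma sobolev_cong_AE: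
  assumes "AE x in lborel. f x = g x" "f \<in> borel_measurable borel" "g \<in> borel_measurable borel"
  shows "f \<in> sobolev_space \<sigma> \<longleftrightarrow> g \<in> sobolev_space \<sigma>" "sobolev_norm \<sigma> f = sobolev_norm \<sigma> g"
proof -
  have "is_fourier_L2 (\<lambda>x. complex_of_real (f x)) F \<longleftrightarrow> is_fourier_L2 (\<lambda>x. complex_of_real (g x)) F" for F
    by (rule is_fourier_L2_cong_AE) (use assms in \<open>auto elim!: eventually_mono\<close>)
  then show "f \<in> sobolev_space \<sigma> \<longleftrightarrow> g \<in> sobolev_space \<sigma>" "sobolev_norm \<sigma> f = sobolev_norm \<sigma> g"
    by (auto simp: sobolev_space_def sobolev_norm_def)
qed

lemma sobolev_space_borel_measurable: "f \<in> sobolev_space \<sigma> \<Longrightarrow> f \<in> borel_measurable borel"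
proof -
  assume "f \<in> sobolev_space \<sigma>"
  then have "(\<lambda>x. complex_of_real (f x)) \<in> borel_measurable borel"
    by (auto simp: sobolev_space_def is_fourier_L2_def square_integrable_def)
  then have "(\<lambda>x. Re (complex_of_real (f x))) \<in> borel_measurable borel"
    by measurable
  then show ?thesis by simp
qed

text \<open>Cauchy-Schwarz for the splitting r/2 = (r - s)/2 + s/2 of the exponent; s - r > 1/2
  makes the first square integrable. The case r = 0 serves f, the case r = 1 its derivative.\<close>

lemma integrable_weighted_fourier:
  fixes F :: "real \<Rightarrow> complex"
  assumes [measurable]: "F \<in> borel_measurable borel"
    and i: "integrable lborel (\<lambda>\<xi>. (1 + \<xi>\<^sup>2) powr s * (cmod (F \<xi>))\<^sup>2)" and s: "s - r > 1 / 2"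
  shows "integrable lborel (\<lambda>\<xi>. (1 + \<xi>\<^sup>2) powr (r / 2) * cmod (F \<xi>))"
    and "(LINT \<xi>|lborel. (1 + \<xi>\<^sup>2) powr (r / 2) * cmod (F \<xi>))
      \<le> sqrt (LINT \<xi>|lborel. (1 + \<xi>\<^sup>2) powr (- (s - r))) * sqrt (LINT \<xi>|lborel. (1 + \<xi>\<^sup>2) powr s * (cmod (F \<xi>))\<^sup>2)"
proof -
  let ?f = "\<lambda>\<xi>::real. (1 + \<xi>\<^sup>2) powr ((r - s) / 2)" and ?g = "\<lambda>\<xi>. (1 + \<xi>\<^sup>2) powr (s / 2) * cmod (F \<xi>)"
  have sq: "(t powr p)\<^sup>2 = t powr (2 * p)" if "t > 0" for t p :: real
    using that by (simp add: power2_eq_square flip: powr_add)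
  have pos: "1 + \<xi>\<^sup>2 > 0" for \<xi> :: real by (smt (verit) zero_le_power2)
  have f2: "(?f \<xi>)\<^sup>2 = (1 + \<xi>\<^sup>2) powr (- (s - r))" for \<xi>
  proof -
    have "2 * ((r - s) / 2) = - (s - r)" by simp
    then show ?thesis by (simp only: sq[OF pos])
  qed
  have g2: "(?g \<xi>)\<^sup>2 = (1 + \<xi>\<^sup>2) powr s * (cmod (F \<xi>))\<^sup>2" for \<xi> by (simp add: power_mult_distrib sq pos)
  have fg: "?f \<xi> * ?g \<xi> = (1 + \<xi>\<^sup>2) powr (r / 2) * cmod (F \<xi>)" for \<xi>
    by (simp add: mult.assoc[symmetric] diff_divide_distrib flip: powr_add)
  have f2i: "integrable lborel (\<lambda>\<xi>. (?f \<xi>)\<^sup>2)"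
    unfolding f2 using s by (rule integrable_powr_sq)
  have g2i: "integrable lborel (\<lambda>\<xi>. (?g \<xi>)\<^sup>2)" unfolding g2 by (rule i)
  have m: "?f \<in> borel_measurable lborel" "?g \<in> borel_measurable lborel" by measurable
  note cs = cauchy_schwarz_integral[OF m f2i g2i]
  show "integrable lborel (\<lambda>\<xi>. (1 + \<xi>\<^sup>2) powr (r / 2) * cmod (F \<xi>))" using cs(1) unfolding fg .
  show "(LINT \<xi>|lborel. (1 + \<xi>\<^sup>2) powr (r / 2) * cmod (F \<xi>))
      \<le> sqrt (LINT \<xi>|lborel. (1 + \<xi>\<^sup>2) powr (- (s - r))) * sqrt (LINT \<xi>|lborel. (1 + \<xi>\<^sup>2) powr s * (cmod (F \<xi>))\<^sup>2)"
    using cs(2) unfolding fg f2 g2 by (simp add: abs_mult)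
qed

definition embedding_const :: "real \<Rightarrow> real" where
  "embedding_const \<sigma> = sqrt (LINT \<xi>|lborel. (1 + \<xi>\<^sup>2) powr (- \<sigma>))"

text \<open>Taking real parts costs nothing since f is real, and it makes the real-valued rules for
  differentiation under the integral applicable.\<close>

lemma sobolev_inversion:
  assumes f: "f \<in> sobolev_space s" and s: "s > 1 / 2" and c: "continuous_on UNIV f"
  obtains F where "F \<in> borel_measurable borel"
    "integrable lborel (\<lambda>\<xi>. (1 + \<xi>\<^sup>2) powr s * (cmod (F \<xi>))\<^sup>2)"
    "sobolev_norm s f = sqrt (LINT \<xi>|lborel. (1 + \<xi>\<^sup>2) powr s * (cmod (F \<xi>))\<^sup>2)"
    "integrable lborel F"
    "\<And>x. f x = (LINT \<xi>|lborel. Re (F \<xi> * cis (x * \<xi>))) / (2 * pi)"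
proof -
  obtain F where F: "is_fourier_L2 (\<lambda>x. complex_of_real (f x)) F"
    "integrable lborel (\<lambda>\<xi>. (1 + \<xi>\<^sup>2) powr s * (cmod (F \<xi>))\<^sup>2)"
    "sobolev_norm s f = sqrt (LINT \<xi>|lborel. (1 + \<xi>\<^sup>2) powr s * (cmod (F \<xi>))\<^sup>2)"
    using sobolev_space_fourier[OF f] .
  have m[measurable]: "F \<in> borel_measurable borel" 
    using F by (auto simp: is_fourier_L2_def square_integrable_def)
  have "integrable lborel (\<lambda>\<xi>. cmod (F \<xi>))"
  proof -
    have "1 + \<xi>\<^sup>2 > 0" for \<xi> :: real by (smt (verit) zero_le_power2)
    then show ?thesis
      using integrable_weighted_fourier(1)[OF m F(2), of 0] s by (simp add: less_imp_neq[symmetric])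
  qed
  then have i: "integrable lborel F" by (rule integrable_norm_cancel) simp
  have "f x = (LINT \<xi>|lborel. Re (F \<xi> * cis (x * \<xi>))) / (2 * pi)" for x
  proof -
    have "isCont (\<lambda>x. complex_of_real (f x)) x"
      using c by (intro continuous_intros) (simp add: continuous_on_eq_continuous_at)
    from fourier_L2_inversion[OF F(1) i this]
    have "(LINT \<xi>|lborel. F \<xi> * cis (x * \<xi>)) = complex_of_real (2 * pi * f x)" by simp
    moreover have "integrable lborel (\<lambda>\<xi>. F \<xi> * cis (x * \<xi>))"
      by (rule Bochner_Integration.integrable_bound[OF i]) (auto simp: norm_mult)
    ultimately have "(LINT \<xi>|lborel. Re (F \<xi> * cis (x * \<xi>))) = 2 * pi * f x"
      by (simp only: integral_Re) simp
    then show ?thesis by simp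
  qed
  with m F(2,3) i show thesis by (rule that)
qed

theorem sobolev_embedding:
  assumes f: "f \<in> sobolev_space \<sigma>" and \<sigma>: "\<sigma> > 1 / 2" and c: "continuous_on UNIV f"
  shows "\<bar>f x\<bar> \<le> embedding_const \<sigma> * sobolev_norm \<sigma> f"
proof -
  obtain F where m[measurable]: "F \<in> borel_measurable borel"
    and i2: "integrable lborel (\<lambda>\<xi>. (1 + \<xi>\<^sup>2) powr \<sigma> * (cmod (F \<xi>))\<^sup>2)"
    and n: "sobolev_norm \<sigma> f = sqrt (LINT \<xi>|lborel. (1 + \<xi>\<^sup>2) powr \<sigma> * (cmod (F \<xi>))\<^sup>2)"
    and i: "integrable lborel F"
    and eq: "\<And>x. f x = (LINT \<xi>|lborel. Re (F \<xi> * cis (x * \<xi>))) / (2 * pi)"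
    by (rule sobolev_inversion[OF f \<sigma> c]) blast
  have pos: "1 + \<xi>\<^sup>2 > 0" for \<xi> :: real by (smt (verit) zero_le_power2)
  have "\<bar>LINT \<xi>|lborel. Re (F \<xi> * cis (x * \<xi>))\<bar> \<le> (LINT \<xi>|lborel. cmod (F \<xi>))"
  proof (rule integral_abs_bound_integral)
    show "\<bar>Re (F \<xi> * cis (x * \<xi>))\<bar> \<le> cmod (F \<xi>)" for \<xi>
      using abs_Re_le_cmod[of "F \<xi> * cis (x * \<xi>)"] by (simp add: norm_mult)
    show "integrable lborel (\<lambda>\<xi>. Re (F \<xi> * cis (x * \<xi>)))"
      by (rule Bochner_Integration.integrable_bound[OF i])
        (auto intro!: order_trans[OF abs_Re_le_cmod] simp: norm_mult simp del: times_complex.sel)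
  qed (use i in auto)
  also have "\<dots> \<le> embedding_const \<sigma> * sobolev_norm \<sigma> f"
    using integrable_weighted_fourier(2)[OF m i2, of 0] \<sigma> pos
    by (simp add: n embedding_const_def less_imp_neq[symmetric])
  finally have *: "\<bar>LINT \<xi>|lborel. Re (F \<xi> * cis (x * \<xi>))\<bar> \<le> embedding_const \<sigma> * sobolev_norm \<sigma> f" .
  have "\<bar>f x\<bar> = \<bar>LINT \<xi>|lborel. Re (F \<xi> * cis (x * \<xi>))\<bar> / (2 * pi)"
    by (simp add: eq abs_divide)
  \<comment> \<open>The factor 1 / (2\<pi>) from inversion is at most 1 and is dropped, which is why
    \<open>embedding_const\<close> does not contain it.\<close>
  also have "\<dots> \<le> \<bar>LINT \<xi>|lborel. Re (F \<xi> * cis (x * \<xi>))\<bar>"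
    using pi_gt3 by (simp add: divide_le_eq mult_le_cancel_left1)
  finally show ?thesis using * by simp
qed

theorem sobolev_embedding_deriv:
  assumes f: "f \<in> sobolev_space s" and s: "s > 3 / 2" and c: "continuous_on UNIV f"
  shows "(f has_real_derivative deriv f x) (at x)"
    and "continuous_on UNIV (deriv f)"
    and "\<bar>deriv f x\<bar> \<le> embedding_const (s - 1) * sobolev_norm s f"
proof -
  obtain F where m[measurable]: "F \<in> borel_measurable borel"
    and i2: "integrable lborel (\<lambda>\<xi>. (1 + \<xi>\<^sup>2) powr s * (cmod (F \<xi>))\<^sup>2)"
    and n: "sobolev_norm s f = sqrt (LINT \<xi>|lborel. (1 + \<xi>\<^sup>2) powr s * (cmod (F \<xi>))\<^sup>2)"
    and i: "integrable lborel F"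
    and eq: "\<And>x. f x = (LINT \<xi>|lborel. Re (F \<xi> * cis (x * \<xi>))) / (2 * pi)"
    by (rule sobolev_inversion[OF f _ c]) (use s in auto)
  have pos: "1 + \<xi>\<^sup>2 > 0" for \<xi> :: real by (smt (verit) zero_le_power2)
  \<comment> \<open>As |\<xi>| \<le> (1 + \<xi>^2)^(1/2), this dominates the differentiated
    integrand; it is integrable since s - 1 > 1/2.\<close>
  let ?w = "\<lambda>\<xi>. (1 + \<xi>\<^sup>2) powr (1 / 2) * cmod (F \<xi>)"
  have w: "integrable lborel ?w"
    using integrable_weighted_fourier(1)[OF m i2, of 1] s by simp
  let ?f = "\<lambda>x \<xi>. Re (F \<xi> * cis (x * \<xi>))" and ?f' = "\<lambda>x \<xi>. Re (F \<xi> * (\<i> * cis (x * \<xi>))) * \<xi>"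
  have d: "((\<lambda>x. ?f x \<xi>) has_real_derivative ?f' x \<xi>) (at x)" for x \<xi>
    by (auto intro!: derivative_eq_intros simp: algebra_simps)
  have b: "\<bar>?f' x \<xi>\<bar> \<le> ?w \<xi>" for x \<xi>
  proof -
    have "\<bar>?f' x \<xi>\<bar> = \<bar>Re (F \<xi> * (\<i> * cis (x * \<xi>)))\<bar> * \<bar>\<xi>\<bar>" by (simp add: abs_mult)
    also have "\<dots> \<le> cmod (F \<xi>) * (1 + \<xi>\<^sup>2) powr (1 / 2)"
    proof (intro mult_mono)
      show "\<bar>Re (F \<xi> * (\<i> * cis (x * \<xi>)))\<bar> \<le> cmod (F \<xi>)"
        using abs_Re_le_cmod[of "F \<xi> * (\<i> * cis (x * \<xi>))"] by (simp add: norm_mult)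
      show "\<bar>\<xi>\<bar> \<le> (1 + \<xi>\<^sup>2) powr (1 / 2)"
        by (subst powr_half_sqrt) (auto intro!: real_le_rsqrt)
    qed auto
    finally show ?thesis by (simp add: mult.commute)
  qed
  have fi: "integrable lborel (?f x)" for x
    by (rule Bochner_Integration.integrable_bound[OF i])
        (auto intro!: order_trans[OF abs_Re_le_cmod] simp: norm_mult simp del: times_complex.sel)
  have D: "((\<lambda>x. LINT \<xi>|lborel. ?f x \<xi>) has_real_derivative (LINT \<xi>|lborel. ?f' x \<xi>)) (at x)" for x
    by (rule has_real_derivative_lebesgue_integral[OF d b w fi]) measurable
  have D': "(f has_real_derivative (LINT \<xi>|lborel. ?f' x \<xi>) / (2 * pi)) (at x)" for x
    using DERIV_cdivide[OF D, of "2 * pi" x] by (simp only: eq[symmetric])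
  then have df: "deriv f x = (LINT \<xi>|lborel. ?f' x \<xi>) / (2 * pi)" for x by (rule DERIV_imp_deriv)
  show "(f has_real_derivative deriv f x) (at x)" using D' by (simp add: df)
  show "continuous_on UNIV (deriv f)"
  proof (intro continuous_at_imp_continuous_on ballI)
    fix x
    have "isCont (\<lambda>x. LINT \<xi>|lborel. ?f' x \<xi>) x"
    proof (rule isCont_lebesgue_integral[OF _ b w])
      show "isCont (\<lambda>x. ?f' x \<xi>) x" for \<xi> by simp
    qed measurable
    then show "isCont (deriv f) x"
      unfolding df by (intro continuous_intros) auto
  qed
  have "\<bar>LINT \<xi>|lborel. ?f' x \<xi>\<bar> \<le> (LINT \<xi>|lborel. ?w \<xi>)"
  proof (rule integral_abs_bound_integral[OF _ w b])
    show "integrable lborel (?f' x)"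
      by (rule Bochner_Integration.integrable_bound[OF w])
         (use b in \<open>auto simp: abs_of_nonneg simp del: times_complex.sel\<close>)
  qed
  also have "\<dots> \<le> embedding_const (s - 1) * sobolev_norm s f"
    using integrable_weighted_fourier(2)[OF m i2, of 1] s
    by (simp add: n embedding_const_def)
  finally have *: "\<bar>LINT \<xi>|lborel. ?f' x \<xi>\<bar> \<le> embedding_const (s - 1) * sobolev_norm s f" .
  have "\<bar>deriv f x\<bar> = \<bar>LINT \<xi>|lborel. ?f' x \<xi>\<bar> / (2 * pi)"
    by (simp add: df abs_divide)
  also have "\<dots> \<le> \<bar>LINT \<xi>|lborel. ?f' x \<xi>\<bar>"
    using pi_gt3 by (simp add: divide_le_eq mult_le_cancel_left1)
  finally show "\<bar>deriv f x\<bar> \<le> embedding_const (s - 1) * sobolev_norm s f" using * by simp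
qed

text \<open>If |f(x)| \<ge> e far out, the Lipschitz bound keeps |f| \<ge> e/2 on an interval of
  fixed length around x, whose share of the integral of f^2 exceeds the whole tail.\<close>

lemma lipschitz_square_integrable_tendsto_0:
  fixes f :: "real \<Rightarrow> real"
  assumes lip: "\<And>x y. \<bar>f x - f y\<bar> \<le> L * \<bar>x - y\<bar>" and i: "integrable lborel (\<lambda>x. (f x)\<^sup>2)"
  shows "(f \<longlongrightarrow> 0) at_infinity"
proof -
  have "continuous_on UNIV f"
  proof (rule lipschitz_on_continuous_on)
    show "\<bar>L\<bar>-lipschitz_on UNIV f"
      by (rule lipschitz_onI) (auto simp: dist_real_def intro!: order_trans[OF lip] mult_right_mono)
  qed
  then have [measurable]: "f \<in> borel_measurable borel" by (rule borel_measurable_continuous_onI)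
  have "((\<lambda>R. LINT y|lborel. indicator {y. \<bar>y\<bar> \<ge> R} y * (f y)\<^sup>2) \<longlongrightarrow> integral\<^sup>L lborel (\<lambda>y::real. 0)) at_top"
  proof (rule integral_dominated_convergence_at_top)
    show "AE y in lborel. ((\<lambda>R. indicator {y. \<bar>y\<bar> \<ge> R} y * (f y)\<^sup>2) \<longlongrightarrow> 0) at_top"
    proof (intro AE_I2 tendsto_eventually)
      fix y :: real
      show "\<forall>\<^sub>F R in at_top. indicator {y. \<bar>y\<bar> \<ge> R} y * (f y)\<^sup>2 = 0"
        using eventually_gt_at_top[of "\<bar>y\<bar>"] by eventually_elim auto
    qed
    show "\<forall>\<^sub>F R in at_top. AE y in lborel. norm (indicator {y. \<bar>y\<bar> \<ge> R} y * (f y)\<^sup>2) \<le> (f y)\<^sup>2"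
      by (intro always_eventually allI AE_I2) (auto simp: indicator_def)
  qed (use i in auto)
  then have tail: "((\<lambda>R. LINT y|lborel. indicator {y. \<bar>y\<bar> \<ge> R} y * (f y)\<^sup>2) \<longlongrightarrow> 0) at_top" by simp
  show ?thesis
  proof (rule tendstoI)
    fix e :: real assume e: "e > 0"
    \<comment> \<open>The summand 1 keeps the divisor positive for L = 0; over a distance
      \<open>d\<close> the function changes by at most e/2.\<close>
    define M where "M = \<bar>L\<bar> + 1"
    define d where "d = e / (2 * M)"
    have M: "M > 0" by (simp add: M_def add_nonneg_pos)
    have d: "d > 0" using e M by (simp add: d_def)
    have "\<forall>\<^sub>F R in at_top. (LINT y|lborel. indicator {y. \<bar>y\<bar> \<ge> R} y * (f y)\<^sup>2) < 2 * d * (e / 2)\<^sup>2"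
      using tail by (rule order_tendstoD) (use d e in simp)
    then obtain R where R: "(LINT y|lborel. indicator {y. \<bar>y\<bar> \<ge> R} y * (f y)\<^sup>2) < 2 * d * (e / 2)\<^sup>2"
      using eventually_happens by fastforce
    have "\<bar>f x\<bar> < e" if x: "\<bar>x\<bar> \<ge> R + d" for x
    proof (rule ccontr)
      assume "\<not> \<bar>f x\<bar> < e"
      have big: "\<bar>f y\<bar> \<ge> e / 2" if y: "y \<in> {x - d..x + d}" for y
      proof -
        have "\<bar>f x - f y\<bar> \<le> L * \<bar>x - y\<bar>" by (rule lip)
        also have "\<dots> \<le> M * d" using y M by (intro mult_mono) (auto simp: M_def)
        also have "\<dots> = e / 2" using M by (simp add: d_def)
        finally show ?thesis using \<open>\<not> \<bar>f x\<bar> < e\<close> by linarith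
      qed
      have "2 * d * (e / 2)\<^sup>2 = (LINT y|lborel. indicator {x - d..x + d} y * (e / 2)\<^sup>2)"
        using d by simp
      also have "\<dots> \<le> (LINT y|lborel. indicator {y. \<bar>y\<bar> \<ge> R} y * (f y)\<^sup>2)"
      proof (rule integral_mono)
        show "integrable lborel (\<lambda>y. indicat_real {x - d..x + d} y * (e / 2)\<^sup>2)"
          by (intro integrable_mult_left integrable_real_indicator) (auto simp: emeasure_lborel_Icc_eq)
        show "integrable lborel (\<lambda>y. indicator {y. \<bar>y\<bar> \<ge> R} y * (f y)\<^sup>2)"
          by (rule Bochner_Integration.integrable_bound[OF i]) (auto simp: indicator_def)
        show "indicat_real {x - d..x + d} y * (e / 2)\<^sup>2 \<le> indicator {y. \<bar>y\<bar> \<ge> R} y * (f y)\<^sup>2" for y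
        proof (cases "y \<in> {x - d..x + d}")
          case True
          then have "\<bar>y\<bar> \<ge> R" using x by auto
          moreover have "(e / 2)\<^sup>2 \<le> (f y)\<^sup>2"
            using big[OF True] e by (subst abs_le_square_iff[symmetric]) auto
          ultimately show ?thesis using True by simp
        qed auto
      qed
      finally show False using R by simp
    qed
    then show "\<forall>\<^sub>F x in at_infinity. dist (f x) 0 < e"
      unfolding eventually_at_infinity by (intro exI[of _ "R + d"]) auto
  qed
qed

text \<open>Supplies the attainment of suprema in the maximum principle: outside a compact set the
  values are too small to compete.\<close>

lemma sobolev_tendsto_0:
  assumes f: "f \<in> sobolev_space s" and s: "s > 3 / 2" and c: "continuous_on UNIV f"
  shows "(f \<longlongrightarrow> 0) at_infinity"
proof (rule lipschitz_square_integrable_tendsto_0)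
  note e = sobolev_embedding_deriv[OF f s c]
  show "\<bar>f x - f y\<bar> \<le> embedding_const (s - 1) * sobolev_norm s f * \<bar>x - y\<bar>" for x y
    using field_differentiable_bound[of UNIV f "deriv f" "embedding_const (s - 1) * sobolev_norm s f" x y] e
    by (auto dest: has_field_derivative_at_within)
  show "integrable lborel (\<lambda>x. (f x)\<^sup>2)"
    using f by (auto simp: sobolev_space_def is_fourier_L2_def square_integrable_def)
qed

section \<open>The Helmholtz operator\<close>

lemma exp_integral_atMost:
  fixes c x :: real
  assumes c: "c > 0"
  shows "set_integrable lborel {..x} (\<lambda>y. exp (c * y))"
    and "(LINT y:{..x}|lborel. exp (c * y)) = exp (c * x) / c"
proof -
  have hi: "((\<lambda>y. exp (- c * y)) has_integral exp (- c * - x) / c) {- x..}"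
    by (rule has_integral_exp_minus_to_infinity[OF c])
  then have "(\<lambda>y. exp (- c * y)) absolutely_integrable_on {- x..}"
    by (intro nonnegative_absolutely_integrable_1) (auto simp: integrable_on_def)
  then have si: "set_integrable lborel {- x..} (\<lambda>y. exp (- c * y))"
    by (simp add: set_integrable_def integrable_completion)
  have val: "(LINT y:{- x..}|lborel. exp (- c * y)) = exp (c * x) / c"
    using set_borel_integral_eq_integral(2)[OF si] hi by (simp add: integral_unique)
  have eq: "indicator {- x..} (0 + (-1) * y) *\<^sub>R exp (- c * (0 + (-1) * y)) = indicator {..x} y *\<^sub>R exp (c * y)" for y
    by (auto simp: indicator_def)
  show "set_integrable lborel {..x} (\<lambda>y. exp (c * y))"
    using lborel_integrable_real_affine[OF si[unfolded set_integrable_def], of "-1" 0]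
    unfolding eq by (simp add: set_integrable_def)
  show "(LINT y:{..x}|lborel. exp (c * y)) = exp (c * x) / c"
    using val lborel_integral_real_affine[of "-1" "\<lambda>y. indicator {- x..} y *\<^sub>R exp (- c * y)" 0]
    unfolding eq set_lebesgue_integral_def by simp
qed

text \<open>For y \<le> x the kernel factors into \<open>exp (- x)\<close> and \<open>exp y\<close>,
  so this is the left half of the convolution up to a factor in x. The right half is the same
  operation applied to the reflected function at - x.\<close>

definition lower_exp_integral :: "(real \<Rightarrow> real) \<Rightarrow> real \<Rightarrow> real" where
  "lower_exp_integral f x = (LINT y:{..x}|lborel. exp y * f y)"

lemma lower_exp_integrable:
  fixes f :: "real \<Rightarrow> real"
  assumes c: "continuous_on UNIV f" and b: "\<And>y. \<bar>f y\<bar> \<le> K"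
  shows "set_integrable lborel {..x} (\<lambda>y. exp y * f y)"
proof (rule set_integrable_bound)
  have [measurable]: "f \<in> borel_measurable borel" using c by (rule borel_measurable_continuous_onI)
  show "set_integrable lborel {..x} (\<lambda>y. K * exp (1 * y))"
    using exp_integral_atMost(1)[of 1 x] by (intro set_integrable_mult_right) simp
  show "set_borel_measurable lborel {..x} (\<lambda>y. exp y * f y)"
    unfolding set_borel_measurable_def by measurable
  show "AE y in lborel. y \<in> {..x} \<longrightarrow> norm (exp y * f y) \<le> norm (K * exp (1 * y))"
  proof (intro AE_I2 impI)
    fix y
    have "\<bar>f y\<bar> \<le> \<bar>K\<bar>" using b[of y] by linarith
    then show "norm (exp y * f y) \<le> norm (K * exp (1 * y))" by (simp add: abs_mult)
  qed
qed

text \<open>Moves the variable end point into a gauge integral over a compact interval, where the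
  fundamental theorem of calculus is available.\<close>

lemma lower_exp_integral_split:
  assumes c: "continuous_on UNIV f" and b: "\<And>y. \<bar>f y\<bar> \<le> K" and ax: "a \<le> x"
  shows "lower_exp_integral f x = lower_exp_integral f a + integral {a..x} (\<lambda>y. exp y * f y)"
proof -
  have i: "set_integrable lborel {..x} (\<lambda>y. exp y * f y)" for x
    by (rule lower_exp_integrable[OF c b])
  have ia: "set_integrable lborel {a..x} (\<lambda>y. exp y * f y)"
    using i[of x] by (rule set_integrable_subset) auto
  have io: "set_integrable lborel {a<..x} (\<lambda>y. exp y * f y)"
    using i[of x] by (rule set_integrable_subset) auto
  have "{..x} = {..a} \<union> {a<..x}" using ax by auto
  then have "lower_exp_integral f x = lower_exp_integral f a + (LINT y:{a<..x}|lborel. exp y * f y)"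
    unfolding lower_exp_integral_def using set_integral_Un[OF _ i[of a] io] by force
  also have "(LINT y:{a<..x}|lborel. exp y * f y) = (LINT y:{a..x}|lborel. exp y * f y)"
    unfolding set_lebesgue_integral_def
    by (rule integral_discrete_difference[where X = "{a}"]) (auto simp: indicator_def)
  also have "\<dots> = integral {a..x} (\<lambda>y. exp y * f y)"
    by (rule set_borel_integral_eq_integral(2)[OF ia])
  finally show ?thesis .
qed

lemma lower_exp_integral_deriv:
  assumes c: "continuous_on UNIV f" and b: "\<And>y. \<bar>f y\<bar> \<le> K"
  shows "(lower_exp_integral f has_real_derivative exp x * f x) (at x)"
proof -
  have "((\<lambda>u. integral {x - 1..u} (\<lambda>y. exp y * f y)) has_real_derivative exp x * f x) (at x within {x - 1..x + 1})"
    using c by (intro integral_has_real_derivative continuous_intros) (auto intro: continuous_on_subset)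
  then have "((\<lambda>u. integral {x - 1..u} (\<lambda>y. exp y * f y)) has_real_derivative exp x * f x) (at x)"
    by (simp add: at_within_Icc_at)
  then have "((\<lambda>u. lower_exp_integral f (x - 1) + integral {x - 1..u} (\<lambda>y. exp y * f y)) has_real_derivative exp x * f x) (at x)"
    by (auto intro!: derivative_eq_intros)
  then show ?thesis
  proof (rule has_field_derivative_transform_within_open)
    show "lower_exp_integral f (x - 1) + integral {x - 1..u} (\<lambda>y. exp y * f y) = lower_exp_integral f u"
      if "u \<in> {x - 1<..}" for u
      using that by (subst lower_exp_integral_split[OF c b, of "x - 1" u]) auto
  qed auto
qed

text \<open>\<open>\<beta>\<close> may be negative: the weight exp (- \<alpha> y) + \<epsilon> calls
  for \<beta> = \<alpha> on the left half and \<beta> = - \<alpha> on the reflected right half. The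
  bound \<open>K\<close> secures integrability, the other bound the size.\<close>

lemma lower_exp_integral_bound:
  assumes c: "continuous_on UNIV f" and b: "\<And>y. \<bar>f y\<bar> \<le> K" 
    and b': "\<And>y. \<bar>f y\<bar> \<le> p * exp (- \<beta> * y) + q" and "\<beta> < 1"
  shows "\<bar>lower_exp_integral f x\<bar> \<le> p * (exp ((1 - \<beta>) * x) / (1 - \<beta>)) + q * exp x"
proof -
  note i1 = set_integrable_mult_right[OF exp_integral_atMost(1)[of "1 - \<beta>" x], of p]
  note i2 = set_integrable_mult_right[OF exp_integral_atMost(1)[of 1 x], of q]
  have "\<bar>lower_exp_integral f x\<bar> \<le> (LINT y:{..x}|lborel. \<bar>exp y * f y\<bar>)"
    unfolding lower_exp_integral_def
    using set_integral_norm_bound[OF lower_exp_integrable[OF c b]] by simp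
  also have "\<dots> \<le> (LINT y:{..x}|lborel. p * exp ((1 - \<beta>) * y) + q * exp (1 * y))"
  proof (rule set_integral_mono)
    show "set_integrable lborel {..x} (\<lambda>y. \<bar>exp y * f y\<bar>)"
      by (intro set_integrable_abs lower_exp_integrable[OF c b])
    show "set_integrable lborel {..x} (\<lambda>y. p * exp ((1 - \<beta>) * y) + q * exp (1 * y))"
      using assms by (intro set_integral_add i1 i2) auto
    fix y
    have "\<bar>exp y * f y\<bar> \<le> exp y * (p * exp (- \<beta> * y) + q)"
      using b'[of y] by (simp add: abs_mult)
    also have "\<dots> = p * exp ((1 - \<beta>) * y) + q * exp (1 * y)"
      by (simp add: algebra_simps exp_diff exp_minus divide_inverse)
    finally show "\<bar>exp y * f y\<bar> \<le> p * exp ((1 - \<beta>) * y) + q * exp (1 * y)" .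
  qed
  also have "\<dots> = p * (exp ((1 - \<beta>) * x) / (1 - \<beta>)) + q * exp x"
    using assms by (subst set_integral_add(2)[OF i1 i2])
      (auto simp: exp_integral_atMost(2)[of "1 - \<beta>"] exp_integral_atMost(2)[of 1, simplified])
  finally show ?thesis .
qed

text \<open>The lower bound does not depend on x once x \<ge> b: mass of f at any place stays
  visible in the half-line integral as x tends to infinity.\<close>

lemma lower_exp_integral_ge:
  assumes c: "continuous_on UNIV f" and b: "\<And>y. \<bar>f y\<bar> \<le> K" and nn: "\<And>y. f y \<ge> 0"
    and "a \<le> b" "b \<le> x" and ge: "\<And>y. y \<in> {a..b} \<Longrightarrow> f y \<ge> \<kappa>" and "\<kappa> \<ge> 0"
  shows "lower_exp_integral f x \<ge> \<kappa> * exp a * (b - a)"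
proof -
  have int: "(\<lambda>y. exp y * f y) integrable_on {a..b}" for a b
    using c by (intro integrable_continuous_interval continuous_intros) (auto intro: continuous_on_subset)
  have "lower_exp_integral f a \<ge> 0"
    unfolding lower_exp_integral_def set_lebesgue_integral_def using nn
    by (intro Bochner_Integration.integral_nonneg) (auto simp: indicator_def)
  moreover have "integral {b..x} (\<lambda>y. exp y * f y) \<ge> 0"
    using nn by (intro integral_nonneg int) auto
  moreover have "integral {a..b} (\<lambda>y. exp y * f y) \<ge> integral {a..b} (\<lambda>y. \<kappa> * exp a)"
  proof (intro integral_le int)
    fix y assume y: "y \<in> {a..b}"
    have "exp a * \<kappa> \<le> exp y * f y"
      using y ge[OF y] assms by (intro mult_mono) auto
    then show "\<kappa> * exp a \<le> exp y * f y" by (simp add: mult.commute)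
  qed auto
  ultimately show ?thesis
    using lower_exp_integral_split[OF c b, of a b] lower_exp_integral_split[OF c b, of b x] assms(4,5)
    by (simp add: mult_ac)
qed

lemma inv_helmholtz_eq:
  assumes c: "continuous_on UNIV f" and b: "\<And>y. \<bar>f y\<bar> \<le> K"
  shows "inv_helmholtz f x = (exp (- x) * lower_exp_integral f x
     + exp x * lower_exp_integral (\<lambda>y. f (- y)) (- x)) / 2"
proof -
  let ?k = "\<lambda>y. exp (- \<bar>x - y\<bar>) / 2 * f y"
  have c': "continuous_on UNIV (\<lambda>y. f (- y))" and b': "\<bar>f (- y)\<bar> \<le> K" for y
    using b continuous_on_compose2[OF c continuous_on_minus[OF continuous_on_id], of UNIV] by auto
  have i1: "set_integrable lborel {..x} (\<lambda>y. exp (- x) / 2 * (exp y * f y))"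
    by (intro set_integrable_mult_right lower_exp_integrable[OF c b])
  have e1: "exp (- x) / 2 * (exp y * f y) = ?k y" if "y \<in> {..x}" for y
  proof -
    have "exp (- \<bar>x - y\<bar>) = exp (- x) * exp y" using that by (simp flip: exp_add)
    then show ?thesis by simp
  qed
  have i1': "set_integrable lborel {..x} ?k"
  proof -
    have "set_integrable lborel {..x} (\<lambda>y. exp (- x) / 2 * (exp y * f y)) = set_integrable lborel {..x} ?k"
      by (rule set_integrable_cong[OF refl refl e1])
    then show ?thesis using i1 by (rule iffD1)
  qed
  have v1: "(LINT y:{..x}|lborel. ?k y) = exp (- x) / 2 * lower_exp_integral f x"
    unfolding lower_exp_integral_def set_integral_mult_right[symmetric]
    by (rule set_lebesgue_integral_cong) (simp, use e1[symmetric] in blast)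
  have "set_integrable lborel {..- x} (\<lambda>y. exp x / 2 * (exp y * f (- y)))"
    by (intro set_integrable_mult_right lower_exp_integrable[OF c' b'])
  then have "integrable lborel (\<lambda>y. indicator {..- x} (0 + (-1) * y) *\<^sub>R (exp x / 2 * (exp (0 + (-1) * y) * f (- (0 + (-1) * y)))))"
    unfolding set_integrable_def by (intro lborel_integrable_real_affine) auto
  also have "(\<lambda>y. indicator {..- x} (0 + (-1) * y) *\<^sub>R (exp x / 2 * (exp (0 + (-1) * y) * f (- (0 + (-1) * y)))))
     = (\<lambda>y. indicator {x..} y *\<^sub>R ?k y)"
    by (auto simp: indicator_def fun_eq_iff mult_exp_exp)
  finally have i2: "set_integrable lborel {x..} ?k" by (simp add: set_integrable_def)
  have i2': "set_integrable lborel {x<..} ?k"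
    using i2 by (rule set_integrable_subset) auto
  have "exp x / 2 * lower_exp_integral (\<lambda>y. f (- y)) (- x)
      = (LINT y|lborel. indicator {..- x} y *\<^sub>R (exp x / 2 * (exp y * f (- y))))"
    unfolding lower_exp_integral_def set_lebesgue_integral_def
    by (subst integral_mult_right_zero[symmetric]) (simp add: mult_ac)
  also have "\<dots> = (LINT y|lborel. indicator {..- x} (0 + (-1) * y) *\<^sub>R (exp x / 2 * (exp (0 + (-1) * y) * f (- (0 + (-1) * y)))))"
    by (subst lborel_integral_real_affine[where c = "-1" and t = 0]) auto
  also have "\<dots> = (LINT y:{x..}|lborel. ?k y)"
    unfolding set_lebesgue_integral_def
    by (intro Bochner_Integration.integral_cong) (auto simp: indicator_def mult_exp_exp)
  also have "\<dots> = (LINT y:{x<..}|lborel. ?k y)"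
    unfolding set_lebesgue_integral_def
    by (rule integral_discrete_difference[where X = "{x}"]) (auto simp: indicator_def)
  finally have v2: "(LINT y:{x<..}|lborel. ?k y) = exp x / 2 * lower_exp_integral (\<lambda>y. f (- y)) (- x)" ..
  have "inv_helmholtz f x = (LINT y:{..x} \<union> {x<..}|lborel. ?k y)"
  proof -
    have "{..x} \<union> {x<..} = UNIV" by auto
    then show ?thesis by (simp add: inv_helmholtz_def set_lebesgue_integral_def)
  qed
  also have "\<dots> = (LINT y:{..x}|lborel. ?k y) + (LINT y:{x<..}|lborel. ?k y)"
    by (rule set_integral_Un[OF _ i1' i2']) auto
  finally show ?thesis unfolding v1 v2 by (simp add: add_divide_distrib)
qed

text \<open>Convolution with the derivative of the kernel: the part y > x enters with a plus sign,
  the part y < x with a minus sign.\<close>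

definition inv_helmholtz' :: "(real \<Rightarrow> real) \<Rightarrow> real \<Rightarrow> real" where
  "inv_helmholtz' f x = (exp x * lower_exp_integral (\<lambda>y. f (- y)) (- x)
     - exp (- x) * lower_exp_integral f x) / 2"

text \<open>Differentiating the half-line integrals produces the boundary terms f(x) and - f(x),
  which cancel in the first derivative and add up to - f(x) in the second. Hence
  \<open>inv_helmholtz'\<close> is differentiable for merely continuous f.\<close>

lemma inv_helmholtz_deriv:
  assumes c: "continuous_on UNIV f" and b: "\<And>y. \<bar>f y\<bar> \<le> K"
  shows "(inv_helmholtz f has_real_derivative inv_helmholtz' f x) (at x)"
    and "(inv_helmholtz' f has_real_derivative inv_helmholtz f x - f x) (at x)"
proof -
  have c': "continuous_on UNIV (\<lambda>y. f (- y))" and b': "\<bar>f (- y)\<bar> \<le> K" for y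
    using b continuous_on_compose2[OF c continuous_on_minus[OF continuous_on_id], of UNIV] by auto
  note d1 = lower_exp_integral_deriv[OF c b, of x]
  have d2: "((\<lambda>x. lower_exp_integral (\<lambda>y. f (- y)) (- x)) has_real_derivative - (exp (- x) * f x)) (at x)"
    using DERIV_chain2[OF lower_exp_integral_deriv[OF c' b'] DERIV_minus[OF DERIV_ident], of x] by simp
  have ee: "exp x * (exp (- x) * t) = t" "exp (- x) * (exp x * t) = t" for t :: real
    by (simp_all add: mult.assoc[symmetric] mult_exp_exp)
  have "inv_helmholtz f = (\<lambda>x. (exp (- x) * lower_exp_integral f x
     + exp x * lower_exp_integral (\<lambda>y. f (- y)) (- x)) / 2)"
    using inv_helmholtz_eq[OF c b] by (rule ext)
  then show "(inv_helmholtz f has_real_derivative inv_helmholtz' f x) (at x)"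
    using ee by (auto intro!: derivative_eq_intros d1 d2 simp: inv_helmholtz'_def field_simps)
  show "(inv_helmholtz' f has_real_derivative inv_helmholtz f x - f x) (at x)"
    unfolding inv_helmholtz'_def[abs_def] inv_helmholtz_eq[OF c b] using ee
    by (auto intro!: derivative_eq_intros d1 d2 simp: field_simps)
qed

text \<open>On the left half the kernel has to decay faster than the weight exp (- \<alpha> x),
  which costs 1 / (1 - \<alpha>); the right half costs 1 / (1 + \<alpha>), enlarged to the same
  constant. The constant is free of \<epsilon>.\<close>

lemma inv_helmholtz_weighted_bound:
  assumes c: "continuous_on UNIV f" and b: "\<And>y. \<bar>f y\<bar> \<le> K"
    and w: "\<And>y. \<bar>f y\<bar> \<le> B * (exp (- \<alpha> * y) + \<epsilon>)" and \<alpha>: "0 < \<alpha>" "\<alpha> < 1" and \<epsilon>: "\<epsilon> > 0"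
  shows "\<bar>inv_helmholtz f x\<bar> \<le> B / (1 - \<alpha>) * (exp (- \<alpha> * x) + \<epsilon>)"
    and "\<bar>inv_helmholtz' f x\<bar> \<le> B / (1 - \<alpha>) * (exp (- \<alpha> * x) + \<epsilon>)"
proof -
  have c': "continuous_on UNIV (\<lambda>y. f (- y))" and b': "\<bar>f (- y)\<bar> \<le> K" for y
    using b continuous_on_compose2[OF c continuous_on_minus[OF continuous_on_id], of UNIV] by auto
  have pos: "exp (- \<alpha> * 0) + \<epsilon> > 0" using \<epsilon> by simp
  have B: "B \<ge> 0"
    using w[of 0] pos by (smt (verit) mult_neg_pos)
  let ?a = "exp (- x) * lower_exp_integral f x" and ?b = "exp x * lower_exp_integral (\<lambda>y. f (- y)) (- x)"
  let ?R = "B / (1 - \<alpha>) * (exp (- \<alpha> * x) + \<epsilon>)"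
  have a: "\<bar>?a\<bar> \<le> ?R"
  proof -
    have "\<bar>lower_exp_integral f x\<bar> \<le> B * (exp ((1 - \<alpha>) * x) / (1 - \<alpha>)) + (B * \<epsilon>) * exp x"
      by (rule lower_exp_integral_bound[OF c b]) (use w \<alpha> in \<open>auto simp: algebra_simps\<close>)
    then have "\<bar>?a\<bar> \<le> exp (- x) * (B * (exp ((1 - \<alpha>) * x) / (1 - \<alpha>)) + (B * \<epsilon>) * exp x)"
      by (simp add: abs_mult)
    also have "\<dots> = B / (1 - \<alpha>) * exp (- \<alpha> * x) + B * \<epsilon>"
    proof -
      have "exp (- x) * exp ((1 - \<alpha>) * x) = exp (- \<alpha> * x)" "exp (- x) * exp x = 1"
        by (simp_all add: mult_exp_exp algebra_simps)
      then show ?thesis by (simp add: distrib_left mult_ac)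
    qed
    also have "\<dots> \<le> B / (1 - \<alpha>) * exp (- \<alpha> * x) + B / (1 - \<alpha>) * \<epsilon>"
      using B \<alpha> \<epsilon> by (intro add_left_mono mult_right_mono) (auto simp: le_divide_eq mult_left_le)
    finally show ?thesis by (simp add: distrib_left)
  qed
  have bb: "\<bar>?b\<bar> \<le> ?R"
  proof -
    have "\<bar>lower_exp_integral (\<lambda>y. f (- y)) (- x)\<bar> \<le> B * (exp ((1 - (- \<alpha>)) * (- x)) / (1 - (- \<alpha>))) + (B * \<epsilon>) * exp (- x)"
      by (rule lower_exp_integral_bound[OF c' b']) (use w[of "- _"] \<alpha> in \<open>auto simp: algebra_simps\<close>)
    then have "\<bar>?b\<bar> \<le> exp x * (B * (exp ((1 - (- \<alpha>)) * (- x)) / (1 - (- \<alpha>))) + (B * \<epsilon>) * exp (- x))"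
      by (simp add: abs_mult)
    also have "\<dots> = B / (1 + \<alpha>) * exp (- \<alpha> * x) + B * \<epsilon>"
    proof -
      have "exp x * exp ((1 - (- \<alpha>)) * (- x)) = exp (- \<alpha> * x)" "exp x * exp (- x) = 1"
        by (simp_all add: mult_exp_exp algebra_simps)
      then show ?thesis by (simp add: distrib_left mult_ac)
    qed
    also have "\<dots> \<le> B / (1 - \<alpha>) * exp (- \<alpha> * x) + B / (1 - \<alpha>) * \<epsilon>"
    proof (intro add_mono mult_right_mono)
      show "B / (1 + \<alpha>) \<le> B / (1 - \<alpha>)" using B \<alpha> by (intro divide_left_mono) auto
    qed (use B \<alpha> \<epsilon> in \<open>auto simp: le_divide_eq mult_left_le\<close>)
    finally show ?thesis by (simp add: distrib_left)
  qed
  have mean: "\<bar>p + q\<bar> / 2 \<le> R" "\<bar>p - q\<bar> / 2 \<le> R" if "\<bar>p\<bar> \<le> R" "\<bar>q\<bar> \<le> R" for p q R :: real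
    using that by auto
  show "\<bar>inv_helmholtz f x\<bar> \<le> ?R"
    unfolding inv_helmholtz_eq[OF c b] abs_divide using mean(1)[OF a bb] by simp
  show "\<bar>inv_helmholtz' f x\<bar> \<le> ?R"
    unfolding inv_helmholtz'_def abs_divide using mean(2)[OF bb a] by simp
qed

section \<open>Persistence of exponential decay\<close>

text \<open>
  Only points where \<open>\<bar>W t\<bar>\<close> is maximal matter in the last hypothesis; there the space derivative
  vanishes, so that a transport term contributes nothing.
\<close>

lemma sup_norm_evolution_bound:
  fixes W :: "real \<Rightarrow> real \<Rightarrow> real" and c c' :: "real \<Rightarrow> real"
  assumes cont: "\<And>t. t \<in> {0..T} \<Longrightarrow> continuous_on UNIV (W t)"
    and vanish: "\<And>t e. t \<in> {0..T} \<Longrightarrow> e > 0 \<Longrightarrow> \<exists>X. \<forall>x. \<bar>x\<bar> \<ge> X \<longrightarrow> \<bar>W t x\<bar> < e"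
    and unif: "\<And>t e. t \<in> {0..T} \<Longrightarrow> e > 0 \<Longrightarrow> \<forall>\<^sub>F \<tau> in at t within {0..T}. \<forall>x. \<bar>W \<tau> x - W t x\<bar> \<le> e"
    and c: "\<And>t. t \<in> {0..T} \<Longrightarrow> (c has_real_derivative c' t) (at t within {0..T})"
    and c0: "\<And>t. t \<in> {0..T} \<Longrightarrow> c t \<ge> 0"
    and init: "\<And>x. \<bar>W 0 x\<bar> \<le> c 0"
    and step: "\<And>t x. t \<in> {0<..T} \<Longrightarrow> W t x \<noteq> 0 \<Longrightarrow> \<forall>y. \<bar>W t y\<bar> \<le> \<bar>W t x\<bar> \<Longrightarrow>
      \<exists>w. ((\<lambda>\<tau>. W \<tau> x) has_real_derivative w) (at t within {0..T}) \<and> sgn (W t x) * w < c' t"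
    and t: "t \<in> {0..T}"
  shows "\<bar>W t x\<bar> \<le> c t"
proof -
  \<comment> \<open>\<open>m\<close> will be continuous but need not be differentiable in t;
    derivatives are therefore taken of W at one fixed maximal point.\<close>
  define m where "m = (\<lambda>t. SUP x. \<bar>W t x\<bar>)"
  have att: "\<exists>x. \<forall>y. \<bar>W t y\<bar> \<le> \<bar>W t x\<bar>" if t: "t \<in> {0..T}" for t
  proof (cases "\<forall>y. W t y = 0")
    case False
    then obtain z where z: "W t z \<noteq> 0" by auto
    obtain X where X: "\<And>x. \<bar>x\<bar> \<ge> X \<Longrightarrow> \<bar>W t x\<bar> < \<bar>W t z\<bar>"
      using vanish[OF t, of "\<bar>W t z\<bar>"] z by auto
    have zX: "\<bar>z\<bar> < X" using X[of z] by linarith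
    have "\<exists>x\<in>{-X..X}. \<forall>y\<in>{-X..X}. \<bar>W t y\<bar> \<le> \<bar>W t x\<bar>"
      using cont[OF t] zX by (intro continuous_attains_sup continuous_intros) (auto intro: continuous_on_subset)
    then obtain x where x: "x \<in> {-X..X}" "\<And>y. y \<in> {-X..X} \<Longrightarrow> \<bar>W t y\<bar> \<le> \<bar>W t x\<bar>" by auto
    have "\<bar>W t y\<bar> \<le> \<bar>W t x\<bar>" for y
    proof (cases "y \<in> {-X..X}")
      case False
      then have "\<bar>W t y\<bar> < \<bar>W t z\<bar>" by (intro X) auto
      also have "\<dots> \<le> \<bar>W t x\<bar>" using zX by (intro x) auto
      finally show ?thesis by simp
    qed (use x in auto)
    then show ?thesis by blast
  qed auto
  have bdd: "bdd_above (range (\<lambda>x. \<bar>W t x\<bar>))" if "t \<in> {0..T}" for t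
    using att[OF that] by (auto intro: bdd_aboveI)
  have le_m: "\<bar>W t x\<bar> \<le> m t" if "t \<in> {0..T}" for t x
    unfolding m_def using bdd[OF that] by (rule cSUP_upper[rotated]) simp
  have m_diff: "m t \<le> m \<tau> + e" if "t \<in> {0..T}" "\<tau> \<in> {0..T}" "\<forall>x. \<bar>W \<tau> x - W t x\<bar> \<le> e" for t \<tau> e
    unfolding m_def
  proof (rule cSUP_least)
    fix x
    have "\<bar>W t x\<bar> \<le> \<bar>W \<tau> x\<bar> + e" using that(3)[rule_format, of x] by linarith
    also have "\<bar>W \<tau> x\<bar> \<le> (SUP x. \<bar>W \<tau> x\<bar>)" using le_m[OF that(2)] by (simp add: m_def)
    finally show "\<bar>W t x\<bar> \<le> (SUP x. \<bar>W \<tau> x\<bar>) + e" by simp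
  qed simp
  have m_cont: "continuous_on {0..T} m"
    unfolding continuous_on_def
  proof (intro ballI tendstoI)
    fix t e :: real assume t: "t \<in> {0..T}" and e: "e > 0"
    have "\<forall>\<^sub>F \<tau> in at t within {0..T}. \<tau> \<in> {0..T}"
      by (auto simp: eventually_at_filter)
    with unif[OF t half_gt_zero[OF e]] have "\<forall>\<^sub>F \<tau> in at t within {0..T}. \<bar>m \<tau> - m t\<bar> \<le> e / 2"
    proof eventually_elim
      case (elim \<tau>)
      have "m t \<le> m \<tau> + e / 2" using t elim by (intro m_diff) auto
      moreover have "m \<tau> \<le> m t + e / 2" using t elim by (intro m_diff) (auto simp: abs_minus_commute)
      ultimately show ?case by linarith
    qed
    then show "\<forall>\<^sub>F \<tau> in at t within {0..T}. dist (m \<tau>) (m t) < e"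
      by eventually_elim (use e in \<open>simp add: dist_real_def\<close>)
  qed
  have c_cont: "continuous_on {0..T} c"
    using c by (rule DERIV_continuous_on)
  \<comment> \<open>At a time s maximising m - c and a point z realising m s, an excess over c would
    make |W| - c at z strictly larger slightly earlier, against the choice of s.\<close>
  have "\<exists>s\<in>{0..T}. \<forall>r\<in>{0..T}. m r - c r \<le> m s - c s"
    using t by (intro continuous_attains_sup continuous_intros m_cont c_cont) auto
  then obtain s where s: "s \<in> {0..T}" "\<And>r. r \<in> {0..T} \<Longrightarrow> m r - c r \<le> m s - c s" by auto
  obtain z where z: "\<And>y. \<bar>W s y\<bar> \<le> \<bar>W s z\<bar>" using att[OF s(1)] by auto
  have ms: "m s = \<bar>W s z\<bar>"
    unfolding m_def by (rule cSup_eq_maximum) (use z in auto)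
  have "m s \<le> c s"
  proof (rule ccontr)
    assume gt: "\<not> m s \<le> c s"
    have s0: "s \<noteq> 0" using gt init[of z] ms by auto
    have Wz: "W s z \<noteq> 0" using gt ms c0[OF s(1)] by auto
    obtain w where w: "((\<lambda>\<tau>. W \<tau> z) has_real_derivative w) (at s within {0..T})" "sgn (W s z) * w < c' s"
      using step[of s z] s(1) s0 Wz z by auto
    define \<sigma> where "\<sigma> = sgn (W s z)"
    have "((\<lambda>\<tau>. \<sigma> * W \<tau> z - c \<tau>) has_real_derivative \<sigma> * w - c' s) (at s within {0..T})"
      using w(1) c[OF s(1)] by (auto intro!: derivative_eq_intros)
    from has_real_derivative_neg_dec_left[OF this] w(2)
    obtain d where d: "d > 0" "\<And>h. h > 0 \<Longrightarrow> s - h \<in> {0..T} \<Longrightarrow> h < d \<Longrightarrow>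
        \<sigma> * W s z - c s < \<sigma> * W (s - h) z - c (s - h)"
      by (auto simp: \<sigma>_def)
    \<comment> \<open>Smaller than \<open>d\<close>, and at most \<open>s\<close> so that s - h
      stays in the time interval.\<close>
    define h where "h = min (d / 2) s"
    have h: "h > 0" "h < d" "s - h \<in> {0..T}" using d(1) s(1) s0 by (auto simp: h_def min_def)
    have "m s - c s = \<sigma> * W s z - c s" by (simp add: ms \<sigma>_def abs_sgn mult.commute)
    also have "\<dots> < \<sigma> * W (s - h) z - c (s - h)" using d h by auto
    also have "\<dots> \<le> \<bar>W (s - h) z\<bar> - c (s - h)"
    proof -
      have "\<sigma> * W (s - h) z \<le> \<bar>\<sigma> * W (s - h) z\<bar>" by (rule abs_ge_self)
      also have "\<dots> \<le> \<bar>W (s - h) z\<bar>" using Wz by (simp add: abs_mult \<sigma>_def abs_sgn_eq)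
      finally show ?thesis by simp
    qed
    also have "\<dots> \<le> m (s - h) - c (s - h)" using le_m[OF h(3)] by simp
    also have "\<dots> \<le> m s - c s" using s(2)[OF h(3)] .
    finally show False by simp
  qed
  then show ?thesis using s(2)[OF t] le_m[OF t, of x] by linarith
qed

section \<open>Elementary inequalities for increments, powers and the source\<close>

lemma increment_ge:
  fixes f f' :: "real \<Rightarrow> real"
  assumes "a \<le> b" and d: "\<And>t. t \<in> {a..b} \<Longrightarrow> (f has_real_derivative f' t) (at t within {a..b})"
    and ge: "\<And>t. t \<in> {a..b} \<Longrightarrow> f' t \<ge> k"
  shows "f b - f a \<ge> k * (b - a)"
proof (cases "a = b")
  case False
  then have "a < b" using assms(1) by simp
  then obtain t where t: "t \<in> {a<..<b}" "f b - f a = f' t * (b - a)"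
    using mvt_simple[of a b f "\<lambda>t. (*) (f' t)"] d by (auto simp: has_field_derivative_def)
  then show ?thesis using ge[of t] \<open>a < b\<close> by (auto intro: mult_right_mono)
qed simp

lemma abs_power_diff_le:
  fixes p q M :: real
  assumes "\<bar>p\<bar> \<le> M" "\<bar>q\<bar> \<le> M"
  shows "\<bar>p ^ n - q ^ n\<bar> \<le> real n * M ^ (n - 1) * \<bar>p - q\<bar>"
proof -
  have M: "M \<ge> 0" using assms by linarith
  have "\<bar>\<Sum>i<n. q ^ (n - Suc i) * p ^ i\<bar> \<le> (\<Sum>i<n. \<bar>q ^ (n - Suc i) * p ^ i\<bar>)" by (rule sum_abs)
  also have "\<dots> \<le> (\<Sum>i<n. M ^ (n - 1))"
  proof (rule sum_mono)
    fix i assume i: "i \<in> {..<n}"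
    have "\<bar>q ^ (n - Suc i) * p ^ i\<bar> \<le> M ^ (n - Suc i) * M ^ i"
      unfolding abs_mult power_abs using assms M by (intro mult_mono power_mono) auto
    also have "\<dots> = M ^ (n - 1)" using i by (simp flip: power_add)
    finally show "\<bar>q ^ (n - Suc i) * p ^ i\<bar> \<le> M ^ (n - 1)" .
  qed
  finally have *: "\<bar>\<Sum>i<n. q ^ (n - Suc i) * p ^ i\<bar> \<le> real n * M ^ (n - 1)" by simp
  have "\<bar>p ^ n - q ^ n\<bar> = \<bar>p - q\<bar> * \<bar>\<Sum>i<n. q ^ (n - Suc i) * p ^ i\<bar>"
    by (simp add: power_diff_sumr2 abs_mult)
  also have "\<dots> \<le> \<bar>p - q\<bar> * (real n * M ^ (n - 1))"
    using * by (intro mult_left_mono) auto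
  finally show ?thesis by (simp add: mult_ac)
qed

definition gCH_source :: "nat \<Rightarrow> real \<Rightarrow> real \<Rightarrow> real" where
  "gCH_source n p q = real n / 2 * p ^ (n - 1) * q\<^sup>2 + real n * (real n + 3) / (2 * (real n + 1)) * p ^ (n + 1)"

text \<open>The degree n + 1 is split: n factors take \<open>M\<close> and one takes
  \<open>E\<close>, so the bound is linear in \<open>E\<close>. The coefficients n/2 and n (n + 3) /
  (2 (n + 1)) \<le> n add up to at most 2 n. Choosing for M and E the same decaying bound recovers
  the full power n + 1.\<close>

lemma abs_gCH_source_le:
  assumes n: "n \<ge> 1" and p: "\<bar>p\<bar> \<le> M" and q: "\<bar>q\<bar> \<le> M" and pE: "\<bar>p\<bar> \<le> E" and qE: "\<bar>q\<bar> \<le> E"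
  shows "\<bar>gCH_source n p q\<bar> \<le> 2 * real n * M ^ n * E"
proof -
  have M: "M \<ge> 0" and E: "E \<ge> 0" using p pE by linarith+
  have "\<bar>p\<bar> ^ (n - 1) * \<bar>q\<bar> \<le> M ^ (n - 1) * M"
    using p q M by (intro mult_mono power_mono) auto
  also have "\<dots> = M ^ n" using n by (simp flip: power_Suc2)
  finally have "(\<bar>p\<bar> ^ (n - 1) * \<bar>q\<bar>) * \<bar>q\<bar> \<le> M ^ n * E"
    using qE M by (intro mult_mono) auto
  then have 1: "\<bar>p ^ (n - 1) * q\<^sup>2\<bar> \<le> M ^ n * E"
    by (simp add: abs_mult power_abs power2_eq_square mult.assoc)
  have "\<bar>p\<bar> ^ n * \<bar>p\<bar> \<le> M ^ n * E"
    using p pE M by (intro mult_mono power_mono) auto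
  then have 2: "\<bar>p ^ (n + 1)\<bar> \<le> M ^ n * E"
    by (simp add: abs_mult power_abs mult.commute)
  have k: "real n * (real n + 3) / (2 * (real n + 1)) \<le> real n"
    using n by (simp add: divide_le_eq)
  have "\<bar>gCH_source n p q\<bar> \<le> \<bar>real n / 2 * (p ^ (n - 1) * q\<^sup>2)\<bar> + \<bar>real n * (real n + 3) / (2 * (real n + 1)) * p ^ (n + 1)\<bar>"
    unfolding gCH_source_def mult.assoc by (rule abs_triangle_ineq)
  also have "\<dots> = real n / 2 * \<bar>p ^ (n - 1) * q\<^sup>2\<bar> + real n * (real n + 3) / (2 * (real n + 1)) * \<bar>p ^ (n + 1)\<bar>"
    by (subst (1 2) abs_mult) (simp add: abs_of_nonneg)
  also have "\<dots> \<le> real n / 2 * (M ^ n * E) + real n * (M ^ n * E)"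
    using 1 2 k M E by (intro add_mono mult_mono) auto
  also have "\<dots> \<le> 2 * real n * M ^ n * E"
    using M E by (simp add: field_simps)
  finally show ?thesis .
qed

text \<open>For odd n both n - 1 and n + 1 are even, so the term with q is nonnegative and can be
  discarded.\<close>

lemma gCH_source_ge:
  assumes "odd n"
  shows "gCH_source n p q \<ge> real n * (real n + 3) / (2 * (real n + 1)) * \<bar>p\<bar> ^ (n + 1)"
proof -
  have "p ^ (n - 1) \<ge> 0" using assms by (intro zero_le_even_power) auto
  moreover have "\<bar>p\<bar> ^ (n + 1) = p ^ (n + 1)" using assms by (intro power_even_abs) auto
  ultimately show ?thesis unfolding gCH_source_def by simp
qed

text \<open>What the estimates use of a solution: pointwise statements with one space derivative.
  \<open>M\<close> is at least 1 to keep its powers away from 0. The nonlocal term in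
  \<open>u_t\<close> is the explicit \<open>inv_helmholtz'\<close>, which can be differentiated once
  more.\<close>

locale gCH_classical =
  fixes n :: nat and T M :: real and u u\<^sub>x :: "real \<Rightarrow> real \<Rightarrow> real"
  assumes n: "n \<ge> 1" and T: "T > 0" and M: "M \<ge> 1"
    and u_x: "t \<in> {0..T} \<Longrightarrow> (u t has_real_derivative u\<^sub>x t x) (at x)"
    and u_x_cont: "t \<in> {0..T} \<Longrightarrow> continuous_on UNIV (u\<^sub>x t)"
    and u_le: "t \<in> {0..T} \<Longrightarrow> \<bar>u t x\<bar> \<le> M"
    and u_x_le: "t \<in> {0..T} \<Longrightarrow> \<bar>u\<^sub>x t x\<bar> \<le> M"
    and vanish: "t \<in> {0..T} \<Longrightarrow> e > 0 \<Longrightarrow> \<exists>X. \<forall>x. \<bar>x\<bar> \<ge> X \<longrightarrow> \<bar>u t x\<bar> < e"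
    and unif: "t \<in> {0..T} \<Longrightarrow> e > 0 \<Longrightarrow> \<forall>\<^sub>F \<tau> in at t within {0..T}. \<forall>x. \<bar>u \<tau> x - u t x\<bar> \<le> e"
    and u_t: "t \<in> {0..T} \<Longrightarrow> ((\<lambda>\<tau>. u \<tau> x) has_real_derivative
      - (u t x ^ n * u\<^sub>x t x) - inv_helmholtz' (\<lambda>y. gCH_source n (u t y) (u\<^sub>x t y)) x) (at t within {0..T})"
begin

abbreviation src :: "real \<Rightarrow> real \<Rightarrow> real" where
  "src t y \<equiv> gCH_source n (u t y) (u\<^sub>x t y)"

lemma u_cont: "t \<in> {0..T} \<Longrightarrow> continuous_on UNIV (u t)"
  using u_x by (auto intro!: continuous_at_imp_continuous_on DERIV_isCont)

lemma src_cont: "t \<in> {0..T} \<Longrightarrow> continuous_on UNIV (src t)"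
  unfolding gCH_source_def by (intro continuous_intros u_cont u_x_cont)

lemma src_le: "t \<in> {0..T} \<Longrightarrow> \<bar>src t y\<bar> \<le> 2 * real n * M ^ n * M"
  by (intro abs_gCH_source_le n u_le u_x_le)

lemma difference_quotient_mean:
  assumes t: "t \<in> {0..T}" and h: "h > 0"
  obtains z where "x \<le> z" "(u t (x + h) - u t x) / h = u\<^sub>x t z"
proof -
  obtain z where "x < z" "u t (x + h) - u t x = (x + h - x) * u\<^sub>x t z"
    using MVT2[of x "x + h" "u t" "u\<^sub>x t"] u_x[OF t] h by auto
  then show thesis using h by (intro that[of z]) auto
qed

section \<open>Estimates for a fixed decay rate \<alpha> and regularisation \<epsilon>\<close>

context
  fixes \<alpha> \<epsilon> :: real
  assumes \<alpha>: "0 < \<alpha>" "\<alpha> < 1" and \<epsilon>: "\<epsilon> > 0"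
begin

text \<open>
  All estimates are uniform in \<open>\<epsilon>\<close>; as \<open>\<epsilon> \<rightarrow> 0\<close> the weight increases to \<open>exp (\<alpha>x)\<close>.
\<close>

definition \<phi> :: "real \<Rightarrow> real" where "\<phi> x = 1 / (exp (- \<alpha> * x) + \<epsilon>)"

definition \<phi>' :: "real \<Rightarrow> real" where "\<phi>' x = \<alpha> * exp (- \<alpha> * x) / (exp (- \<alpha> * x) + \<epsilon>)\<^sup>2"

lemma den_pos: "exp (- \<alpha> * x) + \<epsilon> > 0"
  using \<epsilon> by (simp add: add_pos_pos)

lemma \<phi>_pos: "\<phi> x > 0"
  using den_pos by (simp add: \<phi>_def)

lemma \<phi>_le: "\<phi> x \<le> 1 / \<epsilon>"
  unfolding \<phi>_def using \<epsilon> by (intro divide_left_mono) (auto intro!: mult_pos_pos add_pos_pos)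

lemma \<phi>_mono: "x \<le> y \<Longrightarrow> \<phi> x \<le> \<phi> y"
  unfolding \<phi>_def using \<epsilon> \<alpha> by (intro divide_left_mono) (auto intro!: mult_pos_pos add_pos_pos)

lemma \<phi>_deriv: "(\<phi> has_real_derivative \<phi>' x) (at x)"
  unfolding \<phi>_def[abs_def] \<phi>'_def using den_pos[of x]
  by (auto intro!: derivative_eq_intros simp: power2_eq_square)

lemma \<phi>_cont: "continuous_on UNIV \<phi>"
  using \<phi>_deriv by (auto intro!: continuous_at_imp_continuous_on DERIV_isCont)

text \<open>The logarithmic derivative of \<open>\<phi>\<close> is at most \<alpha> < 1, uniformly
  in \<epsilon>; this pays for the transport term at a maximum.\<close>

lemma \<phi>'_bounds: "0 \<le> \<phi>' x" "\<phi>' x \<le> \<phi> x"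
proof -
  show "0 \<le> \<phi>' x" using \<alpha> by (simp add: \<phi>'_def)
  have "\<alpha> * exp (- \<alpha> * x) \<le> exp (- \<alpha> * x) + \<epsilon>"
  proof -
    have "\<alpha> * exp (- \<alpha> * x) \<le> 1 * exp (- \<alpha> * x)" using \<alpha> by (intro mult_right_mono) auto
    then show ?thesis using \<epsilon> by linarith
  qed
  then have "\<phi>' x \<le> (exp (- \<alpha> * x) + \<epsilon>) / (exp (- \<alpha> * x) + \<epsilon>)\<^sup>2"
    unfolding \<phi>'_def by (intro divide_right_mono) auto
  also have "\<dots> = \<phi> x" using den_pos[of x] by (simp add: \<phi>_def power2_eq_square)
  finally show "\<phi>' x \<le> \<phi> x" .
qed

lemma weighted_le_iff: "\<phi> x * a \<le> b \<longleftrightarrow> a \<le> b * (exp (- \<alpha> * x) + \<epsilon>)"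
  using den_pos[of x] by (simp add: \<phi>_def pos_divide_le_eq)

text \<open>The constant 2 n M^n of the source times the factor 1 / (1 - \<alpha>) of the
  convolution. It also dominates the coefficients arising from advection, and it does not involve
  \<epsilon>.\<close>

definition K0 :: real where "K0 = 2 * real n * M ^ n / (1 - \<alpha>)"

lemma K0_ge: "M ^ n \<le> K0" "real n * M ^ n \<le> K0" "2 * real n * M ^ n \<le> K0"
proof -
  have Mn: "M ^ n \<ge> 1" using M by simp
  have "2 * real n * M ^ n \<le> 2 * real n * M ^ n / (1 - \<alpha>)"
    using \<alpha> Mn n by (simp add: le_divide_eq mult_left_le)
  then show 1: "2 * real n * M ^ n \<le> K0" by (simp add: K0_def)
  have "1 * M ^ n \<le> real n * M ^ n" using n Mn by (intro mult_right_mono) auto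
  moreover have "real n * M ^ n \<le> 2 * real n * M ^ n" using Mn by simp
  ultimately show "M ^ n \<le> K0" "real n * M ^ n \<le> K0" using 1 by auto
qed

lemma K0_pos: "K0 > 0"
  using K0_ge(1) M by (smt (verit) one_le_power)

lemma source_weighted:
  assumes t: "t \<in> {0..T}" and u: "\<And>x. \<phi> x * \<bar>u t x\<bar> \<le> E" and ux: "\<And>x. \<phi> x * \<bar>u\<^sub>x t x\<bar> \<le> E"
  shows "\<phi> x * \<bar>src t x\<bar> \<le> K0 * E"
    and "\<phi> x * \<bar>inv_helmholtz (src t) x\<bar> \<le> K0 * E"
    and "\<phi> x * \<bar>inv_helmholtz' (src t) x\<bar> \<le> K0 * E"
proof -
  have E: "E \<ge> 0" using u[of 0] \<phi>_pos[of 0] by (smt (verit) zero_le_mult_iff abs_ge_zero)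
  have b: "\<bar>src t y\<bar> \<le> (2 * real n * M ^ n * E) * (exp (- \<alpha> * y) + \<epsilon>)" for y
    using abs_gCH_source_le[OF n u_le[OF t] u_x_le[OF t], of y "E * (exp (- \<alpha> * y) + \<epsilon>)" y] u[of y] ux[of y]
    unfolding weighted_le_iff by (simp add: mult.assoc)
  have "\<phi> x * \<bar>src t x\<bar> \<le> 2 * real n * M ^ n * E" using b weighted_le_iff by blast
  also have "\<dots> \<le> K0 * E" by (intro mult_right_mono K0_ge E)
  finally show "\<phi> x * \<bar>src t x\<bar> \<le> K0 * E" .
  have K0E: "2 * real n * M ^ n * E / (1 - \<alpha>) = K0 * E" by (simp add: K0_def)
  note I = inv_helmholtz_weighted_bound[OF src_cont[OF t] src_le[OF t] b \<alpha> \<epsilon>]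
  show "\<phi> x * \<bar>inv_helmholtz (src t) x\<bar> \<le> K0 * E"
    unfolding weighted_le_iff using I(1) K0E by simp
  show "\<phi> x * \<bar>inv_helmholtz' (src t) x\<bar> \<le> K0 * E"
    unfolding weighted_le_iff using I(2) K0E by simp
qed

text \<open>Four terms of size \<open>K0 * E\<close> occur in the evolution of the difference
  quotient, five give a strict inequality, and the factor \<Lambda> / 2 in the comparison function
  doubles this to ten.\<close>

definition rate :: real where "rate = 10 * K0"

text \<open>
  Halving an a priori bound at the cost of the initial data; applied to the optimal \<open>\<Lambda>\<close>
  this replaces Gronwall's inequality.
\<close>

lemma persistence_step:
  assumes \<Lambda>: "\<Lambda> \<ge> 0" and B0: "B\<^sub>0 \<ge> 0"
    and init: "\<And>x. \<phi> x * \<bar>u 0 x\<bar> \<le> B\<^sub>0" "\<And>x. \<phi> x * \<bar>u\<^sub>x 0 x\<bar> \<le> B\<^sub>0"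
    and apriori: "\<And>t x. t \<in> {0..T} \<Longrightarrow> \<phi> x * \<bar>u t x\<bar> \<le> \<Lambda> * exp (rate * t)"
      "\<And>t x. t \<in> {0..T} \<Longrightarrow> \<phi> x * \<bar>u\<^sub>x t x\<bar> \<le> \<Lambda> * exp (rate * t)"
    and t: "t \<in> {0..T}"
  shows "\<phi> x * \<bar>u t x\<bar> \<le> B\<^sub>0 + \<Lambda> / 2 * exp (rate * t)"
    and "\<phi> x * \<bar>u\<^sub>x t x\<bar> \<le> B\<^sub>0 + \<Lambda> / 2 * exp (rate * t)"
proof -
  define E where "E = (\<lambda>t. \<Lambda> * exp (rate * t))"
  define c where "c = (\<lambda>t. B\<^sub>0 + \<Lambda> / 2 * exp (rate * t))"
  define c' where "c' = (\<lambda>t. 5 * K0 * E t)"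
  have cd: "(c has_real_derivative c' t) (at t within {0..T})" for t
    unfolding c_def c'_def E_def by (auto intro!: derivative_eq_intros simp: rate_def)
  have cnn: "c t \<ge> 0" for t using \<Lambda> B0 by (simp add: c_def)
  have c00: "B\<^sub>0 \<le> c 0" using \<Lambda> by (simp add: c_def)
  have ap: "\<phi> x * \<bar>u t x\<bar> \<le> E t" "\<phi> x * \<bar>u\<^sub>x t x\<bar> \<le> E t" if "t \<in> {0..T}" for t x
    using apriori[OF that] by (simp_all add: E_def)
  note sw = source_weighted[OF _ ap]
  have un: "\<bar>u t x ^ n\<bar> \<le> M ^ n" if "t \<in> {0..T}" for t x
    unfolding power_abs using u_le[OF that] by (intro power_mono) auto
  have phi_abs: "\<bar>\<phi> x * a\<bar> = \<phi> x * \<bar>a\<bar>" for x a using \<phi>_pos[of x] by (simp add: abs_mult)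
  have Mn: "M ^ n \<ge> 0" using M by simp
  have adv: "\<phi> x * \<bar>u t y ^ n * a\<bar> \<le> K0 * E t" if t: "t \<in> {0..T}" and a: "\<phi> x * \<bar>a\<bar> \<le> E t" for t x y a
  proof -
    have "\<phi> x * \<bar>u t y ^ n * a\<bar> = \<bar>u t y ^ n\<bar> * (\<phi> x * \<bar>a\<bar>)" by (simp add: abs_mult)
    also have "\<dots> \<le> M ^ n * E t"
      using un[OF t] a Mn \<phi>_pos[of x] by (intro mult_mono) auto
    also have "\<dots> \<le> K0 * E t" using \<Lambda> by (intro mult_right_mono K0_ge) (simp add: E_def)
    finally show ?thesis .
  qed
  \<comment> \<open>The comparison with \<open>c'\<close> is strict, so positivity of
    \<open>E t\<close> has to be drawn from a nonzero value of u.\<close>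
  have E_pos: "E t > 0" if "t \<in> {0..T}" "u t x \<noteq> 0" for t x
    using ap(1)[OF that(1), of x] that(2) \<phi>_pos[of x] by (smt (verit) mult_pos_pos zero_less_abs_iff)
  have sgn_mult_le: "sgn a * w \<le> \<bar>w\<bar>" for a w :: real
    by (auto simp: sgn_if)
  have u_bd: "\<bar>\<phi> x * u t x\<bar> \<le> c t" if t: "t \<in> {0..T}" for t x
  proof (rule sup_norm_evolution_bound[where T = T and W = "\<lambda>t x. \<phi> x * u t x" and c = c and c' = c'])
    fix t assume t: "t \<in> {0..T}"
    show "continuous_on UNIV (\<lambda>x. \<phi> x * u t x)"
      by (intro continuous_intros \<phi>_cont u_cont t)
    show "\<exists>X. \<forall>x. \<bar>x\<bar> \<ge> X \<longrightarrow> \<bar>\<phi> x * u t x\<bar> < e" if e: "e > 0" for e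
    proof -
      obtain X where X: "\<And>x. \<bar>x\<bar> \<ge> X \<Longrightarrow> \<bar>u t x\<bar> < e * \<epsilon>"
        using vanish[OF t, of "e * \<epsilon>"] e \<epsilon> by auto
      have "\<bar>\<phi> x * u t x\<bar> < e" if "\<bar>x\<bar> \<ge> X" for x
      proof -
        have "\<bar>\<phi> x * u t x\<bar> \<le> 1 / \<epsilon> * \<bar>u t x\<bar>"
          unfolding phi_abs by (intro mult_right_mono \<phi>_le) auto
        also have "\<dots> < e" using X[OF that] \<epsilon> by (simp add: divide_less_eq)
        finally show ?thesis .
      qed
      then show ?thesis by blast
    qed
    show "\<forall>\<^sub>F \<tau> in at t within {0..T}. \<forall>x. \<bar>\<phi> x * u \<tau> x - \<phi> x * u t x\<bar> \<le> e" if e: "e > 0" for e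
      using unif[OF t mult_pos_pos[OF e \<epsilon>]]
    proof eventually_elim
      case (elim \<tau>)
      have "\<bar>\<phi> x * u \<tau> x - \<phi> x * u t x\<bar> \<le> e" for x
      proof -
        have "\<bar>\<phi> x * u \<tau> x - \<phi> x * u t x\<bar> = \<phi> x * \<bar>u \<tau> x - u t x\<bar>"
          by (simp add: phi_abs flip: right_diff_distrib)
        also have "\<dots> \<le> 1 / \<epsilon> * (e * \<epsilon>)"
          using elim \<epsilon> by (intro mult_mono \<phi>_le) auto
        finally show ?thesis using \<epsilon> by simp
      qed
      then show ?case by blast
    qed
  next
    show "\<bar>\<phi> x * u 0 x\<bar> \<le> c 0" for x
      unfolding phi_abs using init(1)[of x] c00 by linarith
  next
    fix t x assume t': "t \<in> {0<..T}" and nz: "\<phi> x * u t x \<noteq> 0"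
    from t' have t: "t \<in> {0..T}" by auto
    let ?w = "\<phi> x * (- (u t x ^ n * u\<^sub>x t x) - inv_helmholtz' (src t) x)"
    \<comment> \<open>For u itself the a priori bound on \<open>u\<^sub>x\<close> controls the
      transport term directly.\<close>
    have "\<bar>?w\<bar> \<le> \<phi> x * \<bar>u t x ^ n * u\<^sub>x t x\<bar> + \<phi> x * \<bar>inv_helmholtz' (src t) x\<bar>"
      unfolding phi_abs distrib_left[symmetric] using \<phi>_pos[of x] by (intro mult_left_mono) auto
    also have "\<dots> \<le> K0 * E t + K0 * E t"
      by (intro add_mono adv sw t ap)
    also have "\<dots> < c' t" using K0_pos E_pos[OF t, of x] nz by (simp add: c'_def)
    finally have "sgn (\<phi> x * u t x) * ?w < c' t" using sgn_mult_le[of "\<phi> x * u t x" ?w] by linarith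
    moreover have "((\<lambda>\<tau>. \<phi> x * u \<tau> x) has_real_derivative ?w) (at t within {0..T})"
      using u_t[OF t] by (auto intro!: derivative_eq_intros)
    ultimately show "\<exists>w. ((\<lambda>\<tau>. \<phi> x * u \<tau> x) has_real_derivative w) (at t within {0..T}) \<and> sgn (\<phi> x * u t x) * w < c' t"
      by blast
  qed (use cd cnn t in auto)
  show "\<phi> x * \<bar>u t x\<bar> \<le> B\<^sub>0 + \<Lambda> / 2 * exp (rate * t)"
    using u_bd[OF t, of x] unfolding phi_abs c_def .
  \<comment> \<open>The quotients are forward (\<open>h > 0\<close>) because \<open>\<phi>\<close> is increasing: a mean value \<open>u\<^sub>x t z\<close> with
    \<open>z \<ge> x\<close> obeys the weighted bound at \<open>x\<close> as well.\<close>
  define D where "D = (\<lambda>h t x. (u t (x + h) - u t x) / h)"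
  have D_bd: "\<phi> x * \<bar>D h t x\<bar> \<le> E t" if h: "h > 0" and t: "t \<in> {0..T}" for h t x
  proof -
    obtain z where z: "x \<le> z" "D h t x = u\<^sub>x t z"
      unfolding D_def by (rule difference_quotient_mean[OF t h])
    have "\<phi> x * \<bar>D h t x\<bar> \<le> \<phi> z * \<bar>u\<^sub>x t z\<bar>"
      unfolding z(2) by (intro mult_right_mono \<phi>_mono z) auto
    then show ?thesis using ap(2)[OF t, of z] by linarith
  qed
  have ux_bd: "\<bar>\<phi> x * D h t x\<bar> \<le> c t" if h: "h > 0" and t: "t \<in> {0..T}" for h t x
  proof (rule sup_norm_evolution_bound[where T = T and W = "\<lambda>t x. \<phi> x * D h t x" and c = c and c' = c'])
    fix t assume t: "t \<in> {0..T}"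
    have "continuous_on UNIV (\<lambda>x. u t (x + h))"
      by (rule continuous_on_compose2[OF u_cont[OF t]]) (intro continuous_intros | simp)+
    then show "continuous_on UNIV (\<lambda>x. \<phi> x * D h t x)"
      unfolding D_def using h by (intro continuous_intros \<phi>_cont u_cont t) auto
    show "\<exists>X. \<forall>x. \<bar>x\<bar> \<ge> X \<longrightarrow> \<bar>\<phi> x * D h t x\<bar> < e" if e: "e > 0" for e
    proof -
      obtain X where X: "\<And>x. \<bar>x\<bar> \<ge> X \<Longrightarrow> \<bar>u t x\<bar> < e * \<epsilon> * h / 2"
        using vanish[OF t, of "e * \<epsilon> * h / 2"] e \<epsilon> h by auto
      \<comment> \<open>The radius is X + h because the shifted point x + h must also have absolute
        value at least X.\<close>
      have "\<bar>\<phi> x * D h t x\<bar> < e" if "\<bar>x\<bar> \<ge> X + h" for x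
      proof -
        have "\<bar>u t (x + h)\<bar> < e * \<epsilon> * h / 2" "\<bar>u t x\<bar> < e * \<epsilon> * h / 2"
          by (rule X, use that h in linarith)+
        then have "\<bar>u t (x + h) - u t x\<bar> < e * \<epsilon> * h" by linarith
        then have "\<bar>D h t x\<bar> < e * \<epsilon>" using h by (simp add: D_def abs_divide divide_less_eq)
        then have "1 / \<epsilon> * \<bar>D h t x\<bar> < e" using \<epsilon> by (simp add: divide_less_eq)
        moreover have "\<bar>\<phi> x * D h t x\<bar> \<le> 1 / \<epsilon> * \<bar>D h t x\<bar>"
          unfolding phi_abs by (intro mult_right_mono \<phi>_le) auto
        ultimately show ?thesis by linarith
      qed
      then show ?thesis by blast
    qed
    show "\<forall>\<^sub>F \<tau> in at t within {0..T}. \<forall>x. \<bar>\<phi> x * D h \<tau> x - \<phi> x * D h t x\<bar> \<le> e" if e: "e > 0" for e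
    proof -
      have "e * \<epsilon> * h / 2 > 0" using e \<epsilon> h by simp
      from unif[OF t this] show ?thesis
      proof eventually_elim
        case (elim \<tau>)
        have "\<bar>\<phi> x * D h \<tau> x - \<phi> x * D h t x\<bar> \<le> e" for x
        proof -
          have "D h \<tau> x - D h t x = ((u \<tau> (x + h) - u t (x + h)) - (u \<tau> x - u t x)) / h"
            by (simp add: D_def diff_divide_distrib)
          moreover have "\<bar>(u \<tau> (x + h) - u t (x + h)) - (u \<tau> x - u t x)\<bar> \<le> e * \<epsilon> * h"
            using elim[rule_format, of "x + h"] elim[rule_format, of x] by linarith
          ultimately have "\<bar>D h \<tau> x - D h t x\<bar> \<le> e * \<epsilon>"
            using h by (simp add: abs_divide divide_le_eq)
          then have "\<phi> x * \<bar>D h \<tau> x - D h t x\<bar> \<le> 1 / \<epsilon> * (e * \<epsilon>)"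
            using \<epsilon> by (intro mult_mono \<phi>_le) auto
          then show ?thesis using \<epsilon> by (simp add: phi_abs flip: right_diff_distrib)
        qed
        then show ?case by blast
      qed
    qed
  next
    show "\<bar>\<phi> x * D h 0 x\<bar> \<le> c 0" for x
    proof -
      have t0: "0 \<in> {0..T}" using T by simp
      obtain z where z: "x \<le> z" "D h 0 x = u\<^sub>x 0 z"
        unfolding D_def by (rule difference_quotient_mean[OF t0 h])
      have "\<phi> x * \<bar>D h 0 x\<bar> \<le> \<phi> z * \<bar>u\<^sub>x 0 z\<bar>"
        unfolding z(2) by (intro mult_right_mono \<phi>_mono z) auto
      then show ?thesis unfolding phi_abs using init(2)[of z] c00 by linarith
    qed
  next
    fix t x assume t': "t \<in> {0<..T}" and nz: "\<phi> x * D h t x \<noteq> 0"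
      and max: "\<forall>y. \<bar>\<phi> y * D h t y\<bar> \<le> \<bar>\<phi> x * D h t x\<bar>"
    from t' have t: "t \<in> {0..T}" by auto
    let ?P = "inv_helmholtz' (src t)"
    let ?q = "u t (x + h)" and ?p = "u t x" and ?a = "u\<^sub>x t (x + h)" and ?b = "u\<^sub>x t x"
    let ?\<omega> = "D h t x"
    let ?w = "\<phi> x * (((- (?q ^ n * ?a) - ?P (x + h)) - (- (?p ^ n * ?b) - ?P x)) / h)"
    have Epos: "E t > 0"
    proof (rule E_pos[OF t])
      \<comment> \<open>A nonzero quotient forces u to be nonzero at one of its two end
        points.\<close>
      show "u t (if u t x = 0 then x + h else x) \<noteq> 0" using nz by (auto simp: D_def)
    qed
    \<comment> \<open>The sign factor turns a maximum of the absolute value into one of a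
      differentiable function. The outcome expresses the difference of the \<open>u\<^sub>x\<close>
      values, the substitute for u_xx, through \<open>\<phi>'\<close>.\<close>
    have crit: "\<phi>' x * ?\<omega> + \<phi> x * ((?a - ?b) / h) = 0"
    proof -
      let ?s = "sgn (\<phi> x * ?\<omega>)"
      have sh: "((\<lambda>y. u t (y + h)) has_real_derivative ?a) (at x)"
        using u_x[OF t, of "x + h"] unfolding DERIV_shift .
      have "((\<lambda>y. \<phi> y * D h t y) has_real_derivative \<phi>' x * ?\<omega> + \<phi> x * ((?a - ?b) / h)) (at x)"
        unfolding D_def
        using DERIV_mult[OF \<phi>_deriv DERIV_cdivide[OF DERIV_diff[OF sh u_x[OF t]], of h]]
        by (simp add: add.commute mult.commute)
      then have "((\<lambda>y. ?s * (\<phi> y * D h t y)) has_real_derivative ?s * (\<phi>' x * ?\<omega> + \<phi> x * ((?a - ?b) / h))) (at x)"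
        by (rule DERIV_cmult)
      moreover have "?s * (\<phi> y * D h t y) \<le> ?s * (\<phi> x * D h t x)" for y
      proof -
        have "?s * (\<phi> y * D h t y) \<le> \<bar>\<phi> y * D h t y\<bar>" by (rule sgn_mult_le)
        also have "\<dots> \<le> \<bar>\<phi> x * D h t x\<bar>" using max by blast
        also have "\<dots> = ?s * (\<phi> x * D h t x)" by (simp add: abs_sgn mult.commute)
        finally show ?thesis .
      qed
      ultimately have "?s * (\<phi>' x * ?\<omega> + \<phi> x * ((?a - ?b) / h)) = 0"
        by (intro DERIV_local_max[where d = 1]) auto
      then show ?thesis using nz by (simp add: sgn_zero_iff)
    qed
    \<comment> \<open>The derivative of \<open>?P\<close> is g * F - F, so its increment is bounded
      without differentiating the source; z > x again fits the increasing weight.\<close>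
    obtain z where z: "x < z" "?P (x + h) - ?P x = (x + h - x) * (inv_helmholtz (src t) z - src t z)"
      using MVT2[of x "x + h" ?P "\<lambda>x. inv_helmholtz (src t) x - src t x"]
        inv_helmholtz_deriv(2)[OF src_cont[OF t] src_le[OF t]] h by auto
    then have Pq: "(?P (x + h) - ?P x) / h = inv_helmholtz (src t) z - src t z" using h by simp
    \<comment> \<open>Discrete product rule for (q^n a - p^n b) / h with q^n in front of the
      difference a - b, which \<open>crit\<close> then removes.\<close>
    have split: "?w = ?q ^ n * (\<phi>' x * ?\<omega>) - \<phi> x * (?b * ((?q ^ n - ?p ^ n) / h)) - \<phi> x * ((?P (x + h) - ?P x) / h)"
    proof -
      have "?w = - (?q ^ n * (\<phi> x * ((?a - ?b) / h))) - \<phi> x * (?b * ((?q ^ n - ?p ^ n) / h)) - \<phi> x * ((?P (x + h) - ?P x) / h)"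
        using h by (simp add: field_simps)
      also have "\<phi> x * ((?a - ?b) / h) = - (\<phi>' x * ?\<omega>)" using crit by linarith
      finally show ?thesis by simp
    qed
    have 1: "\<bar>?q ^ n * (\<phi>' x * ?\<omega>)\<bar> \<le> K0 * E t"
    proof -
      have "\<bar>?q ^ n * (\<phi>' x * ?\<omega>)\<bar> = \<phi>' x * \<bar>?q ^ n * ?\<omega>\<bar>"
        using \<phi>'_bounds(1)[of x] by (simp add: abs_mult)
      also have "\<dots> \<le> \<phi> x * \<bar>?q ^ n * ?\<omega>\<bar>"
        by (intro mult_right_mono \<phi>'_bounds) auto
      also have "\<dots> \<le> K0 * E t" by (intro adv t D_bd h)
      finally show ?thesis .
    qed
    have 2: "\<bar>\<phi> x * (?b * ((?q ^ n - ?p ^ n) / h))\<bar> \<le> K0 * E t"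
    proof -
      obtain y where y: "?\<omega> = u\<^sub>x t y"
        unfolding D_def by (rule difference_quotient_mean[OF t h])
      have "\<bar>(?q ^ n - ?p ^ n) / h\<bar> \<le> real n * M ^ (n - 1) * \<bar>?q - ?p\<bar> / h"
        using abs_power_diff_le[OF u_le[OF t, of "x + h"] u_le[OF t, of x], of n] h
        by (simp add: abs_divide divide_right_mono)
      also have "\<dots> = real n * M ^ (n - 1) * \<bar>?\<omega>\<bar>" using h by (simp add: D_def abs_divide)
      also have "\<dots> \<le> real n * M ^ (n - 1) * M"
        unfolding y using M by (intro mult_left_mono u_x_le t) auto
      also have "\<dots> = real n * M ^ n" using n by (simp add: mult.assoc flip: power_Suc2)
      finally have q: "\<bar>(?q ^ n - ?p ^ n) / h\<bar> \<le> real n * M ^ n" .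
      have "\<bar>\<phi> x * (?b * ((?q ^ n - ?p ^ n) / h))\<bar> = (\<phi> x * \<bar>?b\<bar>) * \<bar>(?q ^ n - ?p ^ n) / h\<bar>"
        unfolding phi_abs by (simp add: abs_mult)
      also have "\<dots> \<le> E t * (real n * M ^ n)"
        using q ap(2)[OF t, of x] Epos by (intro mult_mono) auto
      also have "\<dots> \<le> E t * K0" using Epos by (intro mult_left_mono K0_ge) auto
      finally show ?thesis by (simp add: mult.commute)
    qed
    have 3: "\<bar>\<phi> x * ((?P (x + h) - ?P x) / h)\<bar> \<le> K0 * E t + K0 * E t"
    proof -
      have "\<bar>\<phi> x * ((?P (x + h) - ?P x) / h)\<bar> \<le> \<phi> x * (\<bar>inv_helmholtz (src t) z\<bar> + \<bar>src t z\<bar>)"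
        unfolding Pq phi_abs using \<phi>_pos[of x] by (intro mult_left_mono) auto
      also have "\<dots> \<le> \<phi> z * (\<bar>inv_helmholtz (src t) z\<bar> + \<bar>src t z\<bar>)"
        using z by (intro mult_right_mono \<phi>_mono) auto
      also have "\<dots> \<le> K0 * E t + K0 * E t"
        unfolding distrib_left by (intro add_mono sw t)
      finally show ?thesis .
    qed
    have "K0 * E t > 0" using K0_pos Epos by simp
    then have "\<bar>?w\<bar> < c' t" unfolding split c'_def using 1 2 3 by linarith
    then have "sgn (\<phi> x * ?\<omega>) * ?w < c' t" using sgn_mult_le[of "\<phi> x * ?\<omega>" ?w] by linarith
    moreover have "((\<lambda>\<tau>. \<phi> x * D h \<tau> x) has_real_derivative ?w) (at t within {0..T})"
      unfolding D_def using h by (auto intro!: derivative_eq_intros u_t[OF t])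
    ultimately show "\<exists>w. ((\<lambda>\<tau>. \<phi> x * D h \<tau> x) has_real_derivative w) (at t within {0..T}) \<and> sgn (\<phi> x * D h t x) * w < c' t"
      by blast
  qed (use cd cnn t in auto)
  \<comment> \<open>The bound is uniform in h > 0, hence passes to \<open>u\<^sub>x\<close> as h
    tends to 0.\<close>
  have "((\<lambda>h. \<phi> x * \<bar>D h t x\<bar>) \<longlongrightarrow> \<phi> x * \<bar>u\<^sub>x t x\<bar>) (at_right 0)"
  proof (intro tendsto_intros)
    show "((\<lambda>h. D h t x) \<longlongrightarrow> u\<^sub>x t x) (at_right 0)"
      using u_x[OF t, of x] unfolding D_def DERIV_def by (rule filterlim_mono) (auto simp: at_le)
  qed
  then have "\<phi> x * \<bar>u\<^sub>x t x\<bar> \<le> c t"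
  proof (rule tendsto_upperbound)
    show "\<forall>\<^sub>F h in at_right 0. \<phi> x * \<bar>D h t x\<bar> \<le> c t"
      using ux_bd[OF _ t, of _ x] unfolding phi_abs
      by (auto simp: eventually_at_filter)
  qed auto
  then show "\<phi> x * \<bar>u\<^sub>x t x\<bar> \<le> B\<^sub>0 + \<Lambda> / 2 * exp (rate * t)" by (simp add: c_def)
qed

text \<open>The least admissible \<Lambda> is the supremum of the rescaled weighted sizes, finite
  because \<open>\<phi>\<close> \<le> 1 / \<epsilon> and because \<open>M\<close> bounds u and
  \<open>u\<^sub>x\<close>. Finiteness allows \<Lambda> \<le> \<open>B\<^sub>0\<close> + \<Lambda> /
  2 to be solved for \<Lambda>; the result contains no \<epsilon>.\<close>

lemma persistence:
  assumes B0: "B\<^sub>0 \<ge> 0"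
    and init: "\<And>x. \<phi> x * \<bar>u 0 x\<bar> \<le> B\<^sub>0" "\<And>x. \<phi> x * \<bar>u\<^sub>x 0 x\<bar> \<le> B\<^sub>0"
    and t: "t \<in> {0..T}"
  shows "\<phi> x * \<bar>u t x\<bar> \<le> 2 * B\<^sub>0 * exp (rate * t)"
    and "\<phi> x * \<bar>u\<^sub>x t x\<bar> \<le> 2 * B\<^sub>0 * exp (rate * t)"
proof -
  define w where "w = \<phi>"
  define r where "r = rate"
  have r: "r \<ge> 0" using K0_pos by (simp add: r_def rate_def)
  have w: "w x > 0" "w x \<le> 1 / \<epsilon>" for x
    using \<phi>_pos \<phi>_le by (simp_all add: w_def)
  define g where "g = (\<lambda>t x. exp (- (r * t)) * (w x * max \<bar>u t x\<bar> \<bar>u\<^sub>x t x\<bar>))"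
  define S where "S = (\<lambda>(t, x). g t x) ` ({0..T} \<times> UNIV)"
  define \<Lambda> where "\<Lambda> = Sup S"
  have g_le: "g t x \<le> M / \<epsilon>" if "t \<in> {0..T}" for t x
  proof -
    have "g t x \<le> 1 * (1 / \<epsilon> * M)"
      unfolding g_def using that r w[of x] \<epsilon> M u_le[OF that, of x] u_x_le[OF that, of x]
      by (intro mult_mono) (auto intro!: mult_nonneg_nonneg)
    then show ?thesis by simp
  qed
  have bdd: "bdd_above S" using g_le by (auto simp: S_def intro!: bdd_aboveI[of _ "M / \<epsilon>"])
  have ne: "S \<noteq> {}" using T by (auto simp: S_def)
  have g\<Lambda>: "g t x \<le> \<Lambda>" if "t \<in> {0..T}" for t x
    unfolding \<Lambda>_def by (rule cSup_upper[OF _ bdd]) (use that in \<open>auto simp: S_def\<close>)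
  have g0: "g t x \<ge> 0" for t x using w[of x] by (auto simp: g_def intro!: mult_nonneg_nonneg)
  have \<Lambda>: "\<Lambda> \<ge> 0" using g\<Lambda>[of 0 0] g0[of 0 0] T by auto
  have unscale: "g t x \<le> a \<longleftrightarrow> w x * max \<bar>u t x\<bar> \<bar>u\<^sub>x t x\<bar> \<le> a * exp (r * t)" for t x a
    by (simp add: g_def exp_minus field_simps)
  have max_iff: "w x * max p q \<le> a \<longleftrightarrow> w x * p \<le> a \<and> w x * q \<le> a" for x p q a
    using w(1)[of x] by (simp add: max_mult_distrib_left)
  have ap: "w x * \<bar>u t x\<bar> \<le> \<Lambda> * exp (r * t)" "w x * \<bar>u\<^sub>x t x\<bar> \<le> \<Lambda> * exp (r * t)" if "t \<in> {0..T}" for t x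
    using g\<Lambda>[OF that, of x] unfolding unscale max_iff by auto
  have "\<Lambda> \<le> B\<^sub>0 + \<Lambda> / 2"
    unfolding \<Lambda>_def
  proof (rule cSup_least[OF ne])
    fix a assume "a \<in> S"
    then obtain t x where t: "t \<in> {0..T}" and a: "a = g t x" by (auto simp: S_def)
    note st = persistence_step[OF \<Lambda> B0 init, folded w_def r_def, OF ap t, of x]
    have "B\<^sub>0 + \<Lambda> / 2 * exp (r * t) \<le> (B\<^sub>0 + \<Lambda> / 2) * exp (r * t)"
      using t r B0 by (simp add: distrib_right mult_left_le_one_le mult_le_cancel_left1)
    then have "g t x \<le> B\<^sub>0 + \<Lambda> / 2"
      unfolding unscale max_iff using st by linarith
    then show "a \<le> B\<^sub>0 + Sup S / 2" by (simp add: a \<Lambda>_def)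
  qed
  then have "\<Lambda> \<le> 2 * B\<^sub>0" by simp
  then have "g t x \<le> 2 * B\<^sub>0" using g\<Lambda>[OF t, of x] by linarith
  then show "\<phi> x * \<bar>u t x\<bar> \<le> 2 * B\<^sub>0 * exp (rate * t)"
    "\<phi> x * \<bar>u\<^sub>x t x\<bar> \<le> 2 * B\<^sub>0 * exp (rate * t)"
    unfolding unscale max_iff by (auto simp: w_def r_def)
qed

end

section \<open>Exponential decay without regularisation\<close>

lemma exponential_decay:
  assumes \<alpha>: "0 < \<alpha>" "\<alpha> < 1" and B: "B \<ge> 0"
    and init: "\<And>x. \<bar>u 0 x\<bar> \<le> B * exp (- \<alpha> * x)" "\<And>x. \<bar>u\<^sub>x 0 x\<bar> \<le> B * exp (- \<alpha> * x)"
    and t: "t \<in> {0..T}"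
  shows "\<bar>u t x\<bar> \<le> 2 * B * exp (rate \<alpha> * T) * exp (- \<alpha> * x)"
    and "\<bar>u\<^sub>x t x\<bar> \<le> 2 * B * exp (rate \<alpha> * T) * exp (- \<alpha> * x)"
proof -
  define C where "C = 2 * B * exp (rate \<alpha> * T)"
  have C: "C \<ge> 0" using B by (simp add: C_def)
  have lim: "\<bar>u t x\<bar> \<le> C * (exp (- \<alpha> * x) + \<epsilon>) \<and> \<bar>u\<^sub>x t x\<bar> \<le> C * (exp (- \<alpha> * x) + \<epsilon>)" if \<epsilon>: "\<epsilon> > 0" for \<epsilon>
  proof -
    \<comment> \<open>\<open>\<phi>\<close> is at most exp (\<alpha> x), so exponential decay of the
      data bounds their weighted size for every \<epsilon>.\<close>
    have i: "\<phi> \<alpha> \<epsilon> x * \<bar>v\<bar> \<le> B" if "\<bar>v\<bar> \<le> B * exp (- \<alpha> * x)" for v x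
      unfolding weighted_le_iff[OF \<alpha> \<epsilon>] using that B \<epsilon> by (simp add: distrib_left add_increasing2)
    note p = persistence[OF \<alpha> \<epsilon> B i[OF init(1)] i[OF init(2)] t, of x]
    have "rate \<alpha> \<ge> 0" using K0_pos[OF \<alpha> \<epsilon>] by (simp add: rate_def[OF \<alpha> \<epsilon>])
    then have "2 * B * exp (rate \<alpha> * t) \<le> C"
      unfolding C_def using B t by (intro mult_left_mono) (auto intro: mult_left_mono)
    then show ?thesis
      unfolding weighted_le_iff[OF \<alpha> \<epsilon>, symmetric] using p by linarith
  qed
  have *: "v \<le> C * exp (- \<alpha> * x)" if v: "\<And>\<epsilon>. \<epsilon> > 0 \<Longrightarrow> v \<le> C * (exp (- \<alpha> * x) + \<epsilon>)" for v
  proof (rule field_le_epsilon)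
    fix e :: real assume e: "e > 0"
    \<comment> \<open>The divisor is C + 1 instead of C since C may be 0.\<close>
    have "v \<le> C * (exp (- \<alpha> * x) + e / (C + 1))" using e C by (intro v) auto
    also have "\<dots> = C * exp (- \<alpha> * x) + C / (C + 1) * e" by (simp add: distrib_left)
    also have "\<dots> \<le> C * exp (- \<alpha> * x) + e"
      using e C by (intro add_left_mono mult_left_le_one_le) auto
    finally show "v \<le> C * exp (- \<alpha> * x) + e" .
  qed
  show "\<bar>u t x\<bar> \<le> 2 * B * exp (rate \<alpha> * T) * exp (- \<alpha> * x)"
    "\<bar>u\<^sub>x t x\<bar> \<le> 2 * B * exp (rate \<alpha> * T) * exp (- \<alpha> * x)"
    using *[of "\<bar>u t x\<bar>"] *[of "\<bar>u\<^sub>x t x\<bar>"] lim unfolding C_def by blast+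
qed

text \<open>Zero data decay with constant B = 0, so the persistence bound is 0 too; the rate 1/2 is
  an arbitrary choice from (0, 1).\<close>

lemma zero_if_initially_zero:
  assumes z: "\<And>x. u 0 x = 0" and t: "t \<in> {0..T}"
  shows "u t x = 0"
proof -
  have t0: "0 \<in> {0..T}" using T by simp
  have "u\<^sub>x 0 x = 0" for x
  proof -
    have "u 0 = (\<lambda>x. 0)" using z by auto
    then show ?thesis using u_x[OF t0, of x] DERIV_unique DERIV_const by metis
  qed
  then have "\<bar>u t x\<bar> \<le> 2 * 0 * exp (rate (1 / 2) * T) * exp (- (1 / 2) * x)"
    using z by (intro exponential_decay t) auto
  then show ?thesis by simp
qed

section \<open>From decay at two times to vanishing initial data\<close>

lemma bounded_exp_decay:
  fixes g :: "real \<Rightarrow> real"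
  assumes l: "((\<lambda>x. \<bar>g x\<bar> / exp (- \<gamma> * x)) \<longlongrightarrow> L) at_top" and g: "\<And>x. \<bar>g x\<bar> \<le> K"
    and "0 < \<alpha>" "\<alpha> \<le> \<gamma>"
  obtains B where "B \<ge> 0" "\<And>x. \<bar>g x\<bar> \<le> B * exp (- \<alpha> * x)"
proof -
  have K: "K \<ge> 0" using g[of 0] by linarith
  have "\<forall>\<^sub>F x in at_top. \<bar>g x\<bar> / exp (- \<gamma> * x) < \<bar>L\<bar> + 1"
    using l by (rule order_tendstoD) linarith
  then obtain X where X: "\<And>x. x \<ge> X \<Longrightarrow> \<bar>g x\<bar> / exp (- \<gamma> * x) < \<bar>L\<bar> + 1"
    by (auto simp: eventually_at_top_linorder)
  \<comment> \<open>Comparing exp (- \<gamma> x) with exp (- \<alpha> x) takes x \<ge> 0.\<close>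
  define Y where "Y = max X 0"
  \<comment> \<open>The first two summands serve x \<ge> Y. To the left of Y, exp (\<alpha> (Y - x))
    \<ge> 1 lets the global bound \<open>K\<close> suffice.\<close>
  define B where "B = \<bar>L\<bar> + 1 + K * exp (\<alpha> * Y)"
  have "\<bar>g x\<bar> \<le> B * exp (- \<alpha> * x)" for x
  proof (cases "x \<ge> Y")
    case True
    then have "\<bar>g x\<bar> \<le> (\<bar>L\<bar> + 1) * exp (- \<gamma> * x)"
      using X[of x] by (simp add: Y_def pos_divide_less_eq)
    also have "\<dots> \<le> (\<bar>L\<bar> + 1) * exp (- \<alpha> * x)"
      using True assms by (intro mult_left_mono) (auto simp: Y_def intro: mult_right_mono)
    also have "\<dots> \<le> B * exp (- \<alpha> * x)" using K by (intro mult_right_mono) (auto simp: B_def)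
    finally show ?thesis .
  next
    case False
    have "\<bar>g x\<bar> \<le> K * 1" using g by simp
    also have "\<dots> \<le> K * (exp (\<alpha> * Y) * exp (- \<alpha> * x))"
      using K False assms by (intro mult_left_mono) (auto simp: mult_exp_exp)
    also have "\<dots> \<le> B * exp (- \<alpha> * x)" unfolding mult.assoc[symmetric] by (intro mult_right_mono) (auto simp: B_def)
    finally show ?thesis .
  qed
  moreover have "B \<ge> 0" using K by (simp add: B_def)
  ultimately show thesis by (rule that[rotated])
qed

text \<open>Multiplied by exp x, the nonlocal term isolates half the integral of exp y F over y
  \<le> x, up to terms vanishing as x grows. Nonnegativity of F excludes cancellation between times,
  so positivity near a single point during a short time already contradicts that exp x u tends to 0
  at both times.\<close>

theorem initially_zero:
  assumes odd: "odd n" and \<alpha>: "1 / (real n + 1) < \<alpha>" "\<alpha> < 1"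
    and u0: "((\<lambda>x. \<bar>u 0 x\<bar> / exp (- 1 * x)) \<longlongrightarrow> 0) at_top"
    and ux0: "((\<lambda>x. \<bar>u\<^sub>x 0 x\<bar> / exp (- \<alpha> * x)) \<longlongrightarrow> L) at_top"
    and t1: "t\<^sub>1 \<in> {0..T}" "t\<^sub>1 > 0"
    and u1: "((\<lambda>x. \<bar>u t\<^sub>1 x\<bar> / exp (- 1 * x)) \<longlongrightarrow> 0) at_top"
  shows "u 0 y = 0"
proof (rule ccontr)
  assume nz: "u 0 y \<noteq> 0"
  have t0: "0 \<in> {0..T}" using T by simp
  have \<alpha>0: "\<alpha> > 0" using \<alpha>(1) by (smt (verit) of_nat_0_le_iff zero_le_divide_1_iff)
  define \<beta> where "\<beta> = (real n + 1) * \<alpha>"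
  have \<beta>: "\<beta> > 1" using \<alpha>(1) by (simp add: \<beta>_def field_simps)
  obtain B1 where B1: "B1 \<ge> 0" "\<And>x. \<bar>u 0 x\<bar> \<le> B1 * exp (- \<alpha> * x)"
    using bounded_exp_decay[OF u0 u_le[OF t0], of \<alpha>] \<alpha> \<alpha>0 by auto
  obtain B2 where B2: "B2 \<ge> 0" "\<And>x. \<bar>u\<^sub>x 0 x\<bar> \<le> B2 * exp (- \<alpha> * x)"
    using bounded_exp_decay[OF ux0 u_x_le[OF t0], of \<alpha>] \<alpha> \<alpha>0 by auto
  define C where "C = 2 * max B1 B2 * exp (rate \<alpha> * T)"
  have C: "C \<ge> 0" using B1 by (simp add: C_def)
  have dec: "\<bar>u t x\<bar> \<le> C * exp (- \<alpha> * x)" "\<bar>u\<^sub>x t x\<bar> \<le> C * exp (- \<alpha> * x)" if "t \<in> {0..T}" for t x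
  proof -
    have "B1 * exp (- \<alpha> * x) \<le> max B1 B2 * exp (- \<alpha> * x)" "B2 * exp (- \<alpha> * x) \<le> max B1 B2 * exp (- \<alpha> * x)" for x
      by (intro mult_right_mono; simp)+
    then have i: "\<bar>u 0 x\<bar> \<le> max B1 B2 * exp (- \<alpha> * x)" "\<bar>u\<^sub>x 0 x\<bar> \<le> max B1 B2 * exp (- \<alpha> * x)" for x
      using B1(2) B2(2) by (blast intro: order_trans)+
    have m: "max B1 B2 \<ge> 0" using B1 by simp
    show "\<bar>u t x\<bar> \<le> C * exp (- \<alpha> * x)" "\<bar>u\<^sub>x t x\<bar> \<le> C * exp (- \<alpha> * x)"
      unfolding C_def using exponential_decay[OF \<alpha>0 \<alpha>(2) m i that] by auto
  qed
  have pow: "(C * exp (- \<alpha> * x)) ^ n * (C * exp (- \<alpha> * x)) = C ^ (n + 1) * exp (- \<beta> * x)" for x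
  proof -
    have "(C * exp (- \<alpha> * x)) ^ n * (C * exp (- \<alpha> * x)) = (C * exp (- \<alpha> * x)) ^ (n + 1)" by simp
    also have "\<dots> = C ^ (n + 1) * exp (real (n + 1) * (- \<alpha> * x))"
      by (simp only: power_mult_distrib exp_of_nat_mult)
    also have "real (n + 1) * (- \<alpha> * x) = - \<beta> * x" by (simp add: \<beta>_def)
    finally show ?thesis .
  qed
  have adv: "\<bar>u t x ^ n * u\<^sub>x t x\<bar> \<le> C ^ (n + 1) * exp (- \<beta> * x)" if t: "t \<in> {0..T}" for t x
    unfolding abs_mult power_abs pow[symmetric] using dec[OF t] C by (intro mult_mono power_mono) auto
  define C2 where "C2 = 2 * real n * C ^ (n + 1)"
  have C2: "C2 \<ge> 0" using C by (simp add: C2_def)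
  have src_dec: "\<bar>src t x\<bar> \<le> C2 * exp (- \<beta> * x)" if t: "t \<in> {0..T}" for t x
    using abs_gCH_source_le[OF n dec[OF t, of x] dec[OF t, of x]] pow[of x]
    by (simp only: C2_def mult.assoc)
  have src_nn: "src t x \<ge> real n * (real n + 3) / (2 * (real n + 1)) * \<bar>u t x\<bar> ^ (n + 1)" for t x
    by (rule gCH_source_ge[OF odd])
  have src_nn0: "src t x \<ge> 0" for t x
    by (rule order_trans[OF _ src_nn]) simp
  \<comment> \<open>One quarter is spent on moving in time, one on moving in space; at least 2 d
    remains.\<close>
  define d where "d = \<bar>u 0 y\<bar> / 4"
  have d: "d > 0" using nz by (simp add: d_def)
  have "isCont (u 0) y" using u_cont[OF t0] by (simp add: continuous_on_eq_continuous_at)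
  then obtain \<delta> where \<delta>: "\<delta> > 0" "\<And>z. \<bar>z - y\<bar> < \<delta> \<Longrightarrow> \<bar>u 0 z - u 0 y\<bar> < d"
    using d unfolding continuous_at_eps_delta dist_real_def by blast
  obtain \<tau>' where \<tau>': "\<tau>' > 0" "\<And>t. t \<in> {0..T} \<Longrightarrow> t \<noteq> 0 \<Longrightarrow> \<bar>t\<bar> < \<tau>' \<Longrightarrow> \<forall>x. \<bar>u t x - u 0 x\<bar> \<le> d"
    using unif[OF t0 d] by (auto simp: eventually_at dist_real_def)
  \<comment> \<open>Halving makes \<tau> < \<tau>' strict; the cap at \<open>t\<^sub>1\<close> keeps
    the phase of definite growth between the two times compared.\<close>
  define \<tau> where "\<tau> = min (\<tau>' / 2) t\<^sub>1"
  have \<tau>: "0 < \<tau>" "\<tau> \<le> t\<^sub>1" "\<tau> < \<tau>'" using \<tau>' t1 by (auto simp: \<tau>_def min_def)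
  define \<kappa> where "\<kappa> = real n * (real n + 3) / (2 * (real n + 1)) * d ^ (n + 1)"
  have \<kappa>: "\<kappa> > 0" using d n by (simp add: \<kappa>_def)
  have src_ge: "src t z \<ge> \<kappa>" if t: "t \<in> {0..\<tau>}" and z: "z \<in> {y..y + \<delta> / 2}" for t z
  proof -
    have "\<bar>u t z - u 0 z\<bar> \<le> d"
    proof (cases "t = 0")
      case False
      then show ?thesis using \<tau>'(2)[of t] t \<tau> t1 by auto
    qed (use d in simp)
    moreover have "\<bar>u 0 z - u 0 y\<bar> < d" using z \<delta>(1) by (intro \<delta>) auto
    ultimately have "d \<le> \<bar>u t z\<bar>" unfolding d_def by linarith
    then have "\<kappa> \<le> real n * (real n + 3) / (2 * (real n + 1)) * \<bar>u t z\<bar> ^ (n + 1)"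
      unfolding \<kappa>_def using d by (intro mult_left_mono power_mono) auto
    then show ?thesis using src_nn[of t z] by linarith
  qed
  \<comment> \<open>Lower bound for the half-line integral over an interval of length \<delta> / 2;
    the last factor 1/2 is that of the kernel.\<close>
  define k where "k = \<kappa> * exp y * (\<delta> / 2) / 2"
  have k: "k > 0" using \<kappa> \<delta> by (simp add: k_def)
  define \<zeta> where "\<zeta> = (\<lambda>x t. exp x * u t x)"
  define \<zeta>' where "\<zeta>' = (\<lambda>x t. exp x * (- (u t x ^ n * u\<^sub>x t x) - inv_helmholtz' (src t) x))"
  define C3 where "C3 = C ^ (n + 1) + C2"
  \<comment> \<open>Bounds advection and the right half of the convolution, both of order exp (-
    \<beta> x) before multiplication by exp x. It is uniform in t and tends to 0 because \<beta> >
    1.\<close>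
  define \<eta> where "\<eta> = (\<lambda>x. C3 * exp ((1 - \<beta>) * x))"
  have C3: "C3 \<ge> 0" using C C2 by (simp add: C3_def)
  have \<zeta>'_ge: "\<zeta>' x t \<ge> lower_exp_integral (src t) x / 2 - \<eta> x" if t: "t \<in> {0..T}" for x t
  proof -
    let ?A = "lower_exp_integral (src t) x" and ?R = "lower_exp_integral (\<lambda>y. src t (- y)) (- x)"
    have c': "continuous_on UNIV (\<lambda>y. src t (- y))"
      by (rule continuous_on_compose2[OF src_cont[OF t]]) (intro continuous_intros | simp)+
    \<comment> \<open>Reflection turns decay into growth: the bound is applied with exponent -
      \<beta>, which is below 1 as required.\<close>
    have "\<bar>?R\<bar> \<le> C2 * (exp ((1 - (- \<beta>)) * (- x)) / (1 - (- \<beta>))) + 0 * exp (- x)"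
      by (rule lower_exp_integral_bound[OF c' src_le[OF t]]) (use src_dec[OF t, of "- _"] \<beta> in auto)
    then have "?R \<le> C2 * (exp (- (1 + \<beta>) * x) / (1 + \<beta>))" by (simp add: algebra_simps)
    also have "\<dots> \<le> C2 * exp (- (1 + \<beta>) * x)"
      using C2 \<beta> by (intro mult_left_mono) (auto simp: divide_le_eq)
    finally have "exp (2 * x) * ?R \<le> exp (2 * x) * (C2 * exp (- (1 + \<beta>) * x))"
      by (intro mult_left_mono) auto
    also have "\<dots> = C2 * exp ((1 - \<beta>) * x)"
    proof -
      have "exp (2 * x) * exp (- (1 + \<beta>) * x) = exp ((1 - \<beta>) * x)"
        by (simp add: mult_exp_exp algebra_simps)
      then show ?thesis by (simp add: mult.left_commute)
    qed
    finally have R: "exp (2 * x) * ?R \<le> C2 * exp ((1 - \<beta>) * x)" .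
    have "exp x * inv_helmholtz' (src t) x = (exp (2 * x) * ?R - ?A) / 2"
    proof -
      have "exp x * exp x = exp (2 * x)" "exp x * exp (- x) = 1" by (simp_all add: mult_exp_exp)
      then show ?thesis
        unfolding inv_helmholtz'_def by (simp add: right_diff_distrib mult.assoc[symmetric])
    qed
    note helmholtz = this
    have "exp x * (u t x ^ n * u\<^sub>x t x) \<le> C ^ (n + 1) * exp ((1 - \<beta>) * x)"
    proof -
      have "exp x * (u t x ^ n * u\<^sub>x t x) \<le> exp x * (C ^ (n + 1) * exp (- \<beta> * x))"
        using adv[OF t, of x] by (intro mult_left_mono) auto
      also have "\<dots> = C ^ (n + 1) * (exp x * exp (- \<beta> * x))" by (rule mult.left_commute)
      also have "exp x * exp (- \<beta> * x) = exp ((1 - \<beta>) * x)" by (simp add: mult_exp_exp algebra_simps)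
      finally show ?thesis .
    qed
    note advection = this
    have \<zeta>'_eq: "\<zeta>' x t = - (exp x * (u t x ^ n * u\<^sub>x t x)) - exp x * inv_helmholtz' (src t) x"
      by (simp add: \<zeta>'_def right_diff_distrib)
    have nn: "C2 * exp ((1 - \<beta>) * x) \<ge> 0" using C2 by simp
    have "A / 2 - (r + r') \<le> z" if "z = - a - p" "p = (q - A) / 2" "a \<le> r" "q \<le> r'" "r' \<ge> 0"
      for z a p q r r' A :: real unfolding that(1,2) using that(3-5) by argo
    from this[OF \<zeta>'_eq helmholtz advection R nn] show ?thesis
      unfolding \<eta>_def C3_def distrib_right .
  qed
  have \<zeta>_d: "(\<zeta> x has_real_derivative \<zeta>' x t) (at t within {a..b})" if "t \<in> {0..T}" "{a..b} \<subseteq> {0..T}" for x t a b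
    unfolding \<zeta>_def \<zeta>'_def by (rule DERIV_cmult[OF DERIV_subset[OF u_t[OF that(1)] that(2)]])
  \<comment> \<open>Growth at rate at least k - \<eta> on [0, \<tau>]; afterwards nonnegativity of
    the source leaves at most the error \<eta> to be lost.\<close>
  have incr: "\<zeta> x t\<^sub>1 - \<zeta> x 0 \<ge> k * \<tau> - \<eta> x * t\<^sub>1" if x: "x \<ge> y + \<delta> / 2" for x
  proof -
    have "\<zeta> x \<tau> - \<zeta> x 0 \<ge> (k - \<eta> x) * (\<tau> - 0)"
    proof (rule increment_ge)
      fix t assume t: "t \<in> {0..\<tau>}"
      then have t': "t \<in> {0..T}" using \<tau> t1 by auto
      show "(\<zeta> x has_real_derivative \<zeta>' x t) (at t within {0..\<tau>})"
        using t' \<tau> t1 by (intro \<zeta>_d) auto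
      have "\<kappa> * exp y * (y + \<delta> / 2 - y) \<le> lower_exp_integral (src t) x"
        using src_ge[OF t] \<delta> \<kappa> x
        by (intro lower_exp_integral_ge[OF src_cont[OF t'] src_le[OF t'] src_nn0]) auto
      then show "k - \<eta> x \<le> \<zeta>' x t" using \<zeta>'_ge[OF t', of x] by (simp add: k_def)
    qed (use \<tau> in simp)
    moreover have "\<zeta> x t\<^sub>1 - \<zeta> x \<tau> \<ge> - \<eta> x * (t\<^sub>1 - \<tau>)"
    proof (rule increment_ge)
      fix t assume t: "t \<in> {\<tau>..t\<^sub>1}"
      then have t': "t \<in> {0..T}" using \<tau> t1 by auto
      show "(\<zeta> x has_real_derivative \<zeta>' x t) (at t within {\<tau>..t\<^sub>1})"
        using t' \<tau> t1 by (intro \<zeta>_d) auto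
      \<comment> \<open>A degenerate interval: this instance states plain nonnegativity.\<close>
      have "lower_exp_integral (src t) x \<ge> 0 * exp y * (y - y)"
        using x \<delta> src_nn0 by (intro lower_exp_integral_ge[OF src_cont[OF t'] src_le[OF t'] src_nn0]) auto
      then show "- \<eta> x \<le> \<zeta>' x t" using \<zeta>'_ge[OF t', of x] by simp
    qed (use \<tau> in simp)
    ultimately show ?thesis by (simp add: algebra_simps)
  qed
  have \<zeta>_0: "((\<lambda>x. \<zeta> x t) \<longlongrightarrow> 0) at_top" if "((\<lambda>x. \<bar>u t x\<bar> / exp (- 1 * x)) \<longlongrightarrow> 0) at_top" for t
  proof (rule tendsto_rabs_zero_cancel)
    have "(\<lambda>x. \<bar>u t x\<bar> / exp (- 1 * x)) = (\<lambda>x. \<bar>\<zeta> x t\<bar>)"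
      by (simp add: \<zeta>_def abs_mult exp_minus field_simps)
    then show "((\<lambda>x. \<bar>\<zeta> x t\<bar>) \<longlongrightarrow> 0) at_top" using that by simp
  qed
  have "(\<eta> \<longlongrightarrow> C3 * 0) at_top"
    unfolding \<eta>_def
  proof (intro tendsto_mult tendsto_const filterlim_compose[OF exp_at_bot])
    show "filterlim (\<lambda>x. (1 - \<beta>) * x) at_bot at_top"
      using \<beta> by (intro filterlim_tendsto_neg_mult_at_bot[OF tendsto_const _ filterlim_ident]) simp
  qed
  then have lower: "((\<lambda>x. k * \<tau> - \<eta> x * t\<^sub>1) \<longlongrightarrow> k * \<tau> - C3 * 0 * t\<^sub>1) at_top"
    by (intro tendsto_intros)
  have "((\<lambda>x. \<zeta> x t\<^sub>1 - \<zeta> x 0) \<longlongrightarrow> 0 - 0) at_top"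
    by (intro tendsto_diff \<zeta>_0 u0 u1)
  from tendsto_le[OF trivial_limit_at_top_linorder this lower]
  have "k * \<tau> - C3 * 0 * t\<^sub>1 \<le> 0 - 0"
    using incr by (auto simp: eventually_at_top_linorder)
  then show False using k \<tau> by (simp add: mult_le_0_iff)
qed

end

section \<open>From Sobolev to classical solutions\<close>

text \<open>The time derivative is a limit in H^(s-1) and the equation holds almost everywhere. As s
  - 1 > 1/2, the embedding, applied to the difference quotient minus the continuous right-hand side,
  turns convergence in norm into convergence at every x.\<close>

lemma gCH_solution_classical:
  fixes n :: nat and s T :: real and u :: "real \<Rightarrow> real \<Rightarrow> real"
  assumes n: "n \<ge> 1" and T: "T > 0" and s: "s > 3 / 2" and sol: "gCH_solution n s {0..T} u"
  obtains M where "gCH_classical n T M u (\<lambda>t. deriv (u t))"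
proof -
  let ?I = "{0..T}"
  have cont: "continuous_on UNIV (u t)" if "t \<in> ?I" for t
    using sol that by (simp add: gCH_solution_def)
  have Hs: "u t \<in> sobolev_space s" if "t \<in> ?I" for t
    using sol that by (simp add: gCH_solution_def C0_sobolev_def)
  have Hs_cont: "((\<lambda>\<tau>. sobolev_norm s (\<lambda>x. u \<tau> x - u t x)) \<longlongrightarrow> 0) (at t within ?I)" if "t \<in> ?I" for t
    using sol that by (simp add: gCH_solution_def C0_sobolev_def)
  obtain v where v: "has_sobolev_time_derivative ?I (s - 1) u v"
    and pde: "\<And>t. t \<in> ?I \<Longrightarrow> AE x in lborel. v t x + u t x ^ n * deriv (u t) x
          + deriv (inv_helmholtz (\<lambda>y. gCH_source n (u t y) (deriv (u t) y))) x = 0"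
    using sol by (auto simp: gCH_solution_def gCH_source_def)
  have in_I: "\<forall>\<^sub>F \<tau> in at t within ?I. \<tau> \<in> ?I" for t
    by (auto simp: eventually_at_filter)
  define K where "K = embedding_const s + embedding_const (s - 1)"
  have ec: "embedding_const \<sigma> \<ge> 0" for \<sigma> by (simp add: embedding_const_def)
  have K: "K \<ge> 0" using ec by (simp add: K_def)
  have emb: "\<bar>f x\<bar> \<le> K * sobolev_norm s f" "\<bar>deriv f x\<bar> \<le> K * sobolev_norm s f"
    if "f \<in> sobolev_space s" "continuous_on UNIV f" for f x
  proof -
    have le: "embedding_const s * sobolev_norm s f \<le> K * sobolev_norm s f"
      "embedding_const (s - 1) * sobolev_norm s f \<le> K * sobolev_norm s f"
      by (intro mult_right_mono; simp add: K_def ec sobolev_norm_nonneg)+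
    show "\<bar>f x\<bar> \<le> K * sobolev_norm s f"
      using sobolev_embedding[OF that(1) _ that(2), of x] le s by linarith
    show "\<bar>deriv f x\<bar> \<le> K * sobolev_norm s f"
      using sobolev_embedding_deriv(3)[OF that(1) s that(2), of x] le by linarith
  qed
  have ux: "(u t has_real_derivative deriv (u t) x) (at x)" if "t \<in> ?I" for t x
    by (rule sobolev_embedding_deriv(1)[OF Hs[OF that] s cont[OF that]])
  have ux_cont: "continuous_on UNIV (deriv (u t))" if "t \<in> ?I" for t
    by (rule sobolev_embedding_deriv(2)[OF Hs[OF that] s cont[OF that]])
  have diff: "\<bar>u \<tau> x - u t x\<bar> \<le> K * sobolev_norm s (\<lambda>x. u \<tau> x - u t x)"
    "\<bar>deriv (u \<tau>) x - deriv (u t) x\<bar> \<le> K * sobolev_norm s (\<lambda>x. u \<tau> x - u t x)"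
    if "\<tau> \<in> ?I" "t \<in> ?I" for \<tau> t x
  proof -
    have H: "(\<lambda>x. u \<tau> x - u t x) \<in> sobolev_space s" using that by (intro sobolev_space_diff Hs)
    have c: "continuous_on UNIV (\<lambda>x. u \<tau> x - u t x)" using that by (intro continuous_intros cont)
    have "deriv (\<lambda>x. u \<tau> x - u t x) x = deriv (u \<tau>) x - deriv (u t) x"
      by (intro DERIV_imp_deriv DERIV_diff ux that)
    then show "\<bar>u \<tau> x - u t x\<bar> \<le> K * sobolev_norm s (\<lambda>x. u \<tau> x - u t x)"
      "\<bar>deriv (u \<tau>) x - deriv (u t) x\<bar> \<le> K * sobolev_norm s (\<lambda>x. u \<tau> x - u t x)"
      using emb[OF H c, of x] by simp_all
  qed
  have unif: "\<forall>\<^sub>F \<tau> in at t within ?I. \<forall>x. \<bar>u \<tau> x - u t x\<bar> \<le> e \<and> \<bar>deriv (u \<tau>) x - deriv (u t) x\<bar> \<le> e"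
    if t: "t \<in> ?I" and e: "e > 0" for t e
  proof -
    have "((\<lambda>\<tau>. K * sobolev_norm s (\<lambda>x. u \<tau> x - u t x)) \<longlongrightarrow> K * 0) (at t within ?I)"
      by (intro tendsto_mult tendsto_const Hs_cont t)
    then have "\<forall>\<^sub>F \<tau> in at t within ?I. K * sobolev_norm s (\<lambda>x. u \<tau> x - u t x) < e"
      by (rule order_tendstoD) (use e in simp)
    with in_I show ?thesis
    proof eventually_elim
      case (elim \<tau>)
      then show ?case using diff[OF elim(1) t] by (meson le_less_trans less_imp_le)
    qed
  qed
  \<comment> \<open>Uniformity in time comes from compactness: finitely many neighbourhoods, on each
    of which u and its space derivative stay within 1 of their values at the centre, cover the
    interval.\<close>
  obtain M where M: "M \<ge> 1" "\<And>t x. t \<in> ?I \<Longrightarrow> \<bar>u t x\<bar> \<le> M" "\<And>t x. t \<in> ?I \<Longrightarrow> \<bar>deriv (u t) x\<bar> \<le> M"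
  proof -
    obtain \<delta> where \<delta>: "\<And>t. t \<in> ?I \<Longrightarrow> \<delta> t > 0"
      "\<And>t \<tau> x. t \<in> ?I \<Longrightarrow> \<tau> \<in> ?I \<Longrightarrow> \<bar>\<tau> - t\<bar> < \<delta> t \<Longrightarrow> \<bar>u \<tau> x - u t x\<bar> \<le> 1 \<and> \<bar>deriv (u \<tau>) x - deriv (u t) x\<bar> \<le> 1"
    proof -
      have "\<exists>d>0. \<forall>\<tau>\<in>?I. \<bar>\<tau> - t\<bar> < d \<longrightarrow> (\<forall>x. \<bar>u \<tau> x - u t x\<bar> \<le> 1 \<and> \<bar>deriv (u \<tau>) x - deriv (u t) x\<bar> \<le> 1)"
        if t: "t \<in> ?I" for t
      proof -
        obtain d where "d > 0" "\<And>\<tau>. \<tau> \<in> ?I \<Longrightarrow> \<tau> \<noteq> t \<Longrightarrow> \<bar>\<tau> - t\<bar> < d \<Longrightarrow>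
            \<forall>x. \<bar>u \<tau> x - u t x\<bar> \<le> 1 \<and> \<bar>deriv (u \<tau>) x - deriv (u t) x\<bar> \<le> 1"
          using unif[OF t, of 1] by (auto simp: eventually_at dist_real_def)
        then show ?thesis by (intro exI[of _ d]) (metis abs_zero diff_self zero_le_one)
      qed
      then have "\<exists>\<delta>. \<forall>t\<in>?I. \<delta> t > 0 \<and> (\<forall>\<tau>\<in>?I. \<bar>\<tau> - t\<bar> < \<delta> t \<longrightarrow> (\<forall>x. \<bar>u \<tau> x - u t x\<bar> \<le> 1 \<and> \<bar>deriv (u \<tau>) x - deriv (u t) x\<bar> \<le> 1))"
        by (intro bchoice) blast
      then show thesis using that by blast
    qed
    have "?I \<subseteq> (\<Union>t\<in>?I. ball t (\<delta> t))" using \<delta>(1) by auto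
    then obtain D where D: "D \<subseteq> ?I" "finite D" "?I \<subseteq> (\<Union>t\<in>D. ball t (\<delta> t))"
      by (rule compactE_image[OF compact_Icc, rotated]) auto
    \<comment> \<open>The sum over the finite cover bounds each of its terms; the 1 is the variation
      allowed inside a neighbourhood and also yields M \<ge> 1.\<close>
    define M where "M = (\<Sum>t\<in>D. K * sobolev_norm s (u t)) + 1"
    have nn: "K * sobolev_norm s (u t) \<ge> 0" for t using K sobolev_norm_nonneg by simp
    have "\<bar>u t x\<bar> \<le> M \<and> \<bar>deriv (u t) x\<bar> \<le> M" if t: "t \<in> ?I" for t x
    proof -
      obtain r where r: "r \<in> D" "\<bar>t - r\<bar> < \<delta> r" using D(3) t by (force simp: dist_real_def)
      have rI: "r \<in> ?I" using r D(1) by blast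
      have "K * sobolev_norm s (u r) \<le> (\<Sum>t\<in>D. K * sobolev_norm s (u t))"
        using D(2) r(1) nn by (intro member_le_sum) auto
      then have "\<bar>u r x\<bar> \<le> M - 1" "\<bar>deriv (u r) x\<bar> \<le> M - 1"
        using emb[OF Hs[OF rI] cont[OF rI], of x] unfolding M_def by linarith+
      then show ?thesis using \<delta>(2)[OF rI t r(2), of x] by linarith
    qed
    moreover have "M \<ge> 1" unfolding M_def using nn by (simp add: sum_nonneg)
    ultimately show thesis using that by blast
  qed
  have src_c: "continuous_on UNIV (\<lambda>y. gCH_source n (u t y) (deriv (u t) y))" if "t \<in> ?I" for t
    unfolding gCH_source_def using that by (intro continuous_intros cont ux_cont)
  have src_b: "\<bar>gCH_source n (u t y) (deriv (u t) y)\<bar> \<le> 2 * real n * M ^ n * M" if "t \<in> ?I" for t y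
    using that by (intro abs_gCH_source_le n M)
  have "gCH_classical n T M u (\<lambda>t. deriv (u t))"
  proof
    fix t e :: real assume t: "t \<in> ?I" and e: "e > 0"
    show "\<exists>X. \<forall>x. \<bar>x\<bar> \<ge> X \<longrightarrow> \<bar>u t x\<bar> < e"
      using tendstoD[OF sobolev_tendsto_0[OF Hs[OF t] s cont[OF t]] e] by (simp add: eventually_at_infinity)
    show "\<forall>\<^sub>F \<tau> in at t within ?I. \<forall>x. \<bar>u \<tau> x - u t x\<bar> \<le> e"
      using unif[OF t e] by eventually_elim blast
  next
    fix t x :: real assume t: "t \<in> ?I"
    define f where "f = (\<lambda>x. - (u t x ^ n * deriv (u t) x)
      - inv_helmholtz' (\<lambda>y. gCH_source n (u t y) (deriv (u t) y)) x)"
    note hd = inv_helmholtz_deriv[OF src_c[OF t] src_b[OF t]]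
    have fc: "continuous_on UNIV f"
      unfolding f_def
      by (intro continuous_intros cont ux_cont t continuous_at_imp_continuous_on ballI DERIV_isCont[OF hd(2)])
    have vf: "AE x in lborel. v t x = f x"
      using pde[OF t] unfolding DERIV_imp_deriv[OF hd(1)] f_def by eventually_elim linarith
    have vs: "v t \<in> sobolev_space (s - 1)" and us: "\<And>r. r \<in> ?I \<Longrightarrow> u r \<in> sobolev_space (s - 1)"
      and lim: "((\<lambda>\<tau>. sobolev_norm (s - 1) (\<lambda>x. (u \<tau> x - u t x) / (\<tau> - t) - v t x)) \<longlongrightarrow> 0) (at t within ?I)"
      using v t by (auto simp: has_sobolev_time_derivative_def)
    have "((\<lambda>\<tau>. (u \<tau> x - u t x) / (\<tau> - t) - f x) \<longlongrightarrow> 0) (at t within ?I)"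
    proof (rule Lim_null_comparison)
      show "((\<lambda>\<tau>. embedding_const (s - 1) * sobolev_norm (s - 1) (\<lambda>x. (u \<tau> x - u t x) / (\<tau> - t) - v t x)) \<longlongrightarrow> 0) (at t within ?I)"
        using tendsto_mult_left[OF lim, of "embedding_const (s - 1)"] by simp
      show "\<forall>\<^sub>F \<tau> in at t within ?I. norm ((u \<tau> x - u t x) / (\<tau> - t) - f x)
         \<le> embedding_const (s - 1) * sobolev_norm (s - 1) (\<lambda>x. (u \<tau> x - u t x) / (\<tau> - t) - v t x)"
        using in_I
      proof eventually_elim
        case (elim \<tau>)
        let ?q = "\<lambda>x. (u \<tau> x - u t x) / (\<tau> - t)"
        have qs: "?q \<in> sobolev_space (s - 1)"
          using sobolev_space_cmult[OF sobolev_space_diff[OF us[OF elim] us[OF t]], of "1 / (\<tau> - t)"] by simp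
        have qvs: "(\<lambda>x. ?q x - v t x) \<in> sobolev_space (s - 1)" by (rule sobolev_space_diff[OF qs vs])
        have qc: "continuous_on UNIV (\<lambda>x. ?q x - f x)"
        proof -
          \<comment> \<open>Written as a product with a constant, so that continuity holds whatever
            \<open>\<tau> - t\<close> is, including the default 1 / 0 = 0.\<close>
          have "continuous_on UNIV (\<lambda>x. (u \<tau> x - u t x) * (1 / (\<tau> - t)) - f x)"
            by (intro continuous_intros cont elim t fc)
          then show ?thesis by simp
        qed
        have "AE x in lborel. ?q x - v t x = ?q x - f x"
          using vf by eventually_elim simp
        \<comment> \<open>The embedding requires a continuous function, so \<open>v t\<close> is
          exchanged for \<open>f\<close> inside the norm.\<close>
        note cong = sobolev_cong_AE[OF this sobolev_space_borel_measurable[OF qvs] borel_measurable_continuous_onI[OF qc]]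
        have "(\<lambda>x. ?q x - f x) \<in> sobolev_space (s - 1)" using cong(1) qvs by blast
        from sobolev_embedding[OF this _ qc, of x] show ?case using s cong(2) by simp
      qed
    qed
    then have "((\<lambda>\<tau>. (u \<tau> x - u t x) / (\<tau> - t)) \<longlongrightarrow> f x) (at t within ?I)" by (rule LIM_zero_cancel)
    then show "((\<lambda>\<tau>. u \<tau> x) has_real_derivative - (u t x ^ n * deriv (u t) x)
      - inv_helmholtz' (\<lambda>y. gCH_source n (u t y) (deriv (u t) y)) x) (at t within ?I)"
      unfolding has_field_derivative_iff f_def .
  qed (use n T M ux ux_cont in auto)
  then show thesis by (rule that)
qed

theorem theorem2p4:
  fixes n :: nat and s T\<^sub>0 :: real
    and u :: "real \<Rightarrow> real \<Rightarrow> real" and u\<^sub>0 :: "real \<Rightarrow> real"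
  assumes "n \<ge> 1" and "T\<^sub>0 > 0" and "s > 3 / 2"
    and "gCH_solution n s {0..T\<^sub>0} u"
    and "\<forall>x. u 0 x = u\<^sub>0 x"
    and "odd n"
    and "\<exists>\<alpha>\<in>{1 / (real n + 1)<..<1}.
           sim_smallo_exp u\<^sub>0 (- 1) \<and> sim_bigo_exp (deriv u\<^sub>0) (- \<alpha>)"
    and "\<exists>t\<^sub>1\<in>{0..T\<^sub>0}. t\<^sub>1 > 0 \<and> sim_smallo_exp (u t\<^sub>1) (- 1)"
  shows "\<forall>t\<in>{0..T\<^sub>0}. \<forall>x. u t x = 0"
proof -
  obtain M where "gCH_classical n T\<^sub>0 M u (\<lambda>t. deriv (u t))"
    using gCH_solution_classical[OF assms(1-4)] .
  then interpret gCH_classical n T\<^sub>0 M u "\<lambda>t. deriv (u t)" .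
  have u0: "u 0 = u\<^sub>0" using assms(5) by blast
  obtain \<alpha> L where \<alpha>: "1 / (real n + 1) < \<alpha>" "\<alpha> < 1"
    and 0: "((\<lambda>x. \<bar>u 0 x\<bar> / exp (- 1 * x)) \<longlongrightarrow> 0) at_top"
      "((\<lambda>x. \<bar>deriv (u 0) x\<bar> / exp (- \<alpha> * x)) \<longlongrightarrow> L) at_top"
    using assms(7) unfolding u0 sim_smallo_exp_def sim_bigo_exp_def by auto
  obtain t\<^sub>1 where t1: "t\<^sub>1 \<in> {0..T\<^sub>0}" "t\<^sub>1 > 0" "((\<lambda>x. \<bar>u t\<^sub>1 x\<bar> / exp (- 1 * x)) \<longlongrightarrow> 0) at_top"
    using assms(8) unfolding sim_smallo_exp_def by auto
  have "u 0 y = 0" for y by (rule initially_zero[OF assms(6) \<alpha> 0 t1])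
  then show ?thesis using zero_if_initially_zero by blast
qed

end
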